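(* Let $d\ge 2$. There are (sufficiently small) neighbourhoods $N_1,\dots,N_d$ of the standard basis vectors $e_1,\dots,e_d$ in the unit sphere $\mathbf S^{d-1}\subset\mathbb R^d$, depending only on $d$, with the following property. Call finite families $\mathbb T_1,\dots,\mathbb T_d$ of $\delta$-tubes in $\mathbb R^d$ transversal if for each $1\le j\le d$ every tube in $\mathbb T_j$ has its long side pointing in a direction belonging to $N_j$. (i) If $\frac{d}{d-1}<q\le\infty$ then there exists a constant $C<\infty$, independent of $\delta$ and of the families of tubes, such that for all $0<\delta\le 1$ and all transversal families $\mathbb T_1,\dots,\mathbb T_d$ of $\delta$-tubes, $$\Bigl\|\prod_{j=1}^{d}\Bigl(\sum_{T_j\in\mathbb T_j}\chi_{T_j}\Bigr)\Bigr\|_{L^{q/d}(\mathbb R^d)}\le C\prod_{j=1}^{d}\bigl(\delta^{d/q}\,\#\mathbb T_j\bigr).$$ (ii) For each $\epsilon>0$ there exists a constant $C<\infty$, independent of $\delta$ and of the families of tubes, such that for all $0<\delta\le 1$ and all transversal families $\mathbb T_1,\dots,\mathbb T_d$ of $\delta$-tubes, $$\Bigl\|\prod_{j=1}^{d}\Bigl(\sum_{T_j\in\mathbb T_j}\chi_{T_j}\Bigr)\Bigr\|_{L^{1/(d-1)}(B(0,1))}\le C\delta^{-\epsilon}\prod_{j=1}^{d}\bigl(\delta^{d-1}\,\#\mathbb T_j\bigr).$$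
   Context: A $\delta$-tube in $\mathbb R^d$ is a rectangular box (of arbitrary position and orientation) with $d-1$ sides of length $\delta$ and one side of length $1$ (the long side). $\chi_T$ denotes the indicator function of $T$, and $\#\mathbb T$ the cardinality of $\mathbb T$. Tubes within a single family are allowed to be parallel, and may be repeated (in which case they are counted with multiplicity). $B(0,1)$ is the unit ball centred at the origin. For $0<r<1$, $\|F\|_{L^r}=(\int|F|^r)^{1/r}$; for $q=\infty$ one reads $q/d=\infty$ and $\delta^{d/q}=1$. *)

theory Defs
  imports "HOL-Probability.Essential_Supremum" "HOL-Library.Multiset"
begin

text \<open>The closed box with centre \<open>c\<close> whose edges are parallel to the orthonormal basis \<open>w\<close>; the edge
  along \<open>v = w k\<close> has length \<open>1\<close> and the others have length \<open>\<delta>\<close>. Since a box has no preferred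
  orientation, \<open>v\<close> and \<open>-v\<close> describe the same tube; when \<open>\<delta> = 1\<close> every edge counts as a long side.\<close>

definition delta_tube_along :: "real \<Rightarrow> real^'n \<Rightarrow> (real^'n) set \<Rightarrow> bool" where
  "delta_tube_along \<delta> v T \<longleftrightarrow>
     (\<exists>(c :: real^'n) (w :: 'n \<Rightarrow> real^'n) k.
        (\<forall>i j. w i \<bullet> w j = (if i = j then 1 else 0)) \<and> w k = v \<and>
        T = {x. \<forall>i. \<bar>(x - c) \<bullet> w i\<bar> \<le> (if i = k then 1 else \<delta>) / 2})"

text \<open>Families are multisets, so repeated tubes are counted with multiplicity.\<close>

definition transversal ::
  "('n \<Rightarrow> (real^'n) set) \<Rightarrow> real \<Rightarrow> ('n \<Rightarrow> (real^'n) set multiset) \<Rightarrow> bool" where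
  "transversal N \<delta> \<T> \<longleftrightarrow> (\<forall>j. \<forall>T \<in># \<T> j. \<exists>v \<in> N j. delta_tube_along \<delta> v T)"

definition tube_product :: "('n \<Rightarrow> (real^'n) set multiset) \<Rightarrow> real^'n \<Rightarrow> real" where
  "tube_product \<T> x = (\<Prod>j\<in>UNIV. \<Sum>T\<in>#\<T> j. indicator T x)"

text \<open>The (quasi-)norm of \<open>L\<^sup>r\<close> for \<open>0 < r \<le> \<infinity>\<close>, with value \<open>\<infinity>\<close> where the integral diverges.\<close>

definition Lr_norm :: "ennreal \<Rightarrow> 'a measure \<Rightarrow> ('a \<Rightarrow> real) \<Rightarrow> ennreal" where
  "Lr_norm r M f =
     (if r = \<infinity> then esssup M (\<lambda>x. ennreal \<bar>f x\<bar>)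
      else let p = enn2real r; I = (\<integral>\<^sup>+x. ennreal (\<bar>f x\<bar> powr p) \<partial>M)
           in if I = \<infinity> then \<infinity> else ennreal (enn2real I powr (1 / p)))"

end

theory Submission
  imports Defs "HOL-Probability.Distributions"
begin

text \<open>Let \<open>d = CARD('n)\<close> and \<open>p = q / d\<close>. After rescaling, a \<open>\<delta>\<close>-tube is dominated by the Gaussian
  \<open>exp (- (norm (perp \<omega> (x - v)))\<^sup>2 / 2)\<close>, where \<open>perp \<omega>\<close> is the projection along its direction, and the
  first estimate says that the integral of the \<open>p\<close>-th power of the product of the \<open>d\<close> sums of such
  Gaussians is at most a constant times the \<open>p\<close>-th power of the product of the numbers of tubes, for
  every \<open>p > 1 / (d - 1)\<close>.

  This is easy if all tubes pass through the origin, since \<open>d\<close> transversal tubes through a common point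
  meet only near this point. The idea is to move all tubes to the origin, replacing the centres \<open>v\<close>
  by \<open>t *\<^sub>R v\<close> with \<open>t\<close> going from \<open>1\<close> to \<open>0\<close>, and to show that (a quantity comparable to) the integral
  does not decrease on the way.

  Suppose first that all directions are within a small distance \<open>\<eta>\<close> of the basis vectors. For tubes
  through the origin, with arbitrary weights, translations by sufficiently small vectors do not
  increase the integral (\<open>small_translation_decreases\<close>). This is a second order Taylor expansion: the
  product is nearly a Gaussian with exponent \<open>- \<mu> * (norm z)\<^sup>2 / 2\<close>, where \<open>\<mu> = p * (d - 1) > 1\<close>. The
  first order terms are odd. The second order term is an average of \<open>(a \<bullet> z)\<^sup>2 - (norm a)\<^sup>2\<close>, with integral
  proportional to \<open>(1 / \<mu> - 1) * (norm a)\<^sup>2 < 0\<close>, and this leaves room for errors of relative size \<open>\<eta>\<close>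
  and \<open>\<epsilon>\<close> (\<open>shifted_le\<close>, \<open>shifted_integral_le\<close>).

  To pass from small translations at the origin to all \<open>t\<close>, the dimension is doubled. Consider
  the families of Gaussians \<open>exp (- ((norm (perp \<omega> (x - t *\<^sub>R v)))\<^sup>2 + (norm (perp \<omega> (z - s *\<^sub>R v)))\<^sup>2) / 2)\<close> of
  the two variables \<open>x\<close> and \<open>z\<close>. Rotations that mix \<open>x\<close> and \<open>z\<close> show that the corresponding integral depends
  only on \<open>t\<^sup>2 + s\<^sup>2\<close> (\<open>doubled_integral_rotate\<close>). For fixed \<open>x\<close> the Gaussians in \<open>x\<close> are just weights, so
  going from \<open>(t, 0)\<close> to \<open>(t, s)\<close> with small \<open>s\<close> does not increase the integral. Hence it is
  decreasing in \<open>t\<close> (\<open>doubled_integral_decreasing\<close>), which proves the estimate for Gaussians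
  (\<open>gaussian_multilinear_kakeya\<close>) without any loss in \<open>\<delta>\<close>.

  The permitted \<open>\<eta>\<close> shrinks as \<open>p\<close> approaches \<open>1 / (d - 1)\<close>, but the neighbourhoods in the theorem must
  not depend on \<open>q\<close>. Therefore they are cut into finitely many small pieces; for each choice of one
  piece from every neighbourhood, a linear change of variables moves the directions close to the
  basis vectors (\<open>tubes_near_frame\<close>, \<open>transversal_tubes_powr\<close>). The estimate with a loss of
  \<open>\<delta> powr (- \<epsilon>)\<close> on the unit ball follows from the first one for an exponent close to the endpoint
  (\<open>endpoint_estimate\<close>).\<close>

section \<open>Projection along a direction\<close>

text \<open>For a unit vector \<open>\<omega>\<close> this is the orthogonal projection along \<open>\<omega>\<close>, so that
  \<open>norm (perp \<omega> (x - v))\<close> is the distance of \<open>x\<close> from the line through \<open>v\<close> with direction \<open>\<omega>\<close>.\<close>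

definition perp :: "'a::real_inner \<Rightarrow> 'a \<Rightarrow> 'a" where
  "perp \<omega> z = z - (\<omega> \<bullet> z) *\<^sub>R \<omega>"

lemma perp_diff: "perp \<omega> (x - y) = perp \<omega> x - perp \<omega> y"
  and perp_add: "perp \<omega> (x + y) = perp \<omega> x + perp \<omega> y"
  and perp_scaleR: "perp \<omega> (r *\<^sub>R x) = r *\<^sub>R perp \<omega> x"
  and perp_zero [simp]: "perp \<omega> 0 = 0"
  and perp_minus: "perp \<omega> (- x) = - perp \<omega> x"
  by (auto simp: perp_def algebra_simps inner_diff_right inner_add_right)

context
  fixes \<omega> :: "'a::real_inner"
  assumes unit: "norm \<omega> = 1"
begin

lemma unit_inner: "\<omega> \<bullet> \<omega> = 1"
  using unit by (simp add: norm_eq_1)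

lemma perp_inner_perp: "perp \<omega> x \<bullet> perp \<omega> y = perp \<omega> x \<bullet> y"
  by (simp add: perp_def inner_diff_left inner_diff_right unit_inner inner_commute)

lemma perp_idem: "perp \<omega> (perp \<omega> x) = perp \<omega> x"
  by (simp add: perp_def inner_diff_right unit_inner)

lemma norm_perp_sq: "(norm (perp \<omega> z))\<^sup>2 = (norm z)\<^sup>2 - (\<omega> \<bullet> z)\<^sup>2"
  by (simp add: power2_norm_eq_inner perp_inner_perp)
    (simp add: perp_def inner_diff_left inner_diff_right power2_eq_square inner_commute)

lemma norm_perp_le: "norm (perp \<omega> z) \<le> norm z"
  by (rule power2_le_imp_le) (simp_all add: norm_perp_sq)

text \<open>By the formula \<open>norm_perp_sq\<close> the two quadratic forms differ by a difference of two squares, one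
  factor of which contains \<open>\<omega> - e\<close>.\<close>

lemma norm_perp_sq_perturb:
  assumes "norm e = 1"
  shows "\<bar>(norm (perp \<omega> z))\<^sup>2 - ((norm z)\<^sup>2 - (e \<bullet> z)\<^sup>2)\<bar> \<le> 2 * norm (\<omega> - e) * (norm z)\<^sup>2"
proof -
  have "\<bar>(norm (perp \<omega> z))\<^sup>2 - ((norm z)\<^sup>2 - (e \<bullet> z)\<^sup>2)\<bar> = \<bar>(e \<bullet> z)\<^sup>2 - (\<omega> \<bullet> z)\<^sup>2\<bar>"
    by (simp add: norm_perp_sq)
  also have "\<dots> = \<bar>(\<omega> - e) \<bullet> z\<bar> * \<bar>(\<omega> + e) \<bullet> z\<bar>"
    unfolding abs_mult[symmetric] inner_diff_left inner_add_left
    by (subst abs_minus_commute) (simp add: power2_eq_square algebra_simps)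
  also have "\<dots> \<le> (norm (\<omega> - e) * norm z) * (norm (\<omega> + e) * norm z)"
    by (intro mult_mono Cauchy_Schwarz_ineq2) auto
  also have "\<dots> \<le> (norm (\<omega> - e) * norm z) * (2 * norm z)"
    using norm_triangle_ineq[of \<omega> e] assms unit by (intro mult_left_mono mult_right_mono) auto
  finally show ?thesis by (simp add: power2_eq_square algebra_simps)
qed

end

section \<open>Weighted averages\<close>

definition avg :: "'i set \<Rightarrow> ('i \<Rightarrow> real) \<Rightarrow> ('i \<Rightarrow> real) \<Rightarrow> real" where
  "avg I w h = (\<Sum>i\<in>I. w i * h i) / (\<Sum>i\<in>I. w i)"

locale weights =
  fixes I :: "'i set" and w :: "'i \<Rightarrow> real"
  assumes fin: "finite I" and nonempty: "I \<noteq> {}" and pos: "\<And>i. i \<in> I \<Longrightarrow> 0 < w i"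
begin

lemma total_pos: "0 < (\<Sum>i\<in>I. w i)"
  by (rule sum_pos[OF fin nonempty pos])

lemma avg_mono:
  assumes "\<And>i. i \<in> I \<Longrightarrow> g i \<le> h i" shows "avg I w g \<le> avg I w h"
  unfolding avg_def using total_pos assms pos
  by (intro divide_right_mono sum_mono mult_left_mono) (auto intro: less_imp_le)

lemma avg_const [simp]: "avg I w (\<lambda>_. k) = k"
  using total_pos by (simp add: avg_def sum_distrib_right[symmetric])

lemma avg_add: "avg I w (\<lambda>i. g i + h i) = avg I w g + avg I w h"
  by (simp add: avg_def distrib_left sum.distrib add_divide_distrib)

lemma avg_diff: "avg I w (\<lambda>i. g i - h i) = avg I w g - avg I w h"
  by (simp add: avg_def right_diff_distrib sum_subtractf diff_divide_distrib)

lemma avg_cmult: "avg I w (\<lambda>i. k * h i) = k * avg I w h"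
  by (simp add: avg_def sum_distrib_left mult.left_commute)

lemma avg_cong: "(\<And>i. i \<in> I \<Longrightarrow> g i = h i) \<Longrightarrow> avg I w g = avg I w h"
  by (simp add: avg_def cong: sum.cong)

lemma avg_nonneg: "(\<And>i. i \<in> I \<Longrightarrow> 0 \<le> h i) \<Longrightarrow> 0 \<le> avg I w h"
  using avg_mono[of "\<lambda>_. 0" h] by simp

lemma avg_le_const: "(\<And>i. i \<in> I \<Longrightarrow> h i \<le> k) \<Longrightarrow> avg I w h \<le> k"
  using avg_mono[of h "\<lambda>_. k"] by simp

lemma avg_ge_const: "(\<And>i. i \<in> I \<Longrightarrow> k \<le> h i) \<Longrightarrow> k \<le> avg I w h"
  using avg_mono[of "\<lambda>_. k" h] by simp

lemma abs_avg_le: "\<bar>avg I w h\<bar> \<le> avg I w (\<lambda>i. \<bar>h i\<bar>)"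
proof -
  have "avg I w h \<le> avg I w (\<lambda>i. \<bar>h i\<bar>)" by (rule avg_mono) auto
  moreover have "- avg I w h \<le> avg I w (\<lambda>i. \<bar>h i\<bar>)"
    using avg_mono[of "\<lambda>i. (-1) * h i" "\<lambda>i. \<bar>h i\<bar>"] avg_cmult[of "-1" h] by auto
  ultimately show ?thesis by linarith
qed

text \<open>The difference of the two sides is the variance.\<close>

lemma avg_square: "(avg I w h)\<^sup>2 \<le> avg I w (\<lambda>i. (h i)\<^sup>2)"
proof -
  define m where "m = avg I w h"
  have "0 \<le> avg I w (\<lambda>i. (h i - m)\<^sup>2)" by (rule avg_nonneg) simp
  also have "avg I w (\<lambda>i. (h i - m)\<^sup>2) = avg I w (\<lambda>i. (h i)\<^sup>2 - (2 * m) * h i + m\<^sup>2)"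
    by (rule avg_cong) (simp add: power2_eq_square algebra_simps)
  also have "\<dots> = avg I w (\<lambda>i. (h i)\<^sup>2) - 2 * m * m + m\<^sup>2"
    by (simp add: avg_add avg_diff avg_cmult m_def)
  finally show ?thesis by (simp add: m_def power2_eq_square)
qed

text \<open>Jensen's inequality: \<open>exp\<close> lies above its tangent at the average of \<open>\<theta>\<close>.\<close>

lemma ln_avg_exp_ge: "avg I w \<theta> \<le> ln (avg I w (\<lambda>i. exp (\<theta> i)))"
proof -
  define m where "m = avg I w \<theta>"
  have "avg I w (\<lambda>i. exp m * (1 + (\<theta> i - m))) \<le> avg I w (\<lambda>i. exp (\<theta> i))"
  proof (rule avg_mono)
    fix i
    have "exp m * (1 + (\<theta> i - m)) \<le> exp m * exp (\<theta> i - m)"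
      by (intro mult_left_mono exp_ge_add_one_self) auto
    then show "exp m * (1 + (\<theta> i - m)) \<le> exp (\<theta> i)" by (simp add: exp_diff)
  qed
  then have "exp m \<le> avg I w (\<lambda>i. exp (\<theta> i))"
    by (simp add: avg_cmult avg_add avg_diff m_def)
  then show ?thesis
    by (metis exp_gt_zero ln_exp ln_mono m_def order_less_le_trans)
qed

lemma avg_exp_pos: "0 < avg I w (\<lambda>i. exp (\<theta> i))"
  unfolding avg_def using total_pos by (auto intro!: divide_pos_pos sum_pos fin nonempty mult_pos_pos pos)

lemma ln_avg_exp_le: "ln (avg I w (\<lambda>i. exp (\<theta> i))) \<le> avg I w (\<lambda>i. exp (\<theta> i) - 1)"
  using ln_le_minus_one[OF avg_exp_pos[of \<theta>]] by (simp add: avg_diff)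

lemma abs_ln_avg_exp_le:
  assumes "\<And>i. i \<in> I \<Longrightarrow> \<bar>\<theta> i\<bar> \<le> t"
  shows "\<bar>ln (avg I w (\<lambda>i. exp (\<theta> i)))\<bar> \<le> t"
proof -
  have "-t \<le> avg I w \<theta>" using assms by (intro avg_ge_const) (auto simp: abs_le_iff minus_le_iff)
  moreover have "avg I w (\<lambda>i. exp (\<theta> i)) \<le> exp t"
    using assms by (intro avg_le_const) (auto simp: abs_le_iff)
  then have "ln (avg I w (\<lambda>i. exp (\<theta> i))) \<le> t"
    using avg_exp_pos[of \<theta>] by (simp add: ln_le_cancel_iff[symmetric] del: ln_le_cancel_iff)
  ultimately show ?thesis using ln_avg_exp_ge[of \<theta>] by linarith
qed

end

text \<open>Two systems of weights that agree up to a common factor \<open>s\<close> and errors \<open>exp (\<plusminus>\<kappa>)\<close>. The factor \<open>s\<close>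
  cancels in averages, which therefore differ by factors \<open>exp (\<plusminus>2\<kappa>)\<close> only: one \<open>exp (\<plusminus>\<kappa>)\<close> for the
  numerator and one for the denominator.\<close>

locale comparable_weights = w: weights I w + w': weights I w' for I :: "'i set" and w w' +
  fixes s \<kappa> :: real
  assumes s: "0 < s"
    and lower: "\<And>i. i \<in> I \<Longrightarrow> s * exp (-\<kappa>) * w i \<le> w' i"
    and upper: "\<And>i. i \<in> I \<Longrightarrow> w' i \<le> s * exp \<kappa> * w i"
begin

lemma total_lower: "s * exp (-\<kappa>) * sum w I \<le> sum w' I"
  unfolding sum_distrib_left by (rule sum_mono) (rule lower)

lemma total_upper: "sum w' I \<le> s * exp \<kappa> * sum w I"
  unfolding sum_distrib_left by (rule sum_mono) (rule upper)

definition ratio :: "'i \<Rightarrow> real" where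
  "ratio i = w' i / w i * (sum w I / sum w' I)"

lemma avg_ratio: "avg I w' h = avg I w (\<lambda>i. ratio i * h i)"
proof -
  have "(\<Sum>i\<in>I. w i * (ratio i * h i)) = (\<Sum>i\<in>I. (sum w I / sum w' I) * (w' i * h i))"
    by (rule sum.cong) (use w.pos in \<open>auto simp: ratio_def\<close>, fastforce)
  also have "\<dots> = (sum w I / sum w' I) * (\<Sum>i\<in>I. w' i * h i)" by (simp add: sum_distrib_left)
  finally show ?thesis unfolding avg_def using w.total_pos w'.total_pos by simp
qed

lemma ratio_upper: "i \<in> I \<Longrightarrow> ratio i \<le> exp (2 * \<kappa>)"
proof -
  assume i: "i \<in> I"
  have "w' i * sum w I \<le> (s * exp \<kappa> * w i) * sum w I"
    using upper[OF i] w.total_pos by (intro mult_right_mono) auto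
  also have "\<dots> = exp (2*\<kappa>) * w i * (s * exp (-\<kappa>) * sum w I)"
    by (simp add: exp_minus field_simps flip: exp_add mult_exp_exp)
  also have "\<dots> \<le> exp (2*\<kappa>) * w i * sum w' I"
    using w.pos[OF i] total_lower by (intro mult_left_mono) auto
  finally show ?thesis using w.pos[OF i] w'.total_pos
    by (simp add: ratio_def divide_simps mult.assoc)
qed

lemma ratio_lower: "i \<in> I \<Longrightarrow> exp (- 2 * \<kappa>) \<le> ratio i"
proof -
  assume i: "i \<in> I"
  have "exp (-2*\<kappa>) * w i * sum w' I \<le> exp (-2*\<kappa>) * w i * (s * exp \<kappa> * sum w I)"
    using w.pos[OF i] total_upper by (intro mult_left_mono) auto
  also have "\<dots> = (s * exp (-\<kappa>) * w i) * sum w I"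
    by (simp add: exp_minus field_simps flip: exp_add mult_exp_exp)
  also have "\<dots> \<le> w' i * sum w I"
    using lower[OF i] w.total_pos by (intro mult_right_mono) auto
  finally show ?thesis using w.pos[OF i] w'.total_pos
    by (simp add: ratio_def divide_simps mult.assoc)
qed

lemma avg_upper:
  assumes "\<And>i. i \<in> I \<Longrightarrow> 0 \<le> h i"
  shows "avg I w' h \<le> exp (2 * \<kappa>) * avg I w h"
  unfolding avg_ratio w.avg_cmult[symmetric]
  by (intro w.avg_mono mult_right_mono ratio_upper assms)

lemma avg_lower:
  assumes "\<And>i. i \<in> I \<Longrightarrow> 0 \<le> h i"
  shows "exp (- 2 * \<kappa>) * avg I w h \<le> avg I w' h"
  unfolding avg_ratio w.avg_cmult[symmetric]
  by (intro w.avg_mono mult_right_mono ratio_lower assms)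

text \<open>Averages of functions without a sign are compared additively. With \<open>\<kappa>\<close> small the difference is
  small, which is what makes a first order term that vanishes for the weights \<open>w\<close> small for \<open>w'\<close>.\<close>

lemma avg_change: "\<bar>avg I w' h - avg I w h\<bar> \<le> (exp (2 * \<kappa>) - 1) * avg I w (\<lambda>i. \<bar>h i\<bar>)"
proof -
  have "\<bar>avg I w' h - avg I w h\<bar> = \<bar>avg I w (\<lambda>i. (ratio i - 1) * h i)\<bar>"
    by (simp add: avg_ratio w.avg_diff[symmetric] algebra_simps)
  also have "\<dots> \<le> avg I w (\<lambda>i. \<bar>(ratio i - 1) * h i\<bar>)" by (rule w.abs_avg_le)
  also have "\<dots> \<le> avg I w (\<lambda>i. (exp (2 * \<kappa>) - 1) * \<bar>h i\<bar>)"
  proof (rule w.avg_mono)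
    fix i assume i: "i \<in> I"
    have "1 - exp (-2*\<kappa>) \<le> exp (2*\<kappa>) - 1"
      using exp_ge_add_one_self[of "2*\<kappa>"] exp_ge_add_one_self[of "-2*\<kappa>"] by linarith
    with ratio_upper[OF i] ratio_lower[OF i] have "\<bar>ratio i - 1\<bar> \<le> exp (2*\<kappa>) - 1" by linarith
    then show "\<bar>(ratio i - 1) * h i\<bar> \<le> (exp (2 * \<kappa>) - 1) * \<bar>h i\<bar>"
      by (simp add: abs_mult mult_right_mono)
  qed
  finally show ?thesis by (simp add: w.avg_cmult)
qed

end

lemma exp_le_cubic: "exp (x::real) \<le> 1 + x + x\<^sup>2 / 2 + \<bar>x\<bar> ^ 3 * exp \<bar>x\<bar> / 6"
proof -
  obtain t where t: "\<bar>t\<bar> \<le> \<bar>x\<bar>" "exp x = (\<Sum>m<3. x ^ m / fact m) + exp t / fact 3 * x ^ 3"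
    using Maclaurin_exp_le[of x 3] by auto
  have "exp t * x ^ 3 \<le> exp t * \<bar>x ^ 3\<bar>" by (intro mult_left_mono) auto
  also have "\<dots> \<le> exp \<bar>x\<bar> * \<bar>x\<bar> ^ 3"
    using t(1) by (simp add: power_abs mult_right_mono)
  finally have "exp t * x ^ 3 \<le> exp \<bar>x\<bar> * \<bar>x\<bar> ^ 3" .
  with t(2) show ?thesis by (simp add: numeral_eq_Suc field_simps)
qed

lemma exp_le_quadratic: "exp (x::real) \<le> 1 + x + x\<^sup>2 / 2 * exp \<bar>x\<bar>"
proof -
  obtain t where t: "\<bar>t\<bar> \<le> \<bar>x\<bar>" "exp x = (\<Sum>m<2. x ^ m / fact m) + exp t / fact 2 * x ^ 2"
    using Maclaurin_exp_le[of x 2] by auto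
  have "exp t * x ^ 2 \<le> exp \<bar>x\<bar> * x ^ 2"
    using t(1) by (intro mult_right_mono) auto
  with t(2) show ?thesis by (simp add: numeral_eq_Suc field_simps)
qed

lemma exp_minus_one_le: "exp (x::real) - 1 \<le> x * exp x"
  using exp_ge_add_one_self[of "-x"] by (simp add: exp_minus field_simps)

section \<open>Second order expansion of one family\<close>

text \<open>Translating a Gaussian tube by a vector \<open>a\<close> orthogonal to its direction multiplies its value at \<open>z\<close>
  by \<open>exp (a \<bullet> z - (norm a)\<^sup>2 / 2)\<close>. Hence, if \<open>w i\<close> are the values at \<open>z\<close> of the Gaussian tubes of
  a family, \<open>shift_log\<close> is the change of the logarithm of their sum under translations by \<open>a i\<close>.\<close>

definition shift_log :: "'i set \<Rightarrow> ('i \<Rightarrow> real) \<Rightarrow> ('i \<Rightarrow> 'v::real_inner) \<Rightarrow> 'v \<Rightarrow> real" where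
  "shift_log I w a z = ln (avg I w (\<lambda>i. exp (a i \<bullet> z - (norm (a i))\<^sup>2 / 2)))"

context weights
begin

context
  fixes a :: "'i \<Rightarrow> 'v::real_inner" and z :: 'v and \<epsilon> B :: real
  assumes small: "\<And>i. i \<in> I \<Longrightarrow> norm (a i) \<le> \<epsilon>" and eps: "\<epsilon> \<le> 1"
  defines "B \<equiv> (norm z + 1) ^ 3 * exp (norm z + 1)"
begin

lemma B_ge: "norm z + 1 \<le> B" "(norm z)\<^sup>2 \<le> B" "1 \<le> B"
proof -
  have e: "2 \<le> exp (norm z + 1)" using exp_ge_add_one_self[of "norm z + 1"] norm_ge_zero[of z] by linarith
  have 1: "(norm z + 1) ^ k \<le> (norm z + 1) ^ 3" if "k \<le> 3" for k :: nat
    by (rule power_increasing[OF that]) simp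
  have 2: "2 * (norm z + 1) ^ 3 \<le> B"
    unfolding B_def using mult_left_mono[OF e, of "(norm z + 1)^3"] by (simp add: mult.commute)
  have 3: "0 \<le> (norm z + 1) ^ 3" by simp
  have "(norm z)\<^sup>2 \<le> (norm z + 1)\<^sup>2" by (rule power_mono) auto
  then show "norm z + 1 \<le> B" "(norm z)\<^sup>2 \<le> B" "1 \<le> B"
    using one_le_power[of "norm z + 1" 3] 1[of 1, simplified] 1[of 2, simplified] 2 3 norm_ge_zero[of z]
    by linarith+
qed

lemma shift_exponent_abs:
  assumes i: "i \<in> I"
  shows "\<bar>a i \<bullet> z - (norm (a i))\<^sup>2 / 2\<bar> \<le> norm (a i) * (norm z + 1)"
proof -
  have "\<bar>a i \<bullet> z\<bar> \<le> norm (a i) * norm z" by (rule Cauchy_Schwarz_ineq2)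
  moreover have "norm (a i) * norm (a i) \<le> norm (a i) * 1"
    using small[OF i] eps by (intro mult_left_mono) auto
  moreover have "0 \<le> norm (a i) * norm (a i)" by simp
  ultimately show ?thesis unfolding power2_eq_square distrib_left abs_le_iff by linarith
qed

lemma eps_nonneg: "0 \<le> \<epsilon>"
  using nonempty small norm_ge_zero by (meson ex_in_conv order_trans)

text \<open>Only the coefficients of the quadratic terms matter in the end: \<open>a \<bullet> z\<close> has second moment
  \<open>(norm a)\<^sup>2 / \<mu>\<close> under the Gaussian weight that will be used, so that these terms contribute a
  negative amount as soon as \<open>\<mu> > 1\<close>. All remaining terms are of third order in \<open>a\<close> and are
  collected, with the polynomial and exponential growth in \<open>z\<close>, in \<open>\<epsilon> * B\<close>.\<close>

lemma exp_shift_le: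
  assumes i: "i \<in> I"
  shows "exp (a i \<bullet> z - (norm (a i))\<^sup>2 / 2) - 1
    \<le> a i \<bullet> z + (a i \<bullet> z)\<^sup>2 / 2 - (norm (a i))\<^sup>2 / 2 + \<epsilon> * B * (norm (a i))\<^sup>2"
proof -
  define r n t where "r = norm (a i)" and "n = norm z" and "t = a i \<bullet> z"
  define \<theta> where "\<theta> = t - r\<^sup>2 / 2"
  have r: "0 \<le> r" "r \<le> \<epsilon>" "r \<le> 1" using small[OF i] eps by (auto simp: r_def)
  have n: "0 \<le> n" by (simp add: n_def)
  have t: "\<bar>t\<bar> \<le> r * n" unfolding t_def r_def n_def by (rule Cauchy_Schwarz_ineq2)
  have th: "\<bar>\<theta>\<bar> \<le> r * (n + 1)"
    using shift_exponent_abs[OF i] by (simp add: \<theta>_def t_def r_def n_def)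
  have r3: "r ^ 3 \<le> \<epsilon> * r\<^sup>2"
    using r by (simp add: power3_eq_cube power2_eq_square mult_right_mono mult.assoc[symmetric])
  have r4: "r ^ 4 \<le> \<epsilon> * r\<^sup>2"
  proof -
    have "r ^ 4 \<le> r ^ 3" by (rule power_decreasing) (use r in auto)
    with r3 show ?thesis by simp
  qed
  have "\<theta>\<^sup>2 = t\<^sup>2 - t * r\<^sup>2 + r ^ 4 / 4"
    by (simp add: \<theta>_def power2_eq_square algebra_simps power4_eq_xxxx)
  moreover have "- t * r\<^sup>2 \<le> (r * n) * r\<^sup>2"
    using t by (intro mult_right_mono) (auto simp: abs_le_iff)
  moreover have "(r * n) * r\<^sup>2 = n * r ^ 3" by (simp add: power2_eq_square power3_eq_cube)
  moreover have "n * r ^ 3 \<le> n * (\<epsilon> * r\<^sup>2)" by (intro mult_left_mono r3 n)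
  ultimately have q: "\<theta>\<^sup>2 \<le> t\<^sup>2 + (n + 1) * (\<epsilon> * r\<^sup>2)"
    using r4 mult_nonneg_nonneg[OF eps_nonneg zero_le_power2[of r]]
    unfolding distrib_right mult_1 by linarith
  have "\<bar>\<theta>\<bar> ^ 3 \<le> (r * (n + 1)) ^ 3" by (rule power_mono[OF th]) simp
  also have "\<dots> = r ^ 3 * (n + 1) ^ 3" by (rule power_mult_distrib)
  also have "\<dots> \<le> (\<epsilon> * r\<^sup>2) * (n + 1) ^ 3" using n by (intro mult_right_mono r3) simp
  finally have c1: "\<bar>\<theta>\<bar> ^ 3 \<le> (\<epsilon> * r\<^sup>2) * (n + 1) ^ 3" .
  have "\<bar>\<theta>\<bar> \<le> n + 1" using th mult_left_le_one_le[of "n + 1" r] r n by linarith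
  then have c2: "exp \<bar>\<theta>\<bar> \<le> exp (n + 1)" by simp
  have c: "\<bar>\<theta>\<bar> ^ 3 * exp \<bar>\<theta>\<bar> \<le> ((\<epsilon> * r\<^sup>2) * (n + 1) ^ 3) * exp (n + 1)"
    by (rule mult_mono[OF c1 c2]) (use n eps_nonneg in auto)
  also have "\<dots> = \<epsilon> * r\<^sup>2 * B" by (simp add: B_def n_def)
  finally have c: "\<bar>\<theta>\<bar> ^ 3 * exp \<bar>\<theta>\<bar> \<le> \<epsilon> * r\<^sup>2 * B" .
  have "(n + 1) * (\<epsilon> * r\<^sup>2) \<le> B * (\<epsilon> * r\<^sup>2)"
    using B_ge(1) eps_nonneg by (intro mult_right_mono) (auto simp: n_def)
  moreover have "exp \<theta> - 1 \<le> t - r\<^sup>2 / 2 + \<theta>\<^sup>2 / 2 + \<bar>\<theta>\<bar> ^ 3 * exp \<bar>\<theta>\<bar> / 6"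
    using exp_le_cubic[of \<theta>] by (simp add: \<theta>_def)
  moreover have "\<epsilon> * r\<^sup>2 * B = B * (\<epsilon> * r\<^sup>2)" "\<epsilon> * B * r\<^sup>2 = B * (\<epsilon> * r\<^sup>2)" by simp_all
  moreover have "0 \<le> B * (\<epsilon> * r\<^sup>2)" using B_ge(3) eps_nonneg by simp
  ultimately have "exp \<theta> - 1 \<le> t + t\<^sup>2 / 2 - r\<^sup>2 / 2 + \<epsilon> * B * r\<^sup>2" using q c by linarith
  then show ?thesis by (simp add: \<theta>_def t_def r_def)
qed

text \<open>As \<open>ln t \<le> t - 1\<close>, the upper bound for the exponential transfers to the logarithm of its average.\<close>

lemma shift_log_upper:
  "shift_log I w a z \<le> avg I w (\<lambda>i. a i \<bullet> z) + avg I w (\<lambda>i. (a i \<bullet> z)\<^sup>2) / 2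
     - avg I w (\<lambda>i. (norm (a i))\<^sup>2) / 2 + \<epsilon> * B * avg I w (\<lambda>i. (norm (a i))\<^sup>2)"
proof -
  have "shift_log I w a z \<le> avg I w (\<lambda>i. exp (a i \<bullet> z - (norm (a i))\<^sup>2 / 2) - 1)"
    unfolding shift_log_def by (rule ln_avg_exp_le)
  also have "\<dots> \<le> avg I w (\<lambda>i. a i \<bullet> z + (1/2) * (a i \<bullet> z)\<^sup>2 - (1/2) * (norm (a i))\<^sup>2
      + (\<epsilon> * B) * (norm (a i))\<^sup>2)"
    using exp_shift_le by (intro avg_mono) simp
  also have "\<dots> = avg I w (\<lambda>i. a i \<bullet> z) + (1/2) * avg I w (\<lambda>i. (a i \<bullet> z)\<^sup>2)
     - (1/2) * avg I w (\<lambda>i. (norm (a i))\<^sup>2) + (\<epsilon> * B) * avg I w (\<lambda>i. (norm (a i))\<^sup>2)"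
    by (simp only: avg_add avg_diff avg_cmult)
  finally show ?thesis by simp
qed

lemma shift_log_deviation:
  "\<bar>shift_log I w a z - avg I w (\<lambda>i. a i \<bullet> z)\<bar> \<le> 2 * B * avg I w (\<lambda>i. (norm (a i))\<^sup>2)"
proof -
  define D where "D = avg I w (\<lambda>i. (norm (a i))\<^sup>2)"
  have D: "0 \<le> D" unfolding D_def by (rule avg_nonneg) simp
  have "avg I w (\<lambda>i. a i \<bullet> z - (1/2) * (norm (a i))\<^sup>2) \<le> shift_log I w a z"
    unfolding shift_log_def using ln_avg_exp_ge[of "\<lambda>i. a i \<bullet> z - (1/2) * (norm (a i))\<^sup>2"] by simp
  then have low: "avg I w (\<lambda>i. a i \<bullet> z) - D / 2 \<le> shift_log I w a z"
    by (simp only: avg_diff avg_cmult D_def)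
  have "avg I w (\<lambda>i. (a i \<bullet> z)\<^sup>2) \<le> avg I w (\<lambda>i. (norm z)\<^sup>2 * (norm (a i))\<^sup>2)"
  proof (rule avg_mono)
    fix i
    show "(a i \<bullet> z)\<^sup>2 \<le> (norm z)\<^sup>2 * (norm (a i))\<^sup>2"
      using power_mono[OF Cauchy_Schwarz_ineq2[of "a i" z], of 2]
      by (simp add: power_mult_distrib mult.commute)
  qed
  also have "\<dots> = (norm z)\<^sup>2 * D" by (simp add: avg_cmult D_def)
  also have "\<dots> \<le> B * D" using D B_ge(2) by (intro mult_right_mono)
  finally have "avg I w (\<lambda>i. (a i \<bullet> z)\<^sup>2) \<le> B * D" .
  moreover have "\<epsilon> * B * D \<le> B * D" using eps B_ge(3) D
    by (simp add: mult_left_le_one_le eps_nonneg mult.assoc)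
  moreover have "D \<le> B * D" using mult_right_mono[OF B_ge(3) D] by simp
  ultimately show ?thesis using shift_log_upper low D unfolding D_def[symmetric] abs_le_iff by linarith
qed

text \<open>For large \<open>z\<close> the expansion is useless, since \<open>B\<close> grows exponentially; the logarithm itself grows
  only linearly, which keeps its exponential integrable against a Gaussian.\<close>

lemma shift_log_abs: "\<bar>shift_log I w a z\<bar> \<le> \<epsilon> * (norm z + 1)"
  unfolding shift_log_def
proof (rule abs_ln_avg_exp_le)
  fix i assume i: "i \<in> I"
  have "norm (a i) * (norm z + 1) \<le> \<epsilon> * (norm z + 1)"
    using small[OF i] by (intro mult_right_mono) auto
  with shift_exponent_abs[OF i]
  show "\<bar>a i \<bullet> z - (norm (a i))\<^sup>2 / 2\<bar> \<le> \<epsilon> * (norm z + 1)" by linarith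
qed

end

end

section \<open>Families of tubes with nearly axis parallel directions\<close>

text \<open>The \<open>j\<close>-th family consists of lines through the origin with directions \<open>\<omega> j i\<close> within \<open>\<eta>\<close> of the
  \<open>j\<close>-th basis vector. If all directions were basis vectors, \<open>base\<close> below would be
  \<open>mass * exp (- \<mu> * (norm z)\<^sup>2 / 2)\<close>, because the squared distances to the \<open>d\<close> axes add up to
  \<open>(d - 1) * (norm z)\<^sup>2\<close>. The condition \<open>p > 1 / (d - 1)\<close> says that \<open>\<mu> > 1\<close>.\<close>

locale near_axis_tubes =
  fixes I :: "'n::finite \<Rightarrow> 'i set" and c :: "'n \<Rightarrow> 'i \<Rightarrow> real"
    and \<omega> :: "'n \<Rightarrow> 'i \<Rightarrow> real^'n" and p \<eta> d \<mu> :: real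
  assumes p: "0 < p"
    and weights: "\<And>j. weights (I j) (c j)"
    and unit: "\<And>j i. i \<in> I j \<Longrightarrow> norm (\<omega> j i) = 1"
    and near: "\<And>j i. i \<in> I j \<Longrightarrow> norm (\<omega> j i - axis j 1) \<le> \<eta>"
    and \<eta>: "\<eta> \<le> 1"
  defines "d \<equiv> real CARD('n)" and "\<mu> \<equiv> p * (d - 1)"
begin

sublocale c: weights "I j" "c j" for j by (rule weights)

lemma \<eta>_nonneg: "0 \<le> \<eta>"
proof -
  obtain i where "i \<in> I undefined" using c.nonempty by blast
  with near[of i undefined] norm_ge_zero show ?thesis by (meson order_trans)
qed

definition wt :: "'n \<Rightarrow> real^'n \<Rightarrow> 'i \<Rightarrow> real" where
  "wt j z i = c j i * exp (- (norm (perp (\<omega> j i) z))\<^sup>2 / 2)"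

definition mass :: real where "mass = (\<Prod>j\<in>UNIV. sum (c j) (I j) powr p)"

text \<open>The integrand for tubes through the origin, with which the translated tubes will be compared.\<close>

definition base :: "real^'n \<Rightarrow> real" where
  "base z = (\<Prod>j\<in>UNIV. sum (wt j z) (I j) powr p)"

lemma wt_weights: "weights (I j) (wt j z)"
  using c.fin c.nonempty c.pos by unfold_locales (auto simp: wt_def)

sublocale wt: weights "I j" "wt j z" for j z by (rule wt_weights)

lemma wt_comparable:
  "comparable_weights (I j) (c j) (wt j z) (exp (- ((norm z)\<^sup>2 - (z $ j)\<^sup>2) / 2)) (\<eta> * (norm z)\<^sup>2)"
proof unfold_locales
  fix i assume i: "i \<in> I j"
  have "\<bar>(norm (perp (\<omega> j i) z))\<^sup>2 - ((norm z)\<^sup>2 - (z $ j)\<^sup>2)\<bar>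
      \<le> 2 * norm (\<omega> j i - axis j 1) * (norm z)\<^sup>2"
    using norm_perp_sq_perturb[OF unit[OF i], of "axis j 1" z] by (simp add: inner_axis')
  also have "\<dots> \<le> 2 * \<eta> * (norm z)\<^sup>2" using near[OF i] by (intro mult_right_mono) auto
  finally have q: "\<bar>(norm (perp (\<omega> j i) z))\<^sup>2 - ((norm z)\<^sup>2 - (z $ j)\<^sup>2)\<bar> \<le> 2 * \<eta> * (norm z)\<^sup>2" .
  have c: "0 < c j i" by (rule c.pos[OF i])
  show "exp (- ((norm z)\<^sup>2 - (z $ j)\<^sup>2) / 2) * exp (- (\<eta> * (norm z)\<^sup>2)) * c j i \<le> wt j z i"
    unfolding wt_def mult.commute[of "c j i"] exp_add[symmetric]
    using q c by (intro mult_right_mono) (simp_all add: abs_le_iff field_simps)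
  show "wt j z i \<le> exp (- ((norm z)\<^sup>2 - (z $ j)\<^sup>2) / 2) * exp (\<eta> * (norm z)\<^sup>2) * c j i"
    unfolding wt_def mult.commute[of "c j i"] exp_add[symmetric]
    using q c by (intro mult_right_mono) (simp_all add: abs_le_iff field_simps)
qed simp

sublocale cmp: comparable_weights "I j" "c j" "wt j z" "exp (- ((norm z)\<^sup>2 - (z $ j)\<^sup>2) / 2)"
  "\<eta> * (norm z)\<^sup>2" for j z
  by (rule wt_comparable)

lemma mass_pos: "0 < mass"
  unfolding mass_def using c.total_pos by (intro prod_pos) (metis powr_gt_zero less_irrefl)

lemma base_pos: "0 < base z"
  unfolding base_def using wt.total_pos by (intro prod_pos) (metis powr_gt_zero less_irrefl)

lemma sum_coordinates: "(\<Sum>j\<in>UNIV. (norm z)\<^sup>2 - (z $ j)\<^sup>2) = (d - 1) * (norm (z::real^'n))\<^sup>2"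
proof -
  have "(\<Sum>j\<in>UNIV. (z $ j)\<^sup>2) = (norm z)\<^sup>2"
    by (simp add: norm_vec_def L2_set_def sum_nonneg)
  then show ?thesis by (simp add: sum_subtractf algebra_simps d_def)
qed

text \<open>Evaluation of the product for a single axis parallel tube in each family, with an extra factor
  \<open>exp (s * (norm z)\<^sup>2)\<close> that accounts for the deviation of the directions (\<open>s = \<plusminus>\<eta>\<close>).\<close>

lemma prod_comparison:
  assumes "\<And>z j. u z j = exp (- ((norm z)\<^sup>2 - (z $ j)\<^sup>2) / 2) * exp (s * (norm z)\<^sup>2) * sum (c j) (I j)"
  shows "(\<Prod>j\<in>UNIV. u z j powr p) = mass * exp (- \<mu> * (norm z)\<^sup>2 / 2) * exp (p * d * s * (norm z)\<^sup>2)"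
proof -
  let ?e = "\<lambda>j. - ((norm z)\<^sup>2 - (z $ j)\<^sup>2) / 2 + s * (norm z)\<^sup>2"
  have "u z j powr p = exp (p * ?e j) * sum (c j) (I j) powr p" for j
    unfolding assms exp_add[symmetric] using c.total_pos[of j]
    by (subst powr_mult) (auto simp: powr_def)
  then have "(\<Prod>j\<in>UNIV. u z j powr p)
     = exp (\<Sum>j\<in>UNIV. p * ?e j) * mass"
    by (simp add: prod.distrib exp_sum mass_def)
  also have "(\<Sum>j\<in>UNIV. p * ?e j)
     = p * (- (\<Sum>j\<in>UNIV. (norm z)\<^sup>2 - (z $ j)\<^sup>2) / 2 + d * s * (norm z)\<^sup>2)"
    unfolding sum_distrib_left[symmetric] sum.distrib sum_divide_distrib[symmetric] sum_negf by (simp add: d_def)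
  also have "\<dots> = - \<mu> * (norm z)\<^sup>2 / 2 + p * d * s * (norm z)\<^sup>2"
    unfolding sum_coordinates \<mu>_def by (simp add: field_simps)
  finally show ?thesis unfolding exp_add by (simp only: ac_simps)
qed

lemma base_upper:
  "base z \<le> mass * exp (- \<mu> * (norm z)\<^sup>2 / 2) * exp (p * d * \<eta> * (norm z)\<^sup>2)"
proof -
  have "base z \<le> (\<Prod>j\<in>UNIV. (exp (- ((norm z)\<^sup>2 - (z $ j)\<^sup>2) / 2) * exp (\<eta> * (norm z)\<^sup>2) * sum (c j) (I j)) powr p)"
    unfolding base_def using p wt.total_pos cmp.total_upper
    by (intro prod_mono conjI powr_mono2) (auto intro: less_imp_le)
  also have "\<dots> = mass * exp (- \<mu> * (norm z)\<^sup>2 / 2) * exp (p * d * \<eta> * (norm z)\<^sup>2)"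
    by (rule prod_comparison) simp
  finally show ?thesis .
qed

lemma base_lower:
  "mass * exp (- \<mu> * (norm z)\<^sup>2 / 2) * exp (- (p * d * \<eta> * (norm z)\<^sup>2)) \<le> base z"
proof -
  let ?l = "\<Prod>j\<in>UNIV. (exp (- ((norm z)\<^sup>2 - (z $ j)\<^sup>2) / 2) * exp ((- \<eta>) * (norm z)\<^sup>2) * sum (c j) (I j)) powr p"
  have "?l
     = mass * exp (- \<mu> * (norm z)\<^sup>2 / 2) * exp (p * d * (- \<eta>) * (norm z)\<^sup>2)"
    by (rule prod_comparison) simp
  moreover have "?l
     \<le> base z"
    unfolding base_def using p c.total_pos cmp.total_lower
    by (intro prod_mono conjI powr_mono2) (auto intro: less_imp_le)
  ultimately show ?thesis by simp
qed

end

text \<open>Collects the numerical constants of the error terms in \<open>shifted_le\<close> below.\<close>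

definition loss :: "real \<Rightarrow> real \<Rightarrow> real" where
  "loss p d = p * (p * d + 2) / 2 + p + 4 * p\<^sup>2 * d"

lemma loss_nonneg: "0 < p \<Longrightarrow> 0 \<le> d \<Longrightarrow> 0 \<le> loss p d"
  by (auto simp: loss_def)

context near_axis_tubes
begin

text \<open>\<open>shifted a\<close> is the product after the tubes have been translated by the vectors \<open>a j i\<close>; \<open>drift a\<close> is
  the first order term of its logarithm, up to the factor \<open>p\<close>; \<open>spread a\<close> measures the size of the
  second order terms, and all errors have to be bounded by small multiples of it.\<close>

definition shifted :: "('n \<Rightarrow> 'i \<Rightarrow> real^'n) \<Rightarrow> real^'n \<Rightarrow> real" where
  "shifted a z = (\<Prod>j\<in>UNIV. (\<Sum>i\<in>I j. c j i * exp (- (norm (perp (\<omega> j i) z - a j i))\<^sup>2 / 2)) powr p)"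

definition drift :: "('n \<Rightarrow> 'i \<Rightarrow> real^'n) \<Rightarrow> real^'n \<Rightarrow> real" where
  "drift a z = (\<Sum>j\<in>UNIV. avg (I j) (wt j z) (\<lambda>i. a j i \<bullet> z))"

definition spread :: "('n \<Rightarrow> 'i \<Rightarrow> real^'n) \<Rightarrow> real" where
  "spread a = (\<Sum>j\<in>UNIV. avg (I j) (c j) (\<lambda>i. (norm (a j i))\<^sup>2))"

lemma spread_nonneg: "0 \<le> spread a"
  unfolding spread_def by (intro sum_nonneg c.avg_nonneg) simp

context
  fixes a :: "'n \<Rightarrow> 'i \<Rightarrow> real^'n" and \<epsilon> :: real
  assumes small: "\<And>j i. i \<in> I j \<Longrightarrow> norm (a j i) \<le> \<epsilon>" and eps: "\<epsilon> \<le> 1"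
    and orth: "\<And>j i. i \<in> I j \<Longrightarrow> perp (\<omega> j i) (a j i) = a j i"
    and centred: "(\<Sum>j\<in>UNIV. (1 / sum (c j) (I j)) *\<^sub>R (\<Sum>i\<in>I j. c j i *\<^sub>R a j i)) = 0"
begin

lemma shifted_eq:
  "shifted a z = base z * exp (p * (\<Sum>j\<in>UNIV. shift_log (I j) (wt j z) (a j) z))"
proof -
  have "(\<Sum>i\<in>I j. c j i * exp (- (norm (perp (\<omega> j i) z - a j i))\<^sup>2 / 2)) powr p
      = sum (wt j z) (I j) powr p * exp (p * shift_log (I j) (wt j z) (a j) z)" for j
  proof -
    let ?A = "avg (I j) (wt j z) (\<lambda>i. exp (a j i \<bullet> z - (norm (a j i))\<^sup>2 / 2))"
    have "(\<Sum>i\<in>I j. c j i * exp (- (norm (perp (\<omega> j i) z - a j i))\<^sup>2 / 2))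
      = (\<Sum>i\<in>I j. wt j z i * exp (a j i \<bullet> z - (norm (a j i))\<^sup>2 / 2))"
    proof (rule sum.cong[OF refl])
      fix i assume i: "i \<in> I j"
      have "perp (\<omega> j i) z \<bullet> a j i = z \<bullet> a j i"
        using perp_inner_perp[OF unit[OF i], of "a j i" z] orth[OF i] by (simp add: inner_commute)
      then have "(norm (perp (\<omega> j i) z - a j i))\<^sup>2
        = (norm (perp (\<omega> j i) z))\<^sup>2 - 2 * (a j i \<bullet> z) + (norm (a j i))\<^sup>2"
        by (simp add: power2_norm_eq_inner inner_diff_left inner_diff_right inner_commute)
      then have "- (norm (perp (\<omega> j i) z - a j i))\<^sup>2 / 2
        = - (norm (perp (\<omega> j i) z))\<^sup>2 / 2 + (a j i \<bullet> z - (norm (a j i))\<^sup>2 / 2)" by simp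
      then show "c j i * exp (- (norm (perp (\<omega> j i) z - a j i))\<^sup>2 / 2)
        = wt j z i * exp (a j i \<bullet> z - (norm (a j i))\<^sup>2 / 2)"
        by (simp only: wt_def exp_add mult.assoc)
    qed
    also have "\<dots> = sum (wt j z) (I j) * ?A"
      using wt.total_pos[of j z] by (simp add: avg_def)
    finally have "(\<Sum>i\<in>I j. c j i * exp (- (norm (perp (\<omega> j i) z - a j i))\<^sup>2 / 2)) powr p
      = sum (wt j z) (I j) powr p * ?A powr p"
      using wt.total_pos[of j z] wt.avg_exp_pos by (simp add: powr_mult less_imp_le)
    also have "?A powr p = exp (p * shift_log (I j) (wt j z) (a j) z)"
      using wt.avg_exp_pos[of j z "\<lambda>i. a j i \<bullet> z - (norm (a j i))\<^sup>2 / 2"]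
      by (simp add: shift_log_def powr_def)
    finally show ?thesis .
  qed
  then show ?thesis
    by (simp add: shifted_def base_def prod.distrib exp_sum sum_distrib_left)
qed

lemma centred_inner: "(\<Sum>j\<in>UNIV. avg (I j) (c j) (\<lambda>i. a j i \<bullet> z)) = 0"
proof -
  have "(\<Sum>j\<in>UNIV. avg (I j) (c j) (\<lambda>i. a j i \<bullet> z))
     = (\<Sum>j\<in>UNIV. (1 / sum (c j) (I j)) *\<^sub>R (\<Sum>i\<in>I j. c j i *\<^sub>R a j i)) \<bullet> z"
    by (simp add: inner_sum_left avg_def)
  then show ?thesis by (simp add: centred)
qed

text \<open>The drift vanishes for the weights at the origin, since the vectors \<open>a j i\<close> are centred. The weights
  at \<open>z\<close> differ from these by factors \<open>exp (\<plusminus>\<eta> * (norm z)\<^sup>2)\<close> only, hence the drift is of order \<open>\<eta>\<close>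
  relative to the vectors \<open>a\<close>.\<close>

lemma drift_sq:
  fixes z :: "real^'n"
  defines "n \<equiv> norm z"
  shows "(drift a z)\<^sup>2 \<le> 4 * \<eta> * d * n ^ 6 * exp (4 * \<eta> * n\<^sup>2) * spread a"
proof -
  let ?w = "\<lambda>j. avg (I j) (wt j z) (\<lambda>i. a j i \<bullet> z)" and ?c = "\<lambda>j. avg (I j) (c j) (\<lambda>i. a j i \<bullet> z)"
  let ?A = "\<lambda>j. avg (I j) (c j) (\<lambda>i. norm (a j i))"
  have A: "0 \<le> ?A j" for j by (rule c.avg_nonneg) simp
  have e: "exp (2 * (\<eta> * n\<^sup>2)) - 1 \<le> 2 * \<eta> * n\<^sup>2 * exp (2 * \<eta> * n\<^sup>2)"
    using exp_minus_one_le[of "2 * (\<eta> * n\<^sup>2)"] by (simp add: mult.assoc)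
  have "\<bar>drift a z\<bar> = \<bar>\<Sum>j\<in>UNIV. ?w j - ?c j\<bar>"
    unfolding sum_subtractf centred_inner drift_def by simp
  also have "\<dots> \<le> (\<Sum>j\<in>UNIV. \<bar>?w j - ?c j\<bar>)"
    by (rule sum_abs)
  also have "\<dots> \<le> (\<Sum>j\<in>UNIV. (2 * \<eta> * n\<^sup>2 * exp (2 * \<eta> * n\<^sup>2)) * (n * ?A j))"
  proof (rule sum_mono)
    fix j
    have "\<bar>?w j - ?c j\<bar>
      \<le> (exp (2 * (\<eta> * n\<^sup>2)) - 1) * avg (I j) (c j) (\<lambda>i. \<bar>a j i \<bullet> z\<bar>)"
      unfolding n_def by (rule cmp.avg_change)
    also have "\<dots> \<le> (2 * \<eta> * n\<^sup>2 * exp (2 * \<eta> * n\<^sup>2)) * avg (I j) (c j) (\<lambda>i. n * norm (a j i))"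
    proof (rule mult_mono[OF e])
      show "avg (I j) (c j) (\<lambda>i. \<bar>a j i \<bullet> z\<bar>) \<le> avg (I j) (c j) (\<lambda>i. n * norm (a j i))"
        unfolding n_def by (intro c.avg_mono) (metis Cauchy_Schwarz_ineq2 mult.commute)
      show "0 \<le> avg (I j) (c j) (\<lambda>i. \<bar>a j i \<bullet> z\<bar>)" by (rule c.avg_nonneg) simp
    qed (use \<eta>_nonneg in simp)
    finally show "\<bar>?w j - ?c j\<bar>
      \<le> (2 * \<eta> * n\<^sup>2 * exp (2 * \<eta> * n\<^sup>2)) * (n * ?A j)" by (simp add: c.avg_cmult)
  qed
  also have "\<dots> = 2 * \<eta> * n ^ 3 * exp (2 * \<eta> * n\<^sup>2) * (\<Sum>j\<in>UNIV. ?A j)"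
    by (simp add: sum_distrib_left power2_eq_square power3_eq_cube ac_simps)
  finally have 1: "\<bar>drift a z\<bar> \<le> 2 * \<eta> * n ^ 3 * exp (2 * \<eta> * n\<^sup>2) * (\<Sum>j\<in>UNIV. ?A j)" .
  have "(\<Sum>j\<in>UNIV. ?A j)\<^sup>2 \<le> d * (\<Sum>j\<in>UNIV. (?A j)\<^sup>2)"
    using sum_squared_le_sum_of_squares[of ?A UNIV] by (simp add: d_def mult.commute)
  also have "\<dots> \<le> d * spread a"
    unfolding spread_def by (intro mult_left_mono sum_mono c.avg_square) (simp add: d_def)
  finally have 2: "(\<Sum>j\<in>UNIV. ?A j)\<^sup>2 \<le> d * spread a" .
  have "(drift a z)\<^sup>2 \<le> (2 * \<eta> * n ^ 3 * exp (2 * \<eta> * n\<^sup>2) * (\<Sum>j\<in>UNIV. ?A j))\<^sup>2"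
    using power_mono[OF 1, of 2] by simp
  also have "\<dots> = (4 * \<eta>\<^sup>2 * n ^ 6 * exp (4 * \<eta> * n\<^sup>2)) * (\<Sum>j\<in>UNIV. ?A j)\<^sup>2"
    by (simp add: power_mult_distrib exp_double[symmetric] power_mult[symmetric] mult.assoc[symmetric])
  also have "\<dots> \<le> (4 * \<eta> * n ^ 6 * exp (4 * \<eta> * n\<^sup>2)) * (d * spread a)"
  proof (rule mult_mono[OF _ 2])
    have "\<eta>\<^sup>2 \<le> \<eta>" using \<eta> \<eta>_nonneg by (simp add: power2_eq_square mult_left_le_one_le)
    then show "4 * \<eta>\<^sup>2 * n ^ 6 * exp (4 * \<eta> * n\<^sup>2) \<le> 4 * \<eta> * n ^ 6 * exp (4 * \<eta> * n\<^sup>2)"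
      by (intro mult_right_mono) (auto simp: n_def)
  qed (use \<eta>_nonneg in \<open>auto simp: n_def\<close>)
  finally show ?thesis by (simp add: ac_simps)
qed

lemma eps_nonneg: "0 \<le> \<epsilon>"
proof -
  obtain i where "i \<in> I undefined" using c.nonempty by blast
  with small[of i undefined] norm_ge_zero show ?thesis by (meson order_trans)
qed

text \<open>The key expansion. Write \<open>shifted a = base * exp S\<close> and use \<open>exp S \<le> 1 + S + S\<^sup>2 / 2 * exp \<bar>S\<bar>\<close>. The
  first order part of \<open>S\<close> is \<open>p * drift a\<close>, which is odd in \<open>z\<close> and will integrate to zero. The second
  order part is compared with averages with respect to the fixed weights \<open>c\<close> and with the exact
  Gaussian \<open>\<Lambda>\<close>. The square \<open>S\<^sup>2\<close> would be of second order as well, but by \<open>drift_sq\<close> it is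
  smaller by a factor \<open>\<eta>\<close>. Everything else is of third order in \<open>a\<close> or carries a factor \<open>\<eta>\<close>.\<close>

lemma shifted_le:
  fixes z :: "real^'n"
  defines "n \<equiv> norm z"
  defines "\<Lambda> \<equiv> exp (- \<mu> * n\<^sup>2 / 2)"
  shows "shifted a z \<le> base z + p * (base z * drift a z)
    + p / 2 * mass * (\<Sum>j\<in>UNIV. \<Lambda> * avg (I j) (c j) (\<lambda>i. (a j i \<bullet> z)\<^sup>2 - (norm (a j i))\<^sup>2))
    + mass * ((\<epsilon> + \<eta>) * loss p d * (\<Lambda> * exp ((p * d + 4) * \<eta> * n\<^sup>2) * exp ((p * d + 10) * (n + 1))) * spread a)"
proof -
  define B where "B = (n + 1) ^ 3 * exp (n + 1)"
  \<comment> \<open>Growth factors: \<open>e\<close> bounds all effects of the directions, \<open>q\<close> all polynomials and exponentials in \<open>norm z\<close>.\<close>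
  define e q where "e k = exp (k * (\<eta> * n\<^sup>2))" and "q k = exp (k * (n + 1))" for k :: real
  define \<rho> where "\<rho> = base z"
  define U D M where "U j = shift_log (I j) (wt j z) (a j) z"
    and "D j = avg (I j) (wt j z) (\<lambda>i. (norm (a j i))\<^sup>2)"
    and "M j = avg (I j) (wt j z) (\<lambda>i. (a j i \<bullet> z)\<^sup>2)" for j
  define \<Delta> N where "\<Delta> j = avg (I j) (c j) (\<lambda>i. (norm (a j i))\<^sup>2)"
    and "N j = avg (I j) (c j) (\<lambda>i. (a j i \<bullet> z)\<^sup>2)" for j
  define S where "S = p * (\<Sum>j\<in>UNIV. U j)"
  define Z where "Z = e (p * d + 4) * q (p * d + 10)"
  let ?V = "(\<Sum>j\<in>UNIV. M j / 2 - D j / 2 + \<epsilon> * B * D j)"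
  let ?N = "(\<Sum>j\<in>UNIV. \<Lambda> * (N j - \<Delta> j))"
  let ?D = "(\<Sum>j\<in>UNIV. D j)"
  let ?U = "(\<Sum>j\<in>UNIV. U j)"
  let ?S2 = "(4 * p\<^sup>2 * d * spread a * (\<eta> * (e 4 * q 6) + \<epsilon> * (e 2 * q 8)))"
  let ?R1 = "(4 * \<eta> * d * q 6 * e 4 * spread a)"
  let ?R2 = "(4 * q 8 * ((d * \<epsilon>) * (e 2 * spread a)))"
  let ?err = "((p * d + 2) / 2 * \<eta> + \<epsilon>)"
  have n: "0 \<le> n" by (simp add: n_def)
  have d: "0 \<le> d" by (simp add: d_def)
  have pd: "0 \<le> p * d" using p d by simp
  have e_mono: "e k \<le> e l" if "k \<le> l" for k l
    using that \<eta>_nonneg by (auto simp: e_def intro!: mult_right_mono)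
  have q_mono: "q k \<le> q l" if "k \<le> l" for k l
    using that n by (auto simp: q_def intro!: mult_right_mono)
  have e_add: "e k * e l = e (k + l)" and q_add: "q k * q l = q (k + l)" for k l
    by (simp_all add: e_def q_def exp_add[symmetric] distrib_right)
  have e_pos: "0 < e k" and q_pos: "0 < q k" for k by (simp_all add: e_def q_def)
  have eq: "e k * q l \<le> Z" if "k \<le> p * d + 4" "l \<le> p * d + 10" for k l
    unfolding Z_def using e_mono[OF that(1)] q_mono[OF that(2)] e_pos q_pos
    by (intro mult_mono) (auto intro: less_imp_le)
  have poly: "(n + 1) ^ k \<le> q (real k)" for k
  proof -
    have "(n + 1) ^ k \<le> exp (n + 1) ^ k"
      using exp_ge_add_one_self[of "n + 1"] n by (intro power_mono) auto
    then show ?thesis by (simp add: q_def exp_of_nat_mult)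
  qed
  have "B \<le> q 3 * q 1"
    unfolding B_def using poly[of 3] by (intro mult_mono) (auto simp: q_def)
  then have B: "0 \<le> B" "B \<le> q 4"
    using n by (simp_all add: B_def q_add)
  have mass: "0 < mass" by (rule mass_pos)
  have \<rho>: "0 < \<rho>" "\<rho> \<le> mass * \<Lambda> * e (p * d)" "mass * \<Lambda> * e (- (p * d)) \<le> \<rho>"
    using base_pos[of z] base_upper[of z] base_lower[of z]
    by (simp_all add: \<rho>_def \<Lambda>_def e_def n_def mult.assoc)
  have \<Lambda>: "0 < \<Lambda>" by (simp add: \<Lambda>_def)
  have \<Delta>: "0 \<le> \<Delta> j" for j unfolding \<Delta>_def by (rule c.avg_nonneg) simp
  have D0: "0 \<le> D j" for j unfolding D_def by (rule wt.avg_nonneg) simp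
  have M0: "0 \<le> M j" for j unfolding M_def by (rule wt.avg_nonneg) simp
  have D: "D j \<le> e 2 * \<Delta> j" "e (- 2) * \<Delta> j \<le> D j" and M: "M j \<le> e 2 * N j" for j
    using cmp.avg_upper[where j = j and z = z and h = "\<lambda>i. (norm (a j i))\<^sup>2"]
      cmp.avg_lower[where j = j and z = z and h = "\<lambda>i. (norm (a j i))\<^sup>2"]
      cmp.avg_upper[where j = j and z = z and h = "\<lambda>i. (a j i \<bullet> z)\<^sup>2"]
    by (simp_all add: D_def M_def N_def \<Delta>_def e_def n_def)
  have N: "N j \<le> n\<^sup>2 * \<Delta> j" for j
    unfolding N_def \<Delta>_def c.avg_cmult[symmetric]
  proof (rule c.avg_mono)
    fix i show "(a j i \<bullet> z)\<^sup>2 \<le> n\<^sup>2 * (norm (a j i))\<^sup>2"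
      using power_mono[OF Cauchy_Schwarz_ineq2[of "a j i" z], of 2]
      by (simp add: power_mult_distrib mult.commute n_def)
  qed
  have sumD: "?D \<le> e 2 * spread a"
    unfolding spread_def sum_distrib_left using D(1) by (intro sum_mono) (simp add: \<Delta>_def)
  have sumD': "?D \<le> d * \<epsilon>"
  proof -
    have "D j \<le> \<epsilon>" for j
      unfolding D_def
    proof (rule wt.avg_le_const)
      fix i assume i: "i \<in> I j"
      have "(norm (a j i))\<^sup>2 \<le> 1 * norm (a j i)"
        unfolding power2_eq_square using small[OF i] eps by (intro mult_right_mono) auto
      with small[OF i] show "(norm (a j i))\<^sup>2 \<le> \<epsilon>" by simp
    qed
    then show ?thesis using sum_bounded_above[of UNIV D \<epsilon>] by (simp add: d_def)
  qed
  \<comment> \<open>Upper bound for \<open>S\<close> up to second order, used in the linear term of \<open>exp S\<close>.\<close>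
  have S_upper: "S \<le> p * drift a z + p * ?V"
  proof -
    have "?U \<le> (\<Sum>j\<in>UNIV. avg (I j) (wt j z) (\<lambda>i. a j i \<bullet> z)
        + (M j / 2 - D j / 2 + \<epsilon> * B * D j))"
      using wt.shift_log_upper[OF small eps, where z = z]
      by (intro sum_mono) (simp add: U_def M_def D_def B_def n_def algebra_simps)
    then show ?thesis unfolding S_def distrib_left[symmetric] sum.distrib[symmetric] drift_def
      using p by (intro mult_left_mono) auto
  qed
  \<comment> \<open>Two-sided bound for \<open>S\<close> up to first order, used for \<open>S\<^sup>2\<close>.\<close>
  have "\<bar>?U - drift a z\<bar> \<le> (\<Sum>j\<in>UNIV. \<bar>U j - avg (I j) (wt j z) (\<lambda>i. a j i \<bullet> z)\<bar>)"
    unfolding drift_def sum_subtractf[symmetric] by (rule sum_abs)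
  also have "\<dots> \<le> (\<Sum>j\<in>UNIV. 2 * B * D j)"
    using wt.shift_log_deviation[OF small eps, where z = z]
    by (intro sum_mono) (simp add: U_def D_def B_def n_def)
  finally have dev: "\<bar>?U - drift a z\<bar> \<le> 2 * B * ?D"
    by (simp add: sum_distrib_left)
  have "(2 * B * ?D)\<^sup>2 = 4 * (B * B) * (?D * ?D)"
    by (simp add: power2_eq_square)
  also have "\<dots> \<le> ?R2"
  proof (intro mult_mono)
    show "B * B \<le> q 8" using mult_mono[OF B(2) B(2)] B q_add[of 4 4] q_pos[of 4] by simp
  qed (use sumD sumD' D0 B d eps_nonneg q_pos[of 8] in \<open>auto intro!: sum_nonneg mult_nonneg_nonneg\<close>)
  finally have dev2: "(2 * B * ?D)\<^sup>2 \<le> ?R2" .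
  have "(drift a z)\<^sup>2 \<le> 4 * \<eta> * d * n ^ 6 * e 4 * spread a"
    using drift_sq[of z] by (simp add: e_def n_def mult.assoc)
  also have "\<dots> \<le> ?R1"
  proof (intro mult_right_mono mult_left_mono)
    have "n ^ 6 \<le> (n + 1) ^ 6" using n by (intro power_mono) auto
    then show "n ^ 6 \<le> q 6" using poly[of 6] by simp
  qed (use d \<eta>_nonneg e_pos[of 4] spread_nonneg in auto)
  finally have dr2: "(drift a z)\<^sup>2 \<le> ?R1" .
  have "?U\<^sup>2 \<le> 2 * (drift a z)\<^sup>2 + 2 * (2 * B * ?D)\<^sup>2"
  proof -
    have "(x::real)\<^sup>2 \<le> 2 * y\<^sup>2 + 2 * w\<^sup>2" if "\<bar>x - y\<bar> \<le> w" for x y w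
    proof -
      have "(x - y)\<^sup>2 \<le> w\<^sup>2" using that by (metis abs_ge_zero power2_abs power_mono)
      moreover have "x\<^sup>2 + (x - 2 * y)\<^sup>2 = 2 * y\<^sup>2 + 2 * (x - y)\<^sup>2"
        by (simp add: power2_eq_square algebra_simps)
      ultimately show ?thesis using zero_le_power2[of "x - 2 * y"] by linarith
    qed
    then show ?thesis using dev by blast
  qed
  then have "?U\<^sup>2 \<le> 2 * ?R1 + 2 * ?R2"
    using dr2 dev2 by linarith
  then have "p\<^sup>2 * ?U\<^sup>2 \<le> p\<^sup>2 * (2 * ?R1 + 2 * ?R2)"
    by (intro mult_left_mono) auto
  then have S_sq: "S\<^sup>2 / 2 \<le> ?S2"
    by (simp add: S_def power_mult_distrib algebra_simps)
  have S_abs: "\<bar>S\<bar> \<le> p * d * (n + 1)"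
  proof -
    have "\<bar>U j\<bar> \<le> n + 1" for j
    proof -
      have "\<bar>U j\<bar> \<le> \<epsilon> * (n + 1)"
        using wt.shift_log_abs[OF small eps, where z = z] by (simp add: U_def n_def)
      also have "\<dots> \<le> 1 * (n + 1)" using eps n by (intro mult_right_mono) auto
      finally show ?thesis by simp
    qed
    then have "(\<Sum>j\<in>UNIV. \<bar>U j\<bar>) \<le> d * (n + 1)"
      using sum_bounded_above[of UNIV "\<lambda>j. \<bar>U j\<bar>" "n + 1"] by (simp add: d_def)
    then have "\<bar>\<Sum>j\<in>UNIV. U j\<bar> \<le> d * (n + 1)"
      using sum_abs[of U UNIV] by linarith
    then show ?thesis using p by (simp add: S_def abs_mult mult.assoc)
  qed
  have T3: "\<rho> * (S\<^sup>2 / 2 * exp \<bar>S\<bar>) \<le> mass * \<Lambda> * (4 * p\<^sup>2 * d * (\<epsilon> + \<eta>) * Z * spread a)"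
  proof -
    have "exp \<bar>S\<bar> \<le> q (p * d)" using S_abs by (simp add: q_def)
    moreover have "0 \<le> ?S2"
      by (rule order_trans[OF _ S_sq]) simp
    ultimately have "S\<^sup>2 / 2 * exp \<bar>S\<bar> \<le> ?S2 * q (p * d)"
      by (intro mult_mono[OF S_sq]) simp_all
    from mult_mono[OF \<rho>(2) this] have "\<rho> * (S\<^sup>2 / 2 * exp \<bar>S\<bar>) \<le> (mass * \<Lambda> * e (p * d)) *
       (?S2 * q (p * d))"
      using mass \<Lambda> e_pos[of "p * d"] by simp
    also have "\<dots> = mass * \<Lambda> * (4 * p\<^sup>2 * d * spread a) *
       (\<eta> * ((e (p * d) * e 4) * (q 6 * q (p * d))) + \<epsilon> * ((e (p * d) * e 2) * (q 8 * q (p * d))))"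
      by (simp add: algebra_simps)
    also have "\<dots> \<le> mass * \<Lambda> * (4 * p\<^sup>2 * d * spread a) * (\<eta> * Z + \<epsilon> * Z)"
    proof (rule mult_left_mono)
      have "e (p * d) * e 4 * (q 6 * q (p * d)) \<le> Z" "e (p * d) * e 2 * (q 8 * q (p * d)) \<le> Z"
        unfolding e_add q_add by (rule eq; simp)+
      then show "\<eta> * (e (p * d) * e 4 * (q 6 * q (p * d))) + \<epsilon> * (e (p * d) * e 2 * (q 8 * q (p * d)))
          \<le> \<eta> * Z + \<epsilon> * Z"
        by (rule add_mono[OF mult_left_mono[OF _ \<eta>_nonneg] mult_left_mono[OF _ eps_nonneg]])
      show "0 \<le> mass * \<Lambda> * (4 * p\<^sup>2 * d * spread a)" using mass \<Lambda> d spread_nonneg by simp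
    qed
    finally show ?thesis by (simp add: algebra_simps)
  qed
  define x where "x = (p * d + 2) * (\<eta> * n\<^sup>2)"
  have x: "e (p * d + 2) = exp x" "e (- (p * d)) * e (- 2) = exp (- x)" "0 \<le> x"
  proof -
    show "e (p * d + 2) = exp x" by (simp add: e_def x_def)
    show "e (- (p * d)) * e (- 2) = exp (- x)" unfolding e_add by (simp add: e_def x_def algebra_simps)
    show "0 \<le> x" using pd \<eta>_nonneg by (auto simp: x_def intro!: mult_nonneg_nonneg)
  qed
  \<comment> \<open>\<open>exp x + exp (- x) \<ge> 2\<close> in the form in which errors from below and from above are treated alike.\<close>
  have cosh: "1 - (exp x - 1) \<le> exp (- x)"
    using exp_ge_add_one_self[of x] exp_ge_add_one_self[of "- x"] by linarith
  have T12: "\<rho> * (M j / 2 - D j / 2 + \<epsilon> * B * D j)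
     \<le> mass * (\<Lambda> * (N j - \<Delta> j)) / 2 + mass * \<Lambda> * ?err * Z * \<Delta> j" for j
  proof -
    have N0: "0 \<le> N j" unfolding N_def by (rule c.avg_nonneg) simp
    have "\<rho> * M j \<le> (mass * \<Lambda> * e (p * d)) * (e 2 * N j)"
      using \<rho> M M0 by (intro mult_mono) (auto intro: mult_nonneg_nonneg)
    also have "\<dots> = mass * \<Lambda> * N j + mass * \<Lambda> * ((exp x - 1) * N j)"
      unfolding x(1)[symmetric] e_add[symmetric] by (simp add: algebra_simps)
    also have "\<dots> \<le> mass * \<Lambda> * N j + mass * \<Lambda> * ((exp x - 1) * (n\<^sup>2 * \<Delta> j))"
      using mass \<Lambda> x(3) N by (intro add_left_mono mult_left_mono) auto
    finally have m1: "\<rho> * M j \<le> mass * \<Lambda> * N j + mass * \<Lambda> * ((exp x - 1) * (n\<^sup>2 * \<Delta> j))" .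
    have "mass * \<Lambda> * ((1 - (exp x - 1)) * \<Delta> j) \<le> mass * \<Lambda> * (exp (- x) * \<Delta> j)"
      using mass \<Lambda> cosh \<Delta> by (intro mult_left_mono mult_right_mono) auto
    also have "\<dots> = (mass * \<Lambda> * e (- (p * d))) * (e (- 2) * \<Delta> j)"
      unfolding x(2)[symmetric] by (simp add: ac_simps)
    also have "\<dots> \<le> \<rho> * D j"
      using \<rho>(1) mult_nonneg_nonneg[OF less_imp_le[OF e_pos] \<Delta>] by (intro mult_mono \<rho>(3) D(2)) simp_all
    finally have m2: "mass * \<Lambda> * ((1 - (exp x - 1)) * \<Delta> j) \<le> \<rho> * D j" .
    have "(exp x - 1) * (n\<^sup>2 + 1) \<le> (x * exp x) * (n + 1)\<^sup>2"
      using exp_minus_one_le[of x] x(3) n by (intro mult_mono) (auto simp: power2_eq_square algebra_simps)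
    also have "\<dots> = (p * d + 2) * \<eta> * (n\<^sup>2 * (n + 1)\<^sup>2) * e (p * d + 2)"
      unfolding x(1) by (simp add: x_def)
    also have "\<dots> \<le> (p * d + 2) * \<eta> * q 4 * e (p * d + 2)"
    proof (intro mult_right_mono mult_left_mono)
      have "n\<^sup>2 * (n + 1)\<^sup>2 \<le> (n + 1)\<^sup>2 * (n + 1)\<^sup>2"
        using n by (intro mult_right_mono power_mono) auto
      then show "n\<^sup>2 * (n + 1)\<^sup>2 \<le> q 4" using poly[of 4] by (simp add: power_add[symmetric])
    qed (use pd \<eta>_nonneg e_pos[of "p * d + 2"] in auto)
    also have "\<dots> \<le> (p * d + 2) * \<eta> * Z"
      using eq[of "p * d + 2" 4] pd \<eta>_nonneg by (simp add: mult.assoc mult.commute[of "q 4"] mult_left_mono)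
    finally have m3: "(exp x - 1) * (n\<^sup>2 + 1) \<le> (p * d + 2) * \<eta> * Z" .
    have "\<rho> * (B * D j) \<le> (mass * \<Lambda> * e (p * d)) * (q 4 * (e 2 * \<Delta> j))"
      using \<rho> B D D0 q_pos[of 4] by (intro mult_mono) (auto intro: mult_nonneg_nonneg)
    also have "\<dots> = mass * \<Lambda> * \<Delta> j * (e (p * d + 2) * q 4)"
      unfolding e_add[symmetric] by (simp add: ac_simps)
    also have "\<dots> \<le> mass * \<Lambda> * \<Delta> j * Z"
      using mass \<Lambda> \<Delta> pd by (intro mult_left_mono eq) auto
    finally have m4: "\<rho> * (B * D j) \<le> mass * \<Lambda> * \<Delta> j * Z" .
    have "\<rho> * (M j / 2 - D j / 2 + \<epsilon> * B * D j) = (\<rho> * M j) / 2 - (\<rho> * D j) / 2 + \<epsilon> * (\<rho> * (B * D j))"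
      by (simp add: algebra_simps)
    also have "\<dots> \<le> (mass * \<Lambda> * N j + mass * \<Lambda> * ((exp x - 1) * (n\<^sup>2 * \<Delta> j))) / 2
       - (mass * \<Lambda> * ((1 - (exp x - 1)) * \<Delta> j)) / 2 + \<epsilon> * (mass * \<Lambda> * \<Delta> j * Z)"
      using m1 m2 mult_left_mono[OF m4 eps_nonneg] by (intro add_mono diff_mono divide_right_mono) auto
    also have "\<dots> = mass * (\<Lambda> * (N j - \<Delta> j)) / 2 + mass * \<Lambda> * \<Delta> j * (((exp x - 1) * (n\<^sup>2 + 1)) / 2)
       + \<epsilon> * (mass * \<Lambda> * \<Delta> j * Z)"
      by (simp add: field_simps)
    also have "\<dots> \<le> mass * (\<Lambda> * (N j - \<Delta> j)) / 2 + mass * \<Lambda> * \<Delta> j * (((p * d + 2) * \<eta> * Z) / 2)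
       + \<epsilon> * (mass * \<Lambda> * \<Delta> j * Z)"
      using mass \<Lambda> \<Delta> m3 by (intro add_right_mono add_left_mono mult_left_mono divide_right_mono) auto
    finally show ?thesis by (simp add: field_simps)
  qed
  have "\<rho> * ?V
     \<le> (\<Sum>j\<in>UNIV. mass * (\<Lambda> * (N j - \<Delta> j)) / 2 + mass * \<Lambda> * ?err * Z * \<Delta> j)"
    unfolding sum_distrib_left by (intro sum_mono T12)
  also have "\<dots> = mass * ?N / 2
     + mass * \<Lambda> * ?err * Z * spread a"
    by (simp add: sum.distrib sum_distrib_left sum_divide_distrib spread_def \<Delta>_def)
  finally have T: "\<rho> * ?V
     \<le> mass * ?N / 2
     + mass * \<Lambda> * ?err * Z * spread a" .
  have "shifted a z = \<rho> * exp S" by (simp add: shifted_eq \<rho>_def S_def U_def)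
  also have "\<dots> \<le> \<rho> * (1 + S + S\<^sup>2 / 2 * exp \<bar>S\<bar>)"
    using \<rho> by (intro mult_left_mono exp_le_quadratic) auto
  also have "\<dots> = \<rho> + \<rho> * S + \<rho> * (S\<^sup>2 / 2 * exp \<bar>S\<bar>)" by (simp add: algebra_simps)
  also have "\<dots> \<le> \<rho> + \<rho> * (p * drift a z + p * ?V)
     + mass * \<Lambda> * (4 * p\<^sup>2 * d * (\<epsilon> + \<eta>) * Z * spread a)"
    using \<rho> by (intro add_mono mult_left_mono S_upper T3) auto
  also have "\<dots> = \<rho> + p * (\<rho> * drift a z) + p * (\<rho> * ?V)
     + mass * \<Lambda> * (4 * p\<^sup>2 * d * (\<epsilon> + \<eta>) * Z * spread a)"
    by (simp add: algebra_simps)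
  also have "\<dots> \<le> \<rho> + p * (\<rho> * drift a z) + p * (mass * ?N / 2
     + mass * \<Lambda> * ?err * Z * spread a)
     + mass * \<Lambda> * (4 * p\<^sup>2 * d * (\<epsilon> + \<eta>) * Z * spread a)"
    using p by (intro add_right_mono add_left_mono mult_left_mono T) auto
  also have "\<dots> \<le> \<rho> + p * (\<rho> * drift a z) + p / 2 * mass * ?N
     + mass * \<Lambda> * Z * spread a * ((\<epsilon> + \<eta>) * loss p d)"
  proof -
    have "p * ?err + 4 * p\<^sup>2 * d * (\<epsilon> + \<eta>) \<le> (\<epsilon> + \<eta>) * loss p d"
    proof -
      have "(\<epsilon> + \<eta>) * loss p d = p * ?err + 4 * p\<^sup>2 * d * (\<epsilon> + \<eta>)
          + (\<eta> * p + \<epsilon> * (p * (p * d + 2) / 2))"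
        by (simp add: loss_def field_simps power2_eq_square)
      moreover have "0 \<le> \<eta> * p" "0 \<le> \<epsilon> * (p * (p * d + 2) / 2)"
        using p pd \<eta>_nonneg eps_nonneg by simp_all
      ultimately show ?thesis by linarith
    qed
    then have "mass * \<Lambda> * Z * spread a * (p * ?err + 4 * p\<^sup>2 * d * (\<epsilon> + \<eta>))
       \<le> mass * \<Lambda> * Z * spread a * ((\<epsilon> + \<eta>) * loss p d)"
      using mass \<Lambda> spread_nonneg less_imp_le[OF e_pos] less_imp_le[OF q_pos]
      by (intro mult_left_mono) (simp_all add: Z_def)
    then show ?thesis by (simp add: algebra_simps)
  qed
  finally show ?thesis
    by (simp add: \<rho>_def N_def \<Delta>_def c.avg_diff Z_def e_def q_def ac_simps)
qed

end

end

section \<open>Lebesgue integrals and Gaussians\<close>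

lemma nn_integral_translate:
  fixes f :: "'a::euclidean_space \<Rightarrow> ennreal"
  assumes [measurable]: "f \<in> borel_measurable borel"
  shows "(\<integral>\<^sup>+x. f (t + x) \<partial>lborel) = (\<integral>\<^sup>+x. f x \<partial>lborel)"
  by (subst (2) lborel_affine[of 1 t]) (simp_all add: nn_integral_density nn_integral_distr)

lemma nn_integral_reflect:
  fixes f :: "'a::euclidean_space \<Rightarrow> ennreal"
  assumes [measurable]: "f \<in> borel_measurable borel"
  shows "(\<integral>\<^sup>+x. f (- x) \<partial>lborel) = (\<integral>\<^sup>+x. f x \<partial>lborel)"
  by (subst (2) lborel_affine[of "-1" 0]) (simp_all add: nn_integral_density nn_integral_distr)

lemma nn_integral_dilate:
  fixes f :: "'a::euclidean_space \<Rightarrow> ennreal"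
  assumes [measurable]: "f \<in> borel_measurable borel" and "0 < r"
  shows "(\<integral>\<^sup>+x. f x \<partial>lborel) = ennreal (r ^ DIM('a)) * (\<integral>\<^sup>+x. f (r *\<^sub>R x) \<partial>lborel)"
  using assms(2)
  by (subst lborel_affine[of r 0]) (simp_all add: nn_integral_density nn_integral_distr nn_integral_cmult)

lemma integral_translate:
  fixes f :: "'a::euclidean_space \<Rightarrow> real"
  assumes [measurable]: "f \<in> borel_measurable borel"
  shows "(\<integral>x. f (t + x) \<partial>lborel) = (\<integral>x. f x \<partial>lborel)"
  by (subst (2) lborel_affine[of 1 t]) (simp_all add: integral_density integral_distr density_1)

lemma integral_reflect:
  fixes f :: "'a::euclidean_space \<Rightarrow> real"
  assumes [measurable]: "f \<in> borel_measurable borel"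
  shows "(\<integral>x. f (- x) \<partial>lborel) = (\<integral>x. f x \<partial>lborel)"
  by (subst (2) lborel_affine[of "-1" 0]) (simp_all add: integral_density integral_distr density_1)

lemma integral_odd_zero:
  fixes f :: "'a::euclidean_space \<Rightarrow> real"
  assumes [measurable]: "f \<in> borel_measurable borel" and "\<And>x. f (- x) = - f x"
  shows "(\<integral>x. f x \<partial>lborel) = 0"
  using integral_reflect[of f] by (simp add: assms)

definition gauss :: "real \<Rightarrow> 'a::euclidean_space \<Rightarrow> real" where
  "gauss s x = exp (- (s * (norm x)\<^sup>2))"

lemma gauss_measurable [measurable]: "gauss s \<in> borel_measurable borel"
  unfolding gauss_def[abs_def] by measurable

lemma gauss_pos: "0 < gauss s x"
  by (simp add: gauss_def)

lemma gauss_integrable: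
  assumes s: "0 < s"
  shows "integrable lborel (gauss s :: 'a::euclidean_space \<Rightarrow> real)"
proof -
  have one: "(\<integral>\<^sup>+x. ennreal (exp (- (s * (x::real)\<^sup>2))) \<partial>lborel) < \<infinity>"
  proof -
    define \<sigma> where "\<sigma> = 1 / sqrt (2 * s)"
    have \<sigma>: "0 < \<sigma>" "\<sigma>\<^sup>2 = 1 / (2 * s)" using s by (simp_all add: \<sigma>_def power_divide)
    have "integrable lborel (\<lambda>x. sqrt (2 * pi * \<sigma>\<^sup>2) * normal_density 0 \<sigma> x)"
      using \<sigma> by (intro integrable_mult_right integrable_normal_density)
    also have "(\<lambda>x. sqrt (2 * pi * \<sigma>\<^sup>2) * normal_density 0 \<sigma> x) = (\<lambda>x. exp (- (s * x\<^sup>2)))"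
      using \<sigma> s by (auto simp: normal_density_def fun_eq_iff field_simps)
    finally have "integrable lborel (\<lambda>x::real. exp (- (s * x\<^sup>2)))" .
    then show ?thesis by (simp add: integrable_iff_bounded)
  qed
  have "(norm x)\<^sup>2 = (\<Sum>b\<in>Basis. (x \<bullet> b)\<^sup>2)" for x :: 'a
    by (simp add: norm_eq_sqrt_inner euclidean_inner[of x x] power2_eq_square sum_nonneg)
  then have "(\<integral>\<^sup>+x. ennreal (gauss s (x::'a)) \<partial>lborel)
      = (\<integral>\<^sup>+x. (\<Prod>b\<in>(Basis::'a set). ennreal (exp (- (s * (x \<bullet> b)\<^sup>2)))) \<partial>lborel)"
    by (simp add: gauss_def sum_distrib_left exp_sum prod_ennreal sum_negf[symmetric])
  also have "\<dots> = (\<Prod>b\<in>(Basis::'a set). (\<integral>\<^sup>+x. ennreal (exp (- (s * x\<^sup>2))) \<partial>lborel))"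
    by (rule nn_integral_lborel_prod) auto
  also have "\<dots> < \<infinity>" using one by (simp add: power_less_top_ennreal)
  finally show ?thesis by (simp add: integrable_iff_bounded gauss_def)
qed

lemma gauss_integral_pos:
  assumes s: "0 < s"
  shows "0 < integral\<^sup>L lborel (gauss s :: 'a::euclidean_space \<Rightarrow> real)"
proof -
  have "0 \<le> integral\<^sup>L lborel (gauss s :: 'a \<Rightarrow> real)"
    by (intro Bochner_Integration.integral_nonneg less_imp_le gauss_pos)
  moreover have "integral\<^sup>L lborel (gauss s :: 'a \<Rightarrow> real) \<noteq> 0"
  proof
    assume "integral\<^sup>L lborel (gauss s :: 'a \<Rightarrow> real) = 0"
    then have "AE x in lborel. gauss s (x::'a) = 0"
      by (subst (asm) integral_nonneg_eq_0_iff_AE[OF gauss_integrable[OF s]])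
         (auto intro: less_imp_le gauss_pos)
    then have "AE x in (lborel :: 'a measure). False"
      by (rule eventually_mono) (metis gauss_pos less_irrefl)
    then show False by (simp add: eventually_False ae_filter_eq_bot_iff)
  qed
  ultimately show ?thesis by simp
qed

lemma gauss_second_moment_integrable:
  fixes a :: "'a::euclidean_space"
  assumes s: "0 < s"
  shows "integrable lborel (\<lambda>x. gauss s x * (a \<bullet> x)\<^sup>2)"
proof (rule Bochner_Integration.integrable_bound)
  show "integrable lborel (\<lambda>x::'a. ((norm a)\<^sup>2 * (2 / s)) * gauss (s / 2) x)"
    using s by (intro integrable_mult_right gauss_integrable) simp
  show "AE x in lborel. norm (gauss s x * (a \<bullet> x)\<^sup>2) \<le> norm ((norm a)\<^sup>2 * (2 / s) * gauss (s / 2) x)"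
  proof (rule AE_I2)
    fix x :: 'a
    have "s / 2 * (norm x)\<^sup>2 \<le> exp (s / 2 * (norm x)\<^sup>2)"
      using exp_ge_add_one_self[of "s / 2 * (norm x)\<^sup>2"] by linarith
    then have x: "(norm x)\<^sup>2 \<le> 2 / s * exp (s / 2 * (norm x)\<^sup>2)" using s by (simp add: field_simps)
    have "(a \<bullet> x)\<^sup>2 \<le> (norm a)\<^sup>2 * (norm x)\<^sup>2"
      using power_mono[OF Cauchy_Schwarz_ineq2[of a x], of 2] by (simp add: power_mult_distrib)
    also have "\<dots> \<le> (norm a)\<^sup>2 * (2 / s * exp (s / 2 * (norm x)\<^sup>2))"
      using x by (intro mult_left_mono) auto
    finally have "gauss s x * (a \<bullet> x)\<^sup>2 \<le> gauss s x * ((norm a)\<^sup>2 * (2 / s * exp (s / 2 * (norm x)\<^sup>2)))"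
      using gauss_pos[of s x] by (intro mult_left_mono) auto
    also have "\<dots> = (norm a)\<^sup>2 * (2 / s) * (gauss s x * exp (s / 2 * (norm x)\<^sup>2))" by simp
    also have "gauss s x * exp (s / 2 * (norm x)\<^sup>2) = gauss (s / 2) x"
      by (simp add: gauss_def exp_add[symmetric])
    finally show "norm (gauss s x * (a \<bullet> x)\<^sup>2) \<le> norm ((norm a)\<^sup>2 * (2 / s) * gauss (s / 2) x)"
      using s gauss_pos[of s x] gauss_pos[of "s/2" x] by (simp add: abs_mult)
  qed
qed auto

text \<open>This rests on the translation invariance of Lebesgue measure: the average of the translates of a
  Gaussian by \<open>\<plusminus>t *\<^sub>R a\<close> is, up to a constant factor, the Gaussian times a hyperbolic cosine, which
  is at least \<open>1 + y\<^sup>2 / 2\<close>. Comparing integrals gives the bound up to a factor \<open>exp u\<close> that tends to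
  \<open>1\<close> as \<open>t\<close> tends to \<open>0\<close>.\<close>

lemma gauss_second_moment:
  fixes a :: "'a::euclidean_space"
  assumes s: "0 < s"
  shows "(\<integral>x. gauss s x * (a \<bullet> x)\<^sup>2 \<partial>lborel) \<le> (norm a)\<^sup>2 / (2 * s) * integral\<^sup>L lborel (gauss s :: 'a \<Rightarrow> real)"
proof (cases "a = 0")
  case False
  define K where "K = (\<integral>x. gauss s x * (a \<bullet> x)\<^sup>2 \<partial>lborel)"
  define G where "G = integral\<^sup>L lborel (gauss s :: 'a \<Rightarrow> real)"
  have G: "0 < G" unfolding G_def by (rule gauss_integral_pos[OF s])
  have bound: "K \<le> exp u * ((norm a)\<^sup>2 / (2 * s) * G)" if u: "0 < u" for u
  proof -
    define t where "t = sqrt (u / (s * (norm a)\<^sup>2))"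
    have t: "s * t\<^sup>2 * (norm a)\<^sup>2 = u" "0 < t" using u s False by (simp_all add: t_def)
    have int: "integrable lborel (\<lambda>x::'a. gauss s (b + x))" for b
      by (subst integrable_distr_eq[symmetric, of "\<lambda>x. b + x" lborel borel "gauss s"])
         (auto simp: lborel_distr_plus gauss_integrable[OF s])
    have shift: "gauss s (b + x) = gauss s x * exp (- (2 * s * (b \<bullet> x))) * exp (- (s * (norm b)\<^sup>2))" for b x :: 'a
      by (simp add: gauss_def exp_add[symmetric] power2_norm_eq_inner inner_add_left inner_add_right inner_commute algebra_simps)
    have "exp (- u) * (2 * G + (2 * s * t)\<^sup>2 * K)
      = (\<integral>x. exp (- u) * (2 * gauss s x + (2 * s * t)\<^sup>2 * (gauss s x * (a \<bullet> x)\<^sup>2)) \<partial>lborel)"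
      by (simp add: G_def K_def gauss_integrable[OF s] gauss_second_moment_integrable[OF s])
    also have "\<dots> \<le> (\<integral>x. gauss s (t *\<^sub>R a + x) + gauss s (- (t *\<^sub>R a) + x) \<partial>lborel)"
    proof (rule integral_mono)
      fix x :: 'a
      define y where "y = 2 * s * t * (a \<bullet> x)"
      have cosh: "2 + y\<^sup>2 \<le> exp y + exp (- y)"
      proof -
        have "1 + z + z\<^sup>2 / 2 + z ^ 3 / 6 \<le> exp z" for z :: real
        proof -
          obtain t where "exp z = (\<Sum>m<4. z ^ m / fact m) + exp t / fact 4 * z ^ 4"
            using Maclaurin_exp_le[of z 4] by auto
          moreover have "(\<Sum>m<4. z ^ m / fact m) = 1 + z + z\<^sup>2 / 2 + z ^ 3 / 6"
            by (simp add: numeral_eq_Suc)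
          moreover have "0 \<le> exp t / fact 4 * z ^ 4" by simp
          ultimately show ?thesis by linarith
        qed
        from this[of y] this[of "- y"] show ?thesis by simp
      qed
      have "exp (- u) * (2 * gauss s x + (2 * s * t)\<^sup>2 * (gauss s x * (a \<bullet> x)\<^sup>2))
        = exp (- u) * gauss s x * (2 + y\<^sup>2)" by (simp add: y_def algebra_simps power2_eq_square)
      also have "\<dots> \<le> exp (- u) * gauss s x * (exp y + exp (- y))"
        using gauss_pos[of s x] by (intro mult_left_mono cosh) auto
      also have "\<dots> = gauss s (t *\<^sub>R a + x) + gauss s (- (t *\<^sub>R a) + x)"
      proof -
        have s1: "gauss s (t *\<^sub>R a + x) = gauss s x * exp (- y) * exp (- u)"
          unfolding shift using t(1) by (simp add: y_def power_mult_distrib mult.assoc)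
        have s2: "gauss s (- (t *\<^sub>R a) + x) = gauss s x * exp y * exp (- u)"
          unfolding shift using t(1) by (simp add: y_def power_mult_distrib mult.assoc)
        show ?thesis unfolding s1 s2 by (simp add: algebra_simps)
      qed
      finally show "exp (- u) * (2 * gauss s x + (2 * s * t)\<^sup>2 * (gauss s x * (a \<bullet> x)\<^sup>2))
        \<le> gauss s (t *\<^sub>R a + x) + gauss s (- (t *\<^sub>R a) + x)" .
    next
      show "integrable lborel (\<lambda>x. gauss s (t *\<^sub>R a + x) + gauss s (- (t *\<^sub>R a) + x))"
        by (rule Bochner_Integration.integrable_add[OF int int])
    qed (auto intro!: gauss_integrable gauss_second_moment_integrable s)
    also have "\<dots> = 2 * G"
      unfolding G_def by (subst Bochner_Integration.integral_add[OF int int]) 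
         (use integral_translate[OF gauss_measurable[of s], where t = "t *\<^sub>R a"]
           integral_translate[OF gauss_measurable[of s], where t = "- (t *\<^sub>R a)"] in simp)
    finally have "exp (- u) * (2 * G + (2 * s * t)\<^sup>2 * K) \<le> 2 * G" .
    then have "2 * G + (2 * s * t)\<^sup>2 * K \<le> exp u * (2 * G)"
      by (simp add: exp_minus field_simps)
    then have "(2 * s * t)\<^sup>2 * K \<le> (exp u - 1) * (2 * G)"
      by (simp only: left_diff_distrib)
    also have "\<dots> \<le> (u * exp u) * (2 * G)"
    proof (rule mult_right_mono)
      show "exp u - 1 \<le> u * exp u"
        using exp_ge_add_one_self[of "-u"] by (simp add: exp_minus field_simps)
    qed (use G in simp)
    finally have "(2 * s * t)\<^sup>2 * K * (norm a)\<^sup>2 \<le> (u * exp u) * (2 * G) * (norm a)\<^sup>2"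
      by (rule mult_right_mono) simp
    also have "(2 * s * t)\<^sup>2 * K * (norm a)\<^sup>2 = 4 * s * K * (s * t\<^sup>2 * (norm a)\<^sup>2)"
      by (simp add: power2_eq_square)
    finally have "u * (4 * s * K) \<le> u * (exp u * (2 * G) * (norm a)\<^sup>2)"
      unfolding t by (simp only: ac_simps)
    then have "4 * s * K \<le> exp u * (2 * G) * (norm a)\<^sup>2" using u by simp
    then show ?thesis using s by (simp add: field_simps)
  qed
  have "((\<lambda>u. exp u * ((norm a)\<^sup>2 / (2 * s) * G)) \<longlongrightarrow> exp 0 * ((norm a)\<^sup>2 / (2 * s) * G)) (at_right 0)"
    by (intro tendsto_intros)
  moreover have "eventually (\<lambda>u. K \<le> exp u * ((norm a)\<^sup>2 / (2 * s) * G)) (at_right 0)"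
  proof (rule eventually_at_rightI[of 0 1])
    fix u :: real assume "u \<in> {0<..<1}"
    then show "K \<le> exp u * ((norm a)\<^sup>2 / (2 * s) * G)" by (intro bound) simp
  qed simp
  ultimately have "K \<le> exp 0 * ((norm a)\<^sup>2 / (2 * s) * G)"
    by (rule tendsto_lowerbound) simp
  then show ?thesis by (simp add: K_def G_def)
qed simp

section \<open>Small translations decrease the integral\<close>

lemma perp_measurable [measurable]: "perp \<omega> \<in> borel_measurable borel" for \<omega> :: "'a::euclidean_space"
  unfolding perp_def[abs_def] by measurable

lemma (in weights) integral_avg:
  fixes f :: "'i \<Rightarrow> 'b \<Rightarrow> real"
  assumes "\<And>i. i \<in> I \<Longrightarrow> integrable M (f i)"
  shows "integrable M (\<lambda>x. avg I w (\<lambda>i. f i x))"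
    and "(\<integral>x. avg I w (\<lambda>i. f i x) \<partial>M) = avg I w (\<lambda>i. \<integral>x. f i x \<partial>M)"
  using assms by (auto simp: avg_def)

context near_axis_tubes
begin

lemma wt_measurable [measurable]: "(\<lambda>z. wt j z i) \<in> borel_measurable borel"
  unfolding wt_def by measurable

lemma base_measurable [measurable]: "base \<in> borel_measurable borel"
  unfolding base_def[abs_def] by measurable

lemma wt_minus: "wt j (- z) = wt j z"
  by (simp add: wt_def fun_eq_iff perp_minus)

lemma base_minus: "base (- z) = base z"
  by (simp add: base_def wt_minus)

text \<open>A common translation of all tubes does not change the integral of their product; it is chosen such
  that the first order term of the expansion vanishes for the weights at the origin. It solves a
  linear system whose matrix, the sum of the averaged projections, is close to \<open>d - 1\<close> times the
  identity.\<close>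

lemma centring_translation:
  assumes card: "2 \<le> d" and \<eta>_small: "4 * d * \<eta> \<le> 1"
    and v: "\<And>j i. i \<in> I j \<Longrightarrow> norm (v j i) \<le> \<epsilon>"
  obtains x where "norm x \<le> 2 * d * \<epsilon>"
    and "(\<Sum>j\<in>UNIV. (1 / sum (c j) (I j)) *\<^sub>R (\<Sum>i\<in>I j. c j i *\<^sub>R perp (\<omega> j i) (v j i - x))) = 0"
proof -
  define L where "L u = (\<Sum>j\<in>UNIV. (1 / sum (c j) (I j)) *\<^sub>R (\<Sum>i\<in>I j. c j i *\<^sub>R perp (\<omega> j i) (u j i)))"
    for u :: "'n \<Rightarrow> 'i \<Rightarrow> real^'n"
  have L_inner: "L u \<bullet> y = (\<Sum>j\<in>UNIV. avg (I j) (c j) (\<lambda>i. perp (\<omega> j i) (u j i) \<bullet> y))" for u y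
    by (simp add: L_def inner_sum_left avg_def)
  have lin: "linear (\<lambda>x. L (\<lambda>_ _. x))"
    unfolding L_def
    by (rule linearI) (simp add: perp_add scaleR_add_right sum.distrib,
      simp add: perp_scaleR scaleR_sum_right ac_simps)
  have coercive: "(norm x)\<^sup>2 / 2 \<le> L (\<lambda>_ _. x) \<bullet> x" for x
  proof -
    have "(norm x)\<^sup>2 / 2 \<le> (d - 1) * (norm x)\<^sup>2 - (2 * d * \<eta>) * (norm x)\<^sup>2"
    proof -
      have "(1 / 2) * (norm x)\<^sup>2 \<le> ((d - 1) - 2 * d * \<eta>) * (norm x)\<^sup>2"
        using card \<eta>_small by (intro mult_right_mono) auto
      then show ?thesis by (simp only: left_diff_distrib)
    qed
    also have "\<dots> = (\<Sum>j\<in>UNIV. ((norm x)\<^sup>2 - (x $ j)\<^sup>2) - 2 * \<eta> * (norm x)\<^sup>2)"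
      by (subst sum_subtractf) (simp add: sum_coordinates d_def)
    also have "\<dots> \<le> (\<Sum>j\<in>UNIV. avg (I j) (c j) (\<lambda>i. perp (\<omega> j i) x \<bullet> x))"
    proof (intro sum_mono c.avg_ge_const)
      fix j i assume i: "i \<in> I j"
      have "2 * norm (\<omega> j i - axis j 1) * (norm x)\<^sup>2 \<le> 2 * \<eta> * (norm x)\<^sup>2"
        using near[OF i] by (intro mult_right_mono) auto
      then show "(norm x)\<^sup>2 - (x $ j)\<^sup>2 - 2 * \<eta> * (norm x)\<^sup>2 \<le> perp (\<omega> j i) x \<bullet> x"
        using norm_perp_sq_perturb[OF unit[OF i], of "axis j 1" x]
        unfolding perp_inner_perp[OF unit[OF i], symmetric] power2_norm_eq_inner[symmetric]
        by (simp add: inner_axis')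
    qed
    finally show ?thesis by (simp add: L_inner)
  qed
  have "inj (\<lambda>x. L (\<lambda>_ _. x))"
  proof (subst linear_injective_0[OF lin], intro allI impI)
    fix x assume "L (\<lambda>_ _. x) = 0"
    with coercive[of x] show "x = 0" by simp
  qed
  then have "surj (\<lambda>x. L (\<lambda>_ _. x))" by (rule linear_inj_imp_surj[OF lin])
  from surjD[OF this, of "L v"] obtain x where x: "L (\<lambda>_ _. x) = L v" by (auto simp: eq_commute)
  have "(norm x)\<^sup>2 / 2 \<le> L v \<bullet> x" using coercive[of x] x by simp
  also have "\<dots> \<le> (\<Sum>(j::'n)\<in>UNIV. \<epsilon> * norm x)"
    unfolding L_inner
  proof (intro sum_mono c.avg_le_const)
    fix j i assume i: "i \<in> I j"
    have "perp (\<omega> j i) (v j i) \<bullet> x \<le> norm (perp (\<omega> j i) (v j i)) * norm x" by (rule norm_cauchy_schwarz)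
    also have "\<dots> \<le> \<epsilon> * norm x"
      using norm_perp_le[OF unit[OF i], of "v j i"] v[OF i] by (intro mult_right_mono) auto
    finally show "perp (\<omega> j i) (v j i) \<bullet> x \<le> \<epsilon> * norm x" .
  qed
  also have "\<dots> = d * \<epsilon> * norm x" by (simp add: d_def)
  finally have "norm x * norm x \<le> (2 * d * \<epsilon>) * norm x" by (simp add: power2_eq_square)
  moreover have "0 \<le> \<epsilon>"
  proof -
    obtain i where "i \<in> I undefined" using c.nonempty by blast
    with v[of i undefined] norm_ge_zero show ?thesis by (meson order_trans)
  qed
  ultimately have "norm x \<le> 2 * d * \<epsilon>"
    using card by (cases "x = 0") (auto simp: mult_le_cancel_right)
  moreover have "L (\<lambda>j i. v j i - x) = L v - L (\<lambda>_ _. x)"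
    unfolding L_def by (simp add: perp_diff scaleR_diff_right sum_subtractf)
  ultimately show thesis using x by (intro that[of x]) (auto simp: L_def)
qed

context
  assumes \<mu>: "0 < \<mu>" and \<eta>_small: "(p * d + 4) * \<eta> \<le> \<mu> / 8"
begin

lemma base_le_gauss: "base z \<le> mass * gauss (3 * \<mu> / 8) z"
proof -
  have "p * d * \<eta> * (norm z)\<^sup>2 \<le> \<mu> / 8 * (norm z)\<^sup>2"
    using \<eta>_small \<eta>_nonneg by (intro mult_right_mono) (auto simp: distrib_right)
  then have "exp (- \<mu> * (norm z)\<^sup>2 / 2) * exp (p * d * \<eta> * (norm z)\<^sup>2) \<le> gauss (3 * \<mu> / 8) z"
    unfolding exp_add[symmetric] gauss_def by simp
  then have "mass * (exp (- \<mu> * (norm z)\<^sup>2 / 2) * exp (p * d * \<eta> * (norm z)\<^sup>2)) \<le> mass * gauss (3 * \<mu> / 8) z"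
    using mass_pos by (intro mult_left_mono) auto
  with base_upper[of z] show ?thesis by (simp add: mult.assoc)
qed

lemma base_integrable: "integrable lborel base"
proof (rule Bochner_Integration.integrable_bound)
  show "integrable lborel (\<lambda>z. mass * gauss (3 * \<mu> / 8) z)"
    using \<mu> by (intro integrable_mult_right gauss_integrable) simp
  show "AE z in lborel. norm (base z) \<le> norm (mass * gauss (3 * \<mu> / 8) z)"
  proof (rule AE_I2)
    fix z
    show "norm (base z) \<le> norm (mass * gauss (3 * \<mu> / 8) z)"
      using base_le_gauss[of z] base_pos[of z] mass_pos gauss_pos[of "3 * \<mu> / 8" z]
      by (simp add: abs_mult)
  qed
qed simp

context
  fixes a :: "'n \<Rightarrow> 'i \<Rightarrow> real^'n" and \<epsilon> :: real
  assumes small: "\<And>j i. i \<in> I j \<Longrightarrow> norm (a j i) \<le> \<epsilon>" and eps: "\<epsilon> \<le> 1"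
    and orth: "\<And>j i. i \<in> I j \<Longrightarrow> perp (\<omega> j i) (a j i) = a j i"
    and centred: "(\<Sum>j\<in>UNIV. (1 / sum (c j) (I j)) *\<^sub>R (\<Sum>i\<in>I j. c j i *\<^sub>R a j i)) = 0"
begin

lemma drift_measurable [measurable]: "drift a \<in> borel_measurable borel"
  unfolding drift_def[abs_def] avg_def by measurable

lemma abs_drift_le: "\<bar>drift a z\<bar> \<le> d * norm z"
proof -
  let ?a = "\<lambda>j. avg (I j) (wt j z) (\<lambda>i. a j i \<bullet> z)"
  have "\<bar>?a j\<bar> \<le> norm z" for j
  proof (rule order_trans[OF wt.abs_avg_le wt.avg_le_const])
    fix i assume i: "i \<in> I j"
    have "\<bar>a j i \<bullet> z\<bar> \<le> norm (a j i) * norm z" by (rule Cauchy_Schwarz_ineq2)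
    also have "\<dots> \<le> 1 * norm z" using small[OF i] eps by (intro mult_right_mono) auto
    finally show "\<bar>a j i \<bullet> z\<bar> \<le> norm z" by simp
  qed
  then have "(\<Sum>j\<in>UNIV. \<bar>?a j\<bar>) \<le> of_nat CARD('n) * norm z"
    by (intro sum_bounded_above)
  then show ?thesis
    unfolding drift_def d_def by (rule order_trans[OF sum_abs])
qed

lemma base_drift_integrable: "integrable lborel (\<lambda>z. base z * drift a z)"
proof (rule Bochner_Integration.integrable_bound)
  show "integrable lborel (\<lambda>z::real^'n. (mass * d * (1 + 8 / \<mu>)) * gauss (\<mu> / 4) z)"
    using \<mu> by (intro integrable_mult_right gauss_integrable) simp
  show "AE z in lborel. norm (base z * drift a z) \<le> norm ((mass * d * (1 + 8 / \<mu>)) * gauss (\<mu> / 4) z)"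
  proof (rule AE_I2)
    fix z :: "real^'n"
    define E where "E = exp (\<mu> / 8 * (norm z)\<^sup>2)"
    have "0 \<le> \<mu> / 8 * (norm z)\<^sup>2" using \<mu> by simp
    then have "\<mu> / 8 * (norm z)\<^sup>2 \<le> E" "1 \<le> E"
      using exp_ge_add_one_self[of "\<mu> / 8 * (norm z)\<^sup>2"] unfolding E_def by linarith+
    then have n2: "(norm z)\<^sup>2 \<le> 8 / \<mu> * E" "1 \<le> E" using \<mu> by (simp_all add: field_simps)
    have "norm z \<le> 1 + (norm z)\<^sup>2"
    proof -
      have "0 \<le> (norm z - 1)\<^sup>2" by simp
      also have "\<dots> = (norm z)\<^sup>2 - 2 * norm z + 1" by (simp add: power2_eq_square algebra_simps)
      finally show ?thesis using norm_ge_zero[of z] by linarith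
    qed
    also have "\<dots> \<le> (1 + 8 / \<mu>) * E" using n2 by (simp add: distrib_right)
    finally have "d * norm z \<le> d * ((1 + 8 / \<mu>) * E)" by (intro mult_left_mono) (auto simp: d_def)
    with abs_drift_le[of z] have dr: "\<bar>drift a z\<bar> \<le> d * ((1 + 8 / \<mu>) * E)" by linarith
    have "\<bar>base z * drift a z\<bar> = base z * \<bar>drift a z\<bar>" using base_pos[of z] by (simp add: abs_mult)
    also have "\<dots> \<le> (mass * gauss (3 * \<mu> / 8) z) * (d * ((1 + 8 / \<mu>) * E))"
      using base_le_gauss[of z] base_pos[of z] mass_pos gauss_pos[of "3 * \<mu> / 8" z]
      by (intro mult_mono dr) auto
    also have "\<dots> = mass * d * (1 + 8 / \<mu>) * (gauss (3 * \<mu> / 8) z * E)" by (simp only: ac_simps)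
    also have "gauss (3 * \<mu> / 8) z * E = gauss (\<mu> / 4) z"
      by (simp add: gauss_def E_def exp_add[symmetric])
    finally show "norm (base z * drift a z) \<le> norm ((mass * d * (1 + 8 / \<mu>)) * gauss (\<mu> / 4) z)"
      by simp
  qed
qed simp

lemma base_drift_integral: "(\<integral>z. base z * drift a z \<partial>lborel) = 0"
proof (rule integral_odd_zero)
  fix z
  have "drift a (- z) = - drift a z"
    unfolding drift_def wt_minus
    by (simp add: avg_def sum_negf)
  then show "base (- z) * drift a (- z) = - (base z * drift a z)" by (simp add: base_minus)
qed simp

text \<open>The exponential \<open>exp (k * norm z)\<close> is absorbed by completing the square.\<close>

lemma error_le_gauss:
  fixes z :: "real^'n"
  defines "k \<equiv> p * d + 10"
  shows "exp (- \<mu> * (norm z)\<^sup>2 / 2) * exp ((p * d + 4) * \<eta> * (norm z)\<^sup>2) * exp (k * (norm z + 1))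
     \<le> exp (k + k\<^sup>2 / \<mu>) * gauss (\<mu> / 8) z"
proof -
  define n where "n = norm z"
  have e: "(p * d + 4) * \<eta> * n\<^sup>2 \<le> \<mu> / 8 * n\<^sup>2" by (intro mult_right_mono \<eta>_small) simp
  have "0 \<le> (\<mu> * n / 2 - k)\<^sup>2 / \<mu>" using \<mu> by simp
  also have "\<dots> = \<mu> * n\<^sup>2 / 4 - k * n + k\<^sup>2 / \<mu>"
    using \<mu> by (simp add: power2_eq_square field_simps)
  finally have kn: "k * n \<le> \<mu> * n\<^sup>2 / 4 + k\<^sup>2 / \<mu>" by simp
  have "- \<mu> * n\<^sup>2 / 2 + (p * d + 4) * \<eta> * n\<^sup>2 + (k * n + k) \<le> (k + k\<^sup>2 / \<mu>) + - (\<mu> / 8 * n\<^sup>2)"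
    using e kn by linarith
  then show ?thesis
    unfolding exp_add[symmetric] gauss_def n_def[symmetric] distrib_left mult_1_right exp_le_cancel_iff .
qed

text \<open>Integration of the pointwise expansion. The drift is odd and disappears. By the second moment bound
  the quadratic terms contribute at most \<open>p / 2 * mass * (1 / \<mu> - 1) * G * spread a\<close>, which is
  negative for \<open>\<mu> > 1\<close>, and the assumption says that the errors do not exceed its absolute value.\<close>

lemma shifted_integral_le:
  fixes G J :: real
  defines "G \<equiv> integral\<^sup>L lborel (gauss (\<mu> / 2) :: real^'n \<Rightarrow> real)"
    and "J \<equiv> integral\<^sup>L lborel (gauss (\<mu> / 8) :: real^'n \<Rightarrow> real)"
    and "k \<equiv> p * d + 10"
  assumes H: "(\<epsilon> + \<eta>) * loss p d * (exp (k + k\<^sup>2 / \<mu>) * J)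
     \<le> p / 2 * (1 - 1 / \<mu>) * G"
  shows "(\<integral>\<^sup>+z. ennreal (shifted a z) \<partial>lborel) \<le> (\<integral>\<^sup>+z. ennreal (base z) \<partial>lborel)"
proof -
  define Q where "Q z = (\<Sum>j\<in>UNIV. gauss (\<mu> / 2) z * avg (I j) (c j) (\<lambda>i. (a j i \<bullet> z)\<^sup>2 - (norm (a j i))\<^sup>2))"
    for z :: "real^'n"
  define C where "C = mass * ((\<epsilon> + \<eta>) * loss p d * exp (k + k\<^sup>2 / \<mu>) * spread a)"
  define R where "R z = base z + p * (base z * drift a z) + p / 2 * mass * Q z + C * gauss (\<mu> / 8) z" for z
  have d0: "0 \<le> d" by (simp add: d_def)
  have ev: "0 \<le> \<epsilon>" using eps_nonneg[OF small eps orth centred] .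
  have sp: "0 \<le> spread a" using spread_nonneg .
  have le: "shifted a z \<le> R z" for z
  proof -
    have \<Lambda>: "exp (- \<mu> * (norm z)\<^sup>2 / 2) = gauss (\<mu> / 2) z" by (simp add: gauss_def)
    have "mass * ((\<epsilon> + \<eta>) * loss p d * (exp (- \<mu> * (norm z)\<^sup>2 / 2) * exp ((p * d + 4) * \<eta> * (norm z)\<^sup>2) * exp ((p * d + 10) * (norm z + 1))) * spread a)
      \<le> mass * ((\<epsilon> + \<eta>) * loss p d * (exp (k + k\<^sup>2 / \<mu>) * gauss (\<mu> / 8) z) * spread a)"
      unfolding k_def
    proof (intro mult_left_mono mult_right_mono)
      show "exp (- \<mu> * (norm z)\<^sup>2 / 2) * exp ((p * d + 4) * \<eta> * (norm z)\<^sup>2) * exp ((p * d + 10) * (norm z + 1))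
        \<le> exp (p * d + 10 + (p * d + 10)\<^sup>2 / \<mu>) * gauss (\<mu> / 8) z"
        by (rule error_le_gauss)
    qed (use mass_pos ev \<eta>_nonneg loss_nonneg[OF p d0] sp in auto)
    also have "\<dots> = C * gauss (\<mu> / 8) z" by (simp only: C_def ac_simps)
    finally show ?thesis
      using shifted_le[OF small eps orth centred, of z] unfolding R_def Q_def \<Lambda> by linarith
  qed
  have shifted0: "0 \<le> shifted a z" for z
    unfolding shifted_def by (intro prod_nonneg) simp
  have term_int: "integrable lborel (\<lambda>z. gauss (\<mu> / 2) z * ((b \<bullet> z)\<^sup>2 - (norm b)\<^sup>2))"
    and term_le: "(\<integral>z. gauss (\<mu> / 2) z * ((b \<bullet> z)\<^sup>2 - (norm b)\<^sup>2) \<partial>lborel) \<le> (1 / \<mu> - 1) * G * (norm b)\<^sup>2"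
    for b :: "real^'n"
  proof -
    let ?f = "\<lambda>z. gauss (\<mu> / 2) z * ((b \<bullet> z)\<^sup>2 - (norm b)\<^sup>2)"
    have i1: "integrable lborel (\<lambda>z. gauss (\<mu> / 2) z * (b \<bullet> z)\<^sup>2)"
      using \<mu> by (intro gauss_second_moment_integrable) simp
    have i2: "integrable lborel (\<lambda>z::real^'n. gauss (\<mu> / 2) z * (norm b)\<^sup>2)"
      using \<mu> by (intro integrable_mult_left gauss_integrable) simp
    show "integrable lborel ?f"
      unfolding right_diff_distrib by (rule Bochner_Integration.integrable_diff[OF i1 i2])
    have "integral\<^sup>L lborel ?f
      = (\<integral>z. gauss (\<mu> / 2) z * (b \<bullet> z)\<^sup>2 \<partial>lborel) - G * (norm b)\<^sup>2"
      unfolding right_diff_distrib Bochner_Integration.integral_diff[OF i1 i2] by (simp add: G_def)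
    also have "\<dots> \<le> (norm b)\<^sup>2 / (2 * (\<mu> / 2)) * G - G * (norm b)\<^sup>2"
      unfolding G_def using \<mu> by (intro diff_right_mono gauss_second_moment) simp
    finally show "integral\<^sup>L lborel ?f \<le> (1 / \<mu> - 1) * G * (norm b)\<^sup>2"
      by (simp add: algebra_simps)
  qed
  have Q_eq: "Q z = (\<Sum>j\<in>UNIV. avg (I j) (c j) (\<lambda>i. gauss (\<mu> / 2) z * ((a j i \<bullet> z)\<^sup>2 - (norm (a j i))\<^sup>2)))" for z
    by (simp add: Q_def c.avg_cmult)
  have Q_int: "integrable lborel Q"
    unfolding Q_eq[abs_def] by (intro Bochner_Integration.integrable_sum c.integral_avg(1) term_int)
  have "integral\<^sup>L lborel Q = (\<Sum>j\<in>UNIV. avg (I j) (c j) (\<lambda>i. \<integral>z. gauss (\<mu> / 2) z * ((a j i \<bullet> z)\<^sup>2 - (norm (a j i))\<^sup>2) \<partial>lborel))"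
    unfolding Q_eq[abs_def]
    by (subst Bochner_Integration.integral_sum; intro sum.cong refl c.integral_avg term_int)
  also have "\<dots> \<le> (\<Sum>j\<in>UNIV. avg (I j) (c j) (\<lambda>i. (1 / \<mu> - 1) * G * (norm (a j i))\<^sup>2))"
    by (intro sum_mono c.avg_mono term_le)
  also have "\<dots> = (1 / \<mu> - 1) * G * spread a"
    unfolding c.avg_cmult spread_def by (simp add: sum_distrib_left)
  finally have Q_le: "integral\<^sup>L lborel Q \<le> (1 / \<mu> - 1) * G * spread a" .
  have g8: "integrable lborel (gauss (\<mu> / 8) :: real^'n \<Rightarrow> real)" using \<mu> by (intro gauss_integrable) simp
  have R_int: "integrable lborel R"
    unfolding R_def[abs_def]
    by (intro Bochner_Integration.integrable_add integrable_mult_right base_integrable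
      base_drift_integrable Q_int g8)
  have "integral\<^sup>L lborel R = integral\<^sup>L lborel base + p / 2 * mass * integral\<^sup>L lborel Q
      + C * J"
    unfolding R_def[abs_def] using base_integrable base_drift_integrable Q_int g8 base_drift_integral
    by (simp add: J_def)
  also have "\<dots> \<le> integral\<^sup>L lborel base + p / 2 * mass * ((1 / \<mu> - 1) * G * spread a)
      + (mass * spread a) * (p / 2 * (1 - 1 / \<mu>) * G)"
  proof (intro add_mono order_refl mult_left_mono Q_le)
    have "(mass * spread a) * ((\<epsilon> + \<eta>) * loss p d * (exp (k + k\<^sup>2 / \<mu>) * J))
      \<le> (mass * spread a) * (p / 2 * (1 - 1 / \<mu>) * G)"
      using mass_pos sp by (intro mult_left_mono H) auto
    then show "C * J \<le> (mass * spread a) * (p / 2 * (1 - 1 / \<mu>) * G)"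
      by (simp add: C_def ac_simps)
  qed (use p mass_pos in auto)
  also have "\<dots> = integral\<^sup>L lborel base" using \<mu> by (simp add: field_simps)
  finally have R_le: "integral\<^sup>L lborel R \<le> integral\<^sup>L lborel base" .
  have "(\<integral>\<^sup>+z. ennreal (shifted a z) \<partial>lborel) \<le> (\<integral>\<^sup>+z. ennreal (R z) \<partial>lborel)"
    by (intro nn_integral_mono ennreal_leI le)
  also have "\<dots> = ennreal (integral\<^sup>L lborel R)"
    by (intro nn_integral_eq_integral R_int AE_I2 order_trans[OF shifted0 le])
  also have "\<dots> \<le> ennreal (integral\<^sup>L lborel base)" by (rule ennreal_leI[OF R_le])
  also have "\<dots> = (\<integral>\<^sup>+z. ennreal (base z) \<partial>lborel)"
    by (intro nn_integral_eq_integral[symmetric] base_integrable AE_I2 less_imp_le base_pos)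
  finally show ?thesis .
qed

end

end

end

definition tube_prod :: "('n::finite \<Rightarrow> 'i set) \<Rightarrow> ('n \<Rightarrow> 'i \<Rightarrow> real) \<Rightarrow> ('n \<Rightarrow> 'i \<Rightarrow> real^'n) \<Rightarrow> real
    \<Rightarrow> ('n \<Rightarrow> 'i \<Rightarrow> real^'n) \<Rightarrow> real^'n \<Rightarrow> real" where
  "tube_prod I c \<omega> p v z
     = (\<Prod>j\<in>UNIV. (\<Sum>i\<in>I j. c j i * exp (- (norm (perp (\<omega> j i) (z - v j i)))\<^sup>2 / 2)) powr p)"

lemma tube_prod_nonneg: "0 \<le> tube_prod I c \<omega> p v z"
  unfolding tube_prod_def by (intro prod_nonneg) simp

lemma tube_prod_measurable [measurable]: "tube_prod I c \<omega> p v \<in> borel_measurable borel"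
  unfolding tube_prod_def[abs_def] by measurable

lemma (in near_axis_tubes) base_eq_tube_prod: "base = tube_prod I c \<omega> p (\<lambda>_ _. 0)"
  by (simp add: fun_eq_iff base_def tube_prod_def wt_def)

text \<open>Tubes through the origin are compared with their translates by small vectors. The weights \<open>c\<close> are
  quantified inside: they will vary over the values of Gaussians, and \<open>\<epsilon>\<close> must not depend on them.\<close>

definition translation_estimate :: "real \<Rightarrow> real \<Rightarrow> real \<Rightarrow> ('n::finite \<Rightarrow> 'i set) \<Rightarrow> bool" where
  "translation_estimate p \<eta> \<epsilon> I \<longleftrightarrow>
    (\<forall>c \<omega> v. near_axis_tubes I c \<omega> p \<eta> \<longrightarrow> (\<forall>j. \<forall>i\<in>I j. norm (v j i) \<le> \<epsilon>) \<longrightarrow>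
      (\<integral>\<^sup>+z. ennreal (tube_prod I c \<omega> p v z) \<partial>lborel)
        \<le> (\<integral>\<^sup>+z. ennreal (tube_prod I c \<omega> p (\<lambda>_ _. 0) z) \<partial>lborel))"

text \<open>Both \<open>\<epsilon>\<close> and \<open>\<eta>\<close> are chosen so small that the errors in \<open>shifted_integral_le\<close> are dominated by its
  negative main term.\<close>

lemma small_translation_decreases:
  assumes card: "2 \<le> CARD('n::finite)" and p: "0 < p" "1 < p * (real CARD('n) - 1)"
  obtains \<eta> \<epsilon> where "0 < \<eta>" "\<eta> \<le> 1" "0 < \<epsilon>" "(p * real CARD('n) + 4) * \<eta> \<le> p * (real CARD('n) - 1) / 8"
    and "\<And>I :: 'n \<Rightarrow> 'i set. translation_estimate p \<eta> \<epsilon> I"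
proof -
  define d where "d = real CARD('n)"
  define \<mu> where "\<mu> = p * (d - 1)"
  \<comment> \<open>The interpretation below brings facts with the names of these definitions.\<close>
  note D_def = d_def and \<nu>_def = \<mu>_def
  define k where "k = p * d + 10"
  define G where "G = integral\<^sup>L lborel (gauss (\<mu> / 2) :: real^'n \<Rightarrow> real)"
  define L where "L = loss p d * (exp (k + k\<^sup>2 / \<mu>) * integral\<^sup>L lborel (gauss (\<mu> / 8) :: real^'n \<Rightarrow> real))"
  define T where "T = p / 2 * (1 - 1 / \<mu>) * G"
  have d: "2 \<le> d" using card by (simp add: d_def)
  have \<mu>: "1 < \<mu>" using p by (simp add: \<mu>_def d_def)
  have "0 < G" unfolding G_def using \<mu> by (intro gauss_integral_pos) simp
  then have T: "0 < T" using p \<mu> by (simp add: T_def)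
  have L: "0 \<le> L" unfolding L_def using loss_nonneg[OF p(1), of d] d \<mu>
    by (intro mult_nonneg_nonneg Bochner_Integration.integral_nonneg) (auto intro: less_imp_le gauss_pos)
  define t where "t = T / (2 * (L + 1))"
  have t: "0 < t" "2 * t * L \<le> T"
  proof -
    show "0 < t" using T L by (simp add: t_def)
    have "2 * t * L = T * (L / (L + 1))" using L by (simp add: t_def field_simps)
    also have "\<dots> \<le> T * 1" using T L by (intro mult_left_mono) auto
    finally show "2 * t * L \<le> T" by simp
  qed
  define \<epsilon>1 where "\<epsilon>1 = min 1 t"
  define \<epsilon> where "\<epsilon> = \<epsilon>1 / (1 + 2 * d)"
  define \<eta> where "\<eta> = min (min 1 (1 / (4 * d))) (min t (\<mu> / (8 * (p * d + 4))))"
  have pd: "0 < p * d + 4" using p d by (simp add: add_pos_pos)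
  have \<eta>: "0 < \<eta>" "\<eta> \<le> 1" "\<eta> \<le> t"
    using t(1) d \<mu> pd unfolding \<eta>_def by (simp_all add: min.coboundedI1 min.coboundedI2)
  have "\<eta> \<le> 1 / (4 * d)" "\<eta> \<le> \<mu> / (8 * (p * d + 4))" by (auto simp: \<eta>_def)
  then have \<eta>2: "4 * d * \<eta> \<le> 1" "(p * d + 4) * \<eta> \<le> \<mu> / 8"
    using d pd by (simp_all add: field_simps)
  have \<epsilon>1: "0 < \<epsilon>1" "\<epsilon>1 \<le> 1" "\<epsilon>1 \<le> t" using t by (auto simp: \<epsilon>1_def)
  have "\<epsilon> * (1 + 2 * d) = \<epsilon>1" using d by (simp add: \<epsilon>_def)
  moreover have "0 < \<epsilon>" using \<epsilon>1 d by (simp add: \<epsilon>_def)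
  ultimately have \<epsilon>: "0 < \<epsilon>" "\<epsilon> + 2 * d * \<epsilon> = \<epsilon>1" by (simp_all add: algebra_simps)
  have H: "(\<epsilon>1 + \<eta>) * loss p d * (exp (k + k\<^sup>2 / \<mu>) * integral\<^sup>L lborel (gauss (\<mu> / 8) :: real^'n \<Rightarrow> real)) \<le> p / 2 * (1 - 1 / \<mu>) * G"
  proof -
    have "(\<epsilon>1 + \<eta>) * L \<le> (2 * t) * L" using L \<eta> \<epsilon>1 by (intro mult_right_mono) auto
    with t(2) show ?thesis by (simp add: L_def T_def mult.assoc)
  qed
  have est: "translation_estimate p \<eta> \<epsilon> I" for I :: "'n \<Rightarrow> 'i set"
    unfolding translation_estimate_def
  proof (intro allI impI)
    fix c \<omega> and v :: "'n \<Rightarrow> 'i \<Rightarrow> real^'n"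
    assume tubes: "near_axis_tubes I c \<omega> p \<eta>" and "\<forall>j. \<forall>i\<in>I j. norm (v j i) \<le> \<epsilon>"
    then have v: "norm (v j i) \<le> \<epsilon>" if "i \<in> I j" for j i using that by blast
    interpret near_axis_tubes I c \<omega> p \<eta> "real CARD('n)" "p * (real CARD('n) - 1)"
      by (fact tubes) simp_all
    obtain x where x: "norm x \<le> 2 * d * \<epsilon>"
      and centred: "(\<Sum>j\<in>UNIV. (1 / sum (c j) (I j)) *\<^sub>R (\<Sum>i\<in>I j. c j i *\<^sub>R perp (\<omega> j i) (v j i - x))) = 0"
    proof (rule centring_translation[of v \<epsilon>])
      show "2 \<le> real CARD('n)" "4 * real CARD('n) * \<eta> \<le> 1" using d \<eta>2(1) by (simp_all add: D_def)
      show "norm (v j i) \<le> \<epsilon>" if "i \<in> I j" for j i using that by (rule v)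
    next
      fix y
      assume "norm y \<le> 2 * real CARD('n) * \<epsilon>"
        and "(\<Sum>j\<in>UNIV. (1 / sum (c j) (I j)) *\<^sub>R (\<Sum>i\<in>I j. c j i *\<^sub>R perp (\<omega> j i) (v j i - y))) = 0"
      then show thesis by (intro that[of y]) (simp_all only: D_def)
    qed
    define a where "a j i = perp (\<omega> j i) (v j i - x)" for j i
    have a: "norm (a j i) \<le> \<epsilon>1" if "i \<in> I j" for j i
    proof -
      have "norm (a j i) \<le> norm (v j i - x)" unfolding a_def by (rule norm_perp_le[OF unit[OF that]])
      also have "\<dots> \<le> \<epsilon> + 2 * d * \<epsilon>" using v[OF that] x norm_triangle_ineq4[of "v j i" x] by linarith
      finally show ?thesis using \<epsilon>(2) by simp
    qed
    have orth: "perp (\<omega> j i) (a j i) = a j i" if "i \<in> I j" for j i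
      unfolding a_def by (rule perp_idem[OF unit[OF that]])
    have "(\<integral>\<^sup>+z. ennreal (tube_prod I c \<omega> p v z) \<partial>lborel) = (\<integral>\<^sup>+z. ennreal (tube_prod I c \<omega> p v (x + z)) \<partial>lborel)"
      by (rule nn_integral_translate[symmetric]) simp
    also have "\<dots> = (\<integral>\<^sup>+z. ennreal (shifted a z) \<partial>lborel)"
    proof (rule nn_integral_cong)
      fix z
      have "perp (\<omega> j i) (x + z - v j i) = perp (\<omega> j i) z - a j i" for j i
        by (simp add: a_def perp_diff perp_add)
      then show "ennreal (tube_prod I c \<omega> p v (x + z)) = ennreal (shifted a z)"
        by (simp add: tube_prod_def shifted_def)
    qed
    also have "\<dots> \<le> (\<integral>\<^sup>+z. ennreal (base z) \<partial>lborel)"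
      using \<mu> \<eta>2(2) a \<epsilon>1(2) orth centred H
      by (intro shifted_integral_le[where \<epsilon> = \<epsilon>1]) (auto simp: \<nu>_def D_def a_def k_def G_def)
    finally show "(\<integral>\<^sup>+z. ennreal (tube_prod I c \<omega> p v z) \<partial>lborel)
        \<le> (\<integral>\<^sup>+z. ennreal (tube_prod I c \<omega> p (\<lambda>_ _. 0) z) \<partial>lborel)"
      by (simp add: base_eq_tube_prod)
  qed
  have "(p * real CARD('n) + 4) * \<eta> \<le> p * (real CARD('n) - 1) / 8"
    using \<eta>2(2) by (simp add: \<mu>_def d_def)
  then show thesis by (rule that[OF \<eta>(1,2) \<epsilon>(1) _ est])
qed

section \<open>Monotonicity under contraction to the origin\<close>

lemma nn_integral_shear:
  fixes f :: "'a::euclidean_space \<Rightarrow> 'a \<Rightarrow> ennreal"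
  assumes [measurable]: "case_prod f \<in> borel_measurable (borel \<Otimes>\<^sub>M borel)"
  shows "(\<integral>\<^sup>+x. \<integral>\<^sup>+z. f (x + r *\<^sub>R z) z \<partial>lborel \<partial>lborel) = (\<integral>\<^sup>+x. \<integral>\<^sup>+z. f x z \<partial>lborel \<partial>lborel)"
    and "(\<integral>\<^sup>+x. \<integral>\<^sup>+z. f x (z + r *\<^sub>R x) \<partial>lborel \<partial>lborel) = (\<integral>\<^sup>+x. \<integral>\<^sup>+z. f x z \<partial>lborel \<partial>lborel)"
proof -
  have "(\<integral>\<^sup>+x. \<integral>\<^sup>+z. f (x + r *\<^sub>R z) z \<partial>lborel \<partial>lborel) = (\<integral>\<^sup>+z. \<integral>\<^sup>+x. f (x + r *\<^sub>R z) z \<partial>lborel \<partial>lborel)"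
    using lborel_pair.Fubini'[of "\<lambda>x z. f (x + r *\<^sub>R z) z"] by simp
  also have "\<dots> = (\<integral>\<^sup>+z. \<integral>\<^sup>+x. f x z \<partial>lborel \<partial>lborel)"
  proof (rule nn_integral_cong)
    fix z :: 'a
    have "(\<integral>\<^sup>+x. f (r *\<^sub>R z + x) z \<partial>lborel) = (\<integral>\<^sup>+x. f x z \<partial>lborel)"
      by (rule nn_integral_translate) measurable
    then show "(\<integral>\<^sup>+x. f (x + r *\<^sub>R z) z \<partial>lborel) = (\<integral>\<^sup>+x. f x z \<partial>lborel)" by (simp add: add.commute)
  qed
  also have "\<dots> = (\<integral>\<^sup>+x. \<integral>\<^sup>+z. f x z \<partial>lborel \<partial>lborel)"
    using lborel_pair.Fubini'[of f] by simp
  finally show "(\<integral>\<^sup>+x. \<integral>\<^sup>+z. f (x + r *\<^sub>R z) z \<partial>lborel \<partial>lborel) = (\<integral>\<^sup>+x. \<integral>\<^sup>+z. f x z \<partial>lborel \<partial>lborel)" .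
  show "(\<integral>\<^sup>+x. \<integral>\<^sup>+z. f x (z + r *\<^sub>R x) \<partial>lborel \<partial>lborel) = (\<integral>\<^sup>+x. \<integral>\<^sup>+z. f x z \<partial>lborel \<partial>lborel)"
  proof (rule nn_integral_cong)
    fix x :: 'a
    have "(\<integral>\<^sup>+z. f x (r *\<^sub>R x + z) \<partial>lborel) = (\<integral>\<^sup>+z. f x z \<partial>lborel)"
      by (rule nn_integral_translate) measurable
    then show "(\<integral>\<^sup>+z. f x (z + r *\<^sub>R x) \<partial>lborel) = (\<integral>\<^sup>+z. f x z \<partial>lborel)" by (simp add: add.commute)
  qed
qed

text \<open>A rotation is a composition of three shears, and a shear is a translation in one of the two variables.\<close>

lemma nn_integral_rotate:
  fixes f :: "'a::euclidean_space \<Rightarrow> 'a \<Rightarrow> ennreal" and C S :: real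
  assumes [measurable]: "case_prod f \<in> borel_measurable (borel \<Otimes>\<^sub>M borel)"
    and CS: "C\<^sup>2 + S\<^sup>2 = 1" "0 \<le> C"
  shows "(\<integral>\<^sup>+x. \<integral>\<^sup>+z. f (C *\<^sub>R x - S *\<^sub>R z) (S *\<^sub>R x + C *\<^sub>R z) \<partial>lborel \<partial>lborel)
    = (\<integral>\<^sup>+x. \<integral>\<^sup>+z. f x z \<partial>lborel \<partial>lborel)"
proof -
  define r where "r = - S / (1 + C)"
  have rC: "r * (1 + C) = - S" using CS(2) by (simp add: r_def)
  then have r2: "r + r * C = - S" by (simp add: distrib_left)
  have "(1 + S * r) * (1 + C) = (1 + C) + S * (r * (1 + C))" by (simp add: algebra_simps)
  also have "\<dots> = 1 + C - S\<^sup>2" unfolding rC by (simp add: power2_eq_square)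
  also have "\<dots> = C * (1 + C)" using CS(1) by (simp add: power2_eq_square algebra_simps)
  finally have r1: "1 + S * r = C" using CS(2) by simp
  define f1 where "f1 x z = f (x + r *\<^sub>R z) z" for x z
  define f2 where "f2 x z = f1 x (z + S *\<^sub>R x)" for x z
  have [measurable]: "case_prod f1 \<in> borel_measurable (borel \<Otimes>\<^sub>M borel)" unfolding f1_def by measurable
  have [measurable]: "case_prod f2 \<in> borel_measurable (borel \<Otimes>\<^sub>M borel)" unfolding f2_def by measurable
  have "f (C *\<^sub>R x - S *\<^sub>R z) (S *\<^sub>R x + C *\<^sub>R z) = f2 (x + r *\<^sub>R z) z" for x z
  proof -
    have z: "z + S *\<^sub>R (x + r *\<^sub>R z) = S *\<^sub>R x + (1 + S * r) *\<^sub>R z" by (simp add: algebra_simps)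
    have "(x + r *\<^sub>R z) + r *\<^sub>R (S *\<^sub>R x + C *\<^sub>R z) = (1 + S * r) *\<^sub>R x + (r + r * C) *\<^sub>R z"
      by (simp add: algebra_simps)
    with z show ?thesis by (simp add: f2_def f1_def r1 r2)
  qed
  then have "(\<integral>\<^sup>+x. \<integral>\<^sup>+z. f (C *\<^sub>R x - S *\<^sub>R z) (S *\<^sub>R x + C *\<^sub>R z) \<partial>lborel \<partial>lborel)
    = (\<integral>\<^sup>+x. \<integral>\<^sup>+z. f2 (x + r *\<^sub>R z) z \<partial>lborel \<partial>lborel)" by simp
  also have "\<dots> = (\<integral>\<^sup>+x. \<integral>\<^sup>+z. f2 x z \<partial>lborel \<partial>lborel)" by (rule nn_integral_shear) measurable
  also have "\<dots> = (\<integral>\<^sup>+x. \<integral>\<^sup>+z. f1 x z \<partial>lborel \<partial>lborel)" unfolding f2_def by (rule nn_integral_shear) measurable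
  also have "\<dots> = (\<integral>\<^sup>+x. \<integral>\<^sup>+z. f x z \<partial>lborel \<partial>lborel)" unfolding f1_def by (rule nn_integral_shear) measurable
  finally show ?thesis .
qed

text \<open>To each tube a second copy is added in an independent variable \<open>z\<close>. The tubes are translated by
  \<open>t *\<^sub>R v j i\<close> in the variable \<open>x\<close> and by \<open>s *\<^sub>R v j i\<close> in the variable \<open>z\<close>. For fixed \<open>x\<close>, the values of the
  Gaussians in \<open>x\<close> are weights for the Gaussians in \<open>z\<close>.\<close>

definition doubled_prod :: "('n::finite \<Rightarrow> 'i set) \<Rightarrow> ('n \<Rightarrow> 'i \<Rightarrow> real) \<Rightarrow> ('n \<Rightarrow> 'i \<Rightarrow> real^'n) \<Rightarrow> real
    \<Rightarrow> ('n \<Rightarrow> 'i \<Rightarrow> real^'n) \<Rightarrow> real \<Rightarrow> real \<Rightarrow> real^'n \<Rightarrow> real^'n \<Rightarrow> real" where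
  "doubled_prod I c \<omega> p v t s x z = tube_prod I
     (\<lambda>j i. c j i * exp (- (norm (perp (\<omega> j i) (x - t *\<^sub>R v j i)))\<^sup>2 / 2)) \<omega> p (\<lambda>j i. s *\<^sub>R v j i) z"

definition doubled_integral :: "('n::finite \<Rightarrow> 'i set) \<Rightarrow> ('n \<Rightarrow> 'i \<Rightarrow> real) \<Rightarrow> ('n \<Rightarrow> 'i \<Rightarrow> real^'n) \<Rightarrow> real
    \<Rightarrow> ('n \<Rightarrow> 'i \<Rightarrow> real^'n) \<Rightarrow> real \<Rightarrow> real \<Rightarrow> ennreal" where
  "doubled_integral I c \<omega> p v t s = (\<integral>\<^sup>+x. \<integral>\<^sup>+z. ennreal (doubled_prod I c \<omega> p v t s x z) \<partial>lborel \<partial>lborel)"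

lemma doubled_prod_measurable [measurable]:
  "case_prod (doubled_prod I c \<omega> p v t s) \<in> borel_measurable (borel \<Otimes>\<^sub>M borel)"
  unfolding doubled_prod_def[abs_def] tube_prod_def by measurable

text \<open>The form \<open>(norm (perp \<omega> x))\<^sup>2 + (norm (perp \<omega> z))\<^sup>2\<close> is invariant under rotations that mix \<open>x\<close> and \<open>z\<close>, and
  such rotations act on the pair \<open>(t, s)\<close> as well.\<close>

lemma doubled_integral_rotate:
  fixes \<omega> :: "'n::finite \<Rightarrow> 'i \<Rightarrow> real^'n"
  assumes unit: "\<And>j i. i \<in> I j \<Longrightarrow> norm (\<omega> j i) = 1" and t: "0 \<le> t" and r: "0 < t\<^sup>2 + s\<^sup>2"
  shows "doubled_integral I c \<omega> p v t s = doubled_integral I c \<omega> p v (sqrt (t\<^sup>2 + s\<^sup>2)) 0"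
proof -
  define R where "R = sqrt (t\<^sup>2 + s\<^sup>2)"
  have R: "0 < R" "R\<^sup>2 = t\<^sup>2 + s\<^sup>2" using r by (auto simp: R_def)
  define C S where "C = t / R" and "S = s / R"
  have "C\<^sup>2 + S\<^sup>2 = (t\<^sup>2 + s\<^sup>2) / R\<^sup>2" by (simp add: C_def S_def power_divide add_divide_distrib)
  also have "\<dots> = 1" unfolding R(2)[symmetric] using R(1) by simp
  finally have CS: "C\<^sup>2 + S\<^sup>2 = 1" "0 \<le> C" using R(1) t by (simp_all add: C_def)
  have ts: "t = C * R" "s = S * R" using R by (simp_all add: C_def S_def)
  have "doubled_prod I c \<omega> p v t s (C *\<^sub>R x - S *\<^sub>R z) (S *\<^sub>R x + C *\<^sub>R z) = doubled_prod I c \<omega> p v R 0 x z" for x z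
    unfolding doubled_prod_def tube_prod_def
  proof (intro prod.cong refl arg_cong[where f = "\<lambda>y. y powr p"] sum.cong)
    fix j i assume i: "i \<in> I j"
    define x' z' where "x' = perp (\<omega> j i) (x - R *\<^sub>R v j i)" and "z' = perp (\<omega> j i) z"
    have "perp (\<omega> j i) (C *\<^sub>R x - S *\<^sub>R z - t *\<^sub>R v j i) = C *\<^sub>R x' - S *\<^sub>R z'"
      unfolding ts by (simp add: x'_def z'_def perp_diff perp_scaleR scaleR_diff_right)
    moreover have "perp (\<omega> j i) (S *\<^sub>R x + C *\<^sub>R z - s *\<^sub>R v j i) = S *\<^sub>R x' + C *\<^sub>R z'"
      unfolding ts by (simp add: x'_def z'_def perp_diff perp_add perp_scaleR scaleR_diff_right)
    moreover have "(norm (C *\<^sub>R x' - S *\<^sub>R z'))\<^sup>2 + (norm (S *\<^sub>R x' + C *\<^sub>R z'))\<^sup>2 = (C\<^sup>2 + S\<^sup>2) * ((norm x')\<^sup>2 + (norm z')\<^sup>2)"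
      by (simp only: power2_norm_eq_inner inner_add_left inner_add_right inner_diff_left inner_diff_right
        inner_scaleR_left inner_scaleR_right inner_commute[of z' x']) (simp add: power2_eq_square algebra_simps)
    ultimately have "(norm (perp (\<omega> j i) (C *\<^sub>R x - S *\<^sub>R z - t *\<^sub>R v j i)))\<^sup>2
        + (norm (perp (\<omega> j i) (S *\<^sub>R x + C *\<^sub>R z - s *\<^sub>R v j i)))\<^sup>2 = (norm x')\<^sup>2 + (norm z')\<^sup>2"
      using CS by simp
    then have e: "- (norm (perp (\<omega> j i) (C *\<^sub>R x - S *\<^sub>R z - t *\<^sub>R v j i)))\<^sup>2 / 2
        + - (norm (perp (\<omega> j i) (S *\<^sub>R x + C *\<^sub>R z - s *\<^sub>R v j i)))\<^sup>2 / 2 = - (norm x')\<^sup>2 / 2 + - (norm z')\<^sup>2 / 2"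
      by simp
    show "c j i * exp (- (norm (perp (\<omega> j i) (C *\<^sub>R x - S *\<^sub>R z - t *\<^sub>R v j i)))\<^sup>2 / 2)
        * exp (- (norm (perp (\<omega> j i) (S *\<^sub>R x + C *\<^sub>R z - s *\<^sub>R v j i)))\<^sup>2 / 2)
      = c j i * exp (- (norm (perp (\<omega> j i) (x - R *\<^sub>R v j i)))\<^sup>2 / 2) * exp (- (norm (perp (\<omega> j i) (z - 0 *\<^sub>R v j i)))\<^sup>2 / 2)"
      unfolding mult.assoc exp_add[symmetric] e by (simp add: x'_def z'_def)
  qed
  then show ?thesis
    unfolding doubled_integral_def R_def[symmetric]
    using nn_integral_rotate[of "\<lambda>x z. ennreal (doubled_prod I c \<omega> p v t s x z)" C S] CS by simp
qed

lemma (in near_axis_tubes) reweighted: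
  "near_axis_tubes I (\<lambda>j i. c j i * exp (- (norm (perp (\<omega> j i) (x j i)))\<^sup>2 / 2)) \<omega> p \<eta>"
proof unfold_locales
  fix j show "finite (I j)" "I j \<noteq> {}" by (fact c.fin c.nonempty)+
  fix i assume "i \<in> I j"
  then show "0 < c j i * exp (- (norm (perp (\<omega> j i) (x j i)))\<^sup>2 / 2)" using c.pos by simp
qed (use p unit near \<eta> in auto)

text \<open>Passing from \<open>(t, 0)\<close> to \<open>(t, s)\<close> with \<open>s\<close> small is, for each \<open>x\<close>, a small translation in \<open>z\<close> and does
  not increase the integral. By rotation invariance this replaces \<open>t\<close> by \<open>sqrt (t\<^sup>2 + s\<^sup>2)\<close>. With
  \<open>s\<^sup>2 = 1 / N\<close>, finitely many steps lead from \<open>t = 0\<close> to \<open>t = 1\<close>: no step depends on the size of the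
  previous translations.\<close>

lemma doubled_integral_decreasing:
  fixes I :: "'n::finite \<Rightarrow> 'i set" and v :: "'n \<Rightarrow> 'i \<Rightarrow> real^'n"
  assumes tubes: "near_axis_tubes I c \<omega> p \<eta>" and "0 < \<epsilon>"
    and local: "translation_estimate p \<eta> \<epsilon> I"
  shows "doubled_integral I c \<omega> p v 1 0 \<le> doubled_integral I c \<omega> p v 0 0"
proof -
  interpret near_axis_tubes I c \<omega> p \<eta> "real CARD('n)" "p * (real CARD('n) - 1)"
    by (fact tubes) simp_all
  have "finite (\<Union>j. (\<lambda>i. norm (v j i)) ` I j)" using c.fin by simp
  then have M: "norm (v j i) \<le> Max (\<Union>j. (\<lambda>i. norm (v j i)) ` I j)" (is "_ \<le> ?M") if "i \<in> I j" for j i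
    using that by (intro Max_ge) auto
  define M where "M = ?M"
  note M = M[folded M_def]
  obtain N :: nat where N: "(M / \<epsilon>)\<^sup>2 < N" using reals_Archimedean2 by blast
  then have N0: "0 < real N" by (meson le_less_trans zero_le_power2)
  define s where "s = 1 / sqrt N"
  have s: "0 < s" "s\<^sup>2 = 1 / N" using N0 by (simp_all add: s_def power_divide)
  have small: "norm (s *\<^sub>R v j i) \<le> \<epsilon>" if "i \<in> I j" for j i
  proof -
    have "M / \<epsilon> \<le> sqrt N" using N by (intro real_le_rsqrt) simp
    then have "M \<le> \<epsilon> * sqrt N" using \<open>0 < \<epsilon>\<close> by (simp add: field_simps)
    then have "s * M \<le> \<epsilon>" using N0 by (simp add: s_def field_simps)
    moreover have "s * norm (v j i) \<le> s * M" using M[OF that] s by (intro mult_left_mono) auto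
    moreover have "norm (s *\<^sub>R v j i) = s * norm (v j i)" using s(1) by simp
    ultimately show ?thesis by linarith
  qed
  have step: "doubled_integral I c \<omega> p v t s \<le> doubled_integral I c \<omega> p v t 0" for t
    unfolding doubled_integral_def
  proof (rule nn_integral_mono)
    fix x
    show "(\<integral>\<^sup>+z. ennreal (doubled_prod I c \<omega> p v t s x z) \<partial>lborel) \<le> (\<integral>\<^sup>+z. ennreal (doubled_prod I c \<omega> p v t 0 x z) \<partial>lborel)"
      unfolding doubled_prod_def
      using local[unfolded translation_estimate_def, rule_format,
        OF reweighted[of "\<lambda>j i. x - t *\<^sub>R v j i"], of "\<lambda>j i. s *\<^sub>R v j i"] small by simp
  qed
  have "doubled_integral I c \<omega> p v (sqrt (real k / N)) 0 \<le> doubled_integral I c \<omega> p v 0 0" for k :: nat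
  proof (induction k)
    case (Suc k)
    have "(sqrt (real k / N))\<^sup>2 + s\<^sup>2 = real (Suc k) / N" using N0 by (simp add: s field_simps)
    then have "doubled_integral I c \<omega> p v (sqrt (real (Suc k) / N)) 0 = doubled_integral I c \<omega> p v (sqrt (real k / N)) s"
      using doubled_integral_rotate[where I = I and \<omega> = \<omega> and t = "sqrt (real k / N)" and s = s and c = c and p = p and v = v] unit N0 by simp
    also have "\<dots> \<le> doubled_integral I c \<omega> p v (sqrt (real k / N)) 0" by (rule step)
    finally show ?case using Suc by simp
  qed simp
  from this[of N] show ?thesis using N0 by simp
qed

text \<open>The multilinear Kakeya estimate for Gaussian tubes with directions within \<open>\<eta>\<close> of the basis vectors.\<close>

definition gaussian_estimate :: "real \<Rightarrow> real \<Rightarrow> real \<Rightarrow> ('n::finite \<Rightarrow> 'i set) \<Rightarrow> bool" where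
  "gaussian_estimate p \<eta> C I \<longleftrightarrow> (\<forall>c \<omega> v. (\<forall>j. finite (I j)) \<longrightarrow>
    (\<forall>j. \<forall>i\<in>I j. 0 < c j i \<and> norm (\<omega> j i) = 1 \<and> norm (\<omega> j i - axis j 1) \<le> \<eta>) \<longrightarrow>
    (\<integral>\<^sup>+z. ennreal (tube_prod I c \<omega> p v z) \<partial>lborel) \<le> ennreal (C * (\<Prod>j\<in>UNIV. sum (c j) (I j) powr p)))"

text \<open>At \<open>t = 0\<close> all tubes pass through the origin. Their product is at most the product of the total weights
  times a Gaussian, since a point far from the origin is far from one of \<open>d\<close> transversal lines. At
  \<open>t = 1\<close> the tubes are where they should be, and the second copies, which pass through the
  origin, only contribute a constant factor because \<open>norm (perp \<omega> z) \<le> norm z\<close>.\<close>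

theorem gaussian_multilinear_kakeya:
  assumes card: "2 \<le> CARD('n::finite)" and p: "0 < p" "1 < p * (real CARD('n) - 1)"
  obtains \<eta> C where "0 < \<eta>" "0 \<le> C" and "\<And>I :: 'n \<Rightarrow> 'i set. gaussian_estimate p \<eta> C I"
proof -
  define \<mu>0 where "\<mu>0 = p * (real CARD('n) - 1)"
  have \<mu>0: "0 < \<mu>0" using p by (simp add: \<mu>0_def)
  obtain \<eta> \<epsilon> where \<eta>: "0 < \<eta>" "\<eta> \<le> 1" and \<epsilon>: "0 < \<epsilon>"
    and \<eta>_small: "(p * real CARD('n) + 4) * \<eta> \<le> \<mu>0 / 8"
    and local: "\<And>I :: 'n \<Rightarrow> 'i set. translation_estimate p \<eta> \<epsilon> I"
    unfolding \<mu>0_def by (rule small_translation_decreases[OF card p]) blast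
  define G where "G = integral\<^sup>L lborel (gauss (3 * \<mu>0 / 8) :: real^'n \<Rightarrow> real)"
  define H where "H = integral\<^sup>L lborel (gauss (p * real CARD('n) / 2) :: real^'n \<Rightarrow> real)"
  have H: "0 < H" unfolding H_def using p card by (intro gauss_integral_pos) simp
  have gauss_G: "(\<integral>\<^sup>+z. ennreal (gauss (3 * \<mu>0 / 8) (z::real^'n)) \<partial>lborel) = ennreal G"
    unfolding G_def using \<mu>0 by (intro nn_integral_eq_integral gauss_integrable) (auto intro: less_imp_le gauss_pos)
  have gauss_H: "(\<integral>\<^sup>+z. ennreal (gauss (p * real CARD('n) / 2) (z::real^'n)) \<partial>lborel) = ennreal H"
    unfolding H_def using p card by (intro nn_integral_eq_integral gauss_integrable) (auto intro: less_imp_le gauss_pos)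
  have est: "gaussian_estimate p \<eta> (G\<^sup>2 / H) I" for I :: "'n \<Rightarrow> 'i set"
    unfolding gaussian_estimate_def
  proof (intro allI impI)
    fix c :: "'n \<Rightarrow> 'i \<Rightarrow> real" and \<omega> v :: "'n \<Rightarrow> 'i \<Rightarrow> real^'n"
    assume "\<forall>j. finite (I j)"
      and tubes: "\<forall>j. \<forall>i\<in>I j. 0 < c j i \<and> norm (\<omega> j i) = 1 \<and> norm (\<omega> j i - axis j 1) \<le> \<eta>"
    then have fin: "finite (I j)" for j by blast
    have c0: "0 < c j i" and unit: "norm (\<omega> j i) = 1" and near: "norm (\<omega> j i - axis j 1) \<le> \<eta>"
      if "i \<in> I j" for j i using tubes that by blast+
    show "(\<integral>\<^sup>+z. ennreal (tube_prod I c \<omega> p v z) \<partial>lborel) \<le> ennreal (G\<^sup>2 / H * (\<Prod>j\<in>UNIV. sum (c j) (I j) powr p))"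
    proof (cases "\<exists>j. I j = {}")
      case True
      then obtain k where "I k = {}" by blast
      then have "tube_prod I c \<omega> p v z = 0" for z
        unfolding tube_prod_def by (intro prod_zero) (auto intro!: exI[of _ k])
      then show ?thesis by simp
    next
      case False
      have tubes: "near_axis_tubes I c \<omega> p \<eta>"
        using False fin c0 unit near p \<eta> by unfold_locales auto
      interpret near_axis_tubes I c \<omega> p \<eta> "real CARD('n)" "p * (real CARD('n) - 1)"
        by (fact tubes) simp_all
      let ?g = "gauss (3 * \<mu>0 / 8) :: real^'n \<Rightarrow> real"
      let ?h = "gauss (p * real CARD('n) / 2) :: real^'n \<Rightarrow> real"
      have upper: "doubled_prod I c \<omega> p v 0 0 x z \<le> (mass * ?g x) * ?g z" for x z
      proof -
        let ?c = "\<lambda>j i. c j i * exp (- (norm (perp (\<omega> j i) x))\<^sup>2 / 2)"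
        interpret R: near_axis_tubes I ?c \<omega> p \<eta> "real CARD('n)" "p * (real CARD('n) - 1)"
          by (fact reweighted[of "\<lambda>_ _. x"]) simp_all
        have "doubled_prod I c \<omega> p v 0 0 x z = R.base z"
          unfolding doubled_prod_def R.base_eq_tube_prod by simp
        also have "\<dots> \<le> R.mass * ?g z"
          using R.base_le_gauss[of z] \<mu>0 \<eta>_small by (simp add: \<mu>0_def)
        also have "R.mass = base x"
          unfolding R.mass_def base_def wt_def by simp
        also have "base x * ?g z \<le> (mass * ?g x) * ?g z"
          using base_le_gauss[of x] \<mu>0 \<eta>_small gauss_pos[of "3 * \<mu>0 / 8" z]
          by (intro mult_right_mono) (auto simp: \<mu>0_def)
        finally show ?thesis .
      qed
      have lower: "tube_prod I c \<omega> p v x * ?h z \<le> doubled_prod I c \<omega> p v 1 0 x z" for x z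
      proof -
        let ?s = "\<lambda>j. \<Sum>i\<in>I j. c j i * exp (- (norm (perp (\<omega> j i) (x - v j i)))\<^sup>2 / 2)"
        let ?e = "exp (- (norm z)\<^sup>2 / 2)"
        let ?X = "\<lambda>j i. exp (- (norm (perp (\<omega> j i) (x - 1 *\<^sub>R v j i)))\<^sup>2 / 2)"
        let ?Z = "\<lambda>j i. exp (- (norm (perp (\<omega> j i) (z - 0 *\<^sub>R v j i)))\<^sup>2 / 2)"
        have "?h z = exp (- (norm z)\<^sup>2 / 2 * p) ^ CARD('n)"
          by (simp add: gauss_def exp_of_nat_mult[symmetric] algebra_simps)
        also have "\<dots> = (\<Prod>(j::'n)\<in>UNIV. ?e powr p)"
          by (simp add: powr_def mult.commute)
        finally have "tube_prod I c \<omega> p v x * ?h z = (\<Prod>j\<in>UNIV. ?s j powr p * ?e powr p)"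
          by (simp add: tube_prod_def prod.distrib)
        also have "\<dots> \<le> (\<Prod>j\<in>UNIV. (\<Sum>i\<in>I j. c j i * ?X j i * ?Z j i) powr p)"
        proof (intro prod_mono conjI)
          fix j
          have s0: "0 \<le> ?s j" using c0 by (intro sum_nonneg) (auto intro: less_imp_le)
          have "?s j * ?e \<le> (\<Sum>i\<in>I j. c j i * ?X j i * ?Z j i)"
            unfolding sum_distrib_right
          proof (rule sum_mono)
            fix i assume i: "i \<in> I j"
            have "(norm (perp (\<omega> j i) z))\<^sup>2 \<le> (norm z)\<^sup>2"
              by (intro power_mono norm_perp_le unit i) simp
            then show "c j i * exp (- (norm (perp (\<omega> j i) (x - v j i)))\<^sup>2 / 2) * ?e
              \<le> c j i * ?X j i * ?Z j i"
              using c0[OF i] by (intro mult_mono) auto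
          qed
          then show "?s j powr p * ?e powr p \<le> (\<Sum>i\<in>I j. c j i * ?X j i * ?Z j i) powr p"
            using s0 p by (subst powr_mult[symmetric]) (auto intro!: powr_mono2)
        qed simp
        finally show ?thesis by (simp add: doubled_prod_def tube_prod_def)
      qed
      let ?T = "\<integral>\<^sup>+x. ennreal (tube_prod I c \<omega> p v x) \<partial>lborel"
      have "?T * ennreal H = (\<integral>\<^sup>+x. ennreal (tube_prod I c \<omega> p v x) * ennreal H \<partial>lborel)"
        by (rule nn_integral_multc[symmetric]) simp
      also have "\<dots> = (\<integral>\<^sup>+x. \<integral>\<^sup>+z. ennreal (tube_prod I c \<omega> p v x) * ennreal (?h z) \<partial>lborel \<partial>lborel)"
        by (intro nn_integral_cong) (simp add: nn_integral_cmult gauss_H)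
      also have "\<dots> \<le> doubled_integral I c \<omega> p v 1 0"
        unfolding doubled_integral_def
        by (intro nn_integral_mono)
           (auto simp: ennreal_mult[symmetric] tube_prod_nonneg less_imp_le[OF gauss_pos] intro!: ennreal_leI lower)
      also have "\<dots> \<le> doubled_integral I c \<omega> p v 0 0"
        using tubes \<epsilon> local by (rule doubled_integral_decreasing)
      also have "\<dots> \<le> (\<integral>\<^sup>+x. \<integral>\<^sup>+z. ennreal (mass * ?g x) * ennreal (?g z) \<partial>lborel \<partial>lborel)"
        unfolding doubled_integral_def using mass_pos
        by (intro nn_integral_mono)
           (auto simp: ennreal_mult[symmetric] less_imp_le[OF gauss_pos] intro!: ennreal_leI upper)
      also have "\<dots> = (\<integral>\<^sup>+x. ennreal mass * ennreal (?g x) * ennreal G \<partial>lborel)"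
        using mass_pos by (intro nn_integral_cong) (simp add: nn_integral_cmult gauss_G ennreal_mult less_imp_le[OF gauss_pos])
      also have "\<dots> = ennreal mass * ennreal G * ennreal G"
        by (simp add: nn_integral_multc nn_integral_cmult gauss_G mult.assoc)
      also have "\<dots> = ennreal (mass * G\<^sup>2)"
        using mass_pos unfolding G_def
        by (simp add: ennreal_mult[symmetric] power2_eq_square mult.assoc Bochner_Integration.integral_nonneg less_imp_le[OF gauss_pos])
      finally have "?T * ennreal H * ennreal (1 / H) \<le> ennreal (mass * G\<^sup>2) * ennreal (1 / H)"
        by (rule mult_right_mono) simp
      also have "?T * ennreal H * ennreal (1 / H) = ?T"
        using H by (simp add: mult.assoc ennreal_mult[symmetric])
      also have "ennreal (mass * G\<^sup>2) * ennreal (1 / H) = ennreal (G\<^sup>2 / H * mass)"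
        using H mass_pos by (subst ennreal_mult[symmetric]) (simp_all add: ac_simps)
      finally show ?thesis by (simp add: mass_def)
    qed
  qed
  show thesis by (rule that[OF \<eta>(1) _ est]) (use H in simp)
qed

section \<open>Passing to arbitrary frames of directions\<close>

text \<open>Integrating \<open>g (y + L x) * \<phi> y\<close> over both variables, for a Gaussian \<open>\<phi>\<close>, gives the integral of
  \<open>\<lambda>x. g (L x)\<close> times that of \<open>\<phi>\<close> if \<open>x\<close> is integrated first (and translated), and the integral of \<open>g\<close> times
  that of \<open>\<lambda>x. \<phi> (L x)\<close> if \<open>y\<close> is translated first.\<close>

lemma nn_integral_linear_le:
  fixes L :: "'a::euclidean_space \<Rightarrow> 'a"
  assumes L: "linear L" and K: "0 < K" "\<And>x. norm x \<le> K * norm (L x)"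
  obtains C where "0 \<le> C" and "\<And>g. g \<in> borel_measurable borel \<Longrightarrow>
    (\<integral>\<^sup>+x. g (L x) \<partial>lborel) \<le> ennreal C * (\<integral>\<^sup>+x. g x \<partial>lborel)"
proof -
  define \<phi> :: "'a \<Rightarrow> ennreal" where "\<phi> x = ennreal (gauss 1 x)" for x
  have [measurable]: "\<phi> \<in> borel_measurable borel" unfolding \<phi>_def[abs_def] by measurable
  have [measurable]: "L \<in> borel_measurable borel"
    using L by (intro borel_measurable_continuous_onI linear_continuous_on linear_conv_bounded_linear[THEN iffD1])
  have "inj L"
  proof (subst linear_injective_0[OF L], intro allI impI)
    fix x assume "L x = 0" with K(2)[of x] show "x = 0" by simp
  qed
  then have "surj L" by (rule linear_inj_imp_surj[OF L])
  define M where "M = inv L"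
  have LM: "L (M y) = y" for y unfolding M_def by (rule surj_f_inv_f[OF \<open>surj L\<close>])
  define F where "F = integral\<^sup>L lborel (gauss 1 :: 'a \<Rightarrow> real)"
  have F: "0 < F" "(\<integral>\<^sup>+x. \<phi> x \<partial>lborel) = ennreal F"
    unfolding F_def \<phi>_def by (auto intro!: gauss_integral_pos nn_integral_eq_integral gauss_integrable less_imp_le[OF gauss_pos])
  define s where "s = 1 / K\<^sup>2"
  have s: "0 < s" using K by (simp add: s_def)
  define B where "B = integral\<^sup>L lborel (gauss s :: 'a \<Rightarrow> real)"
  have B: "0 \<le> B" unfolding B_def by (intro less_imp_le gauss_integral_pos s)
  have \<phi>L: "(\<integral>\<^sup>+x. \<phi> (L x) \<partial>lborel) \<le> ennreal B"
  proof -
    have "(\<integral>\<^sup>+x. \<phi> (L x) \<partial>lborel) \<le> (\<integral>\<^sup>+x. ennreal (gauss s (x::'a)) \<partial>lborel)"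
    proof (rule nn_integral_mono)
      fix x :: 'a
      have "(norm x)\<^sup>2 \<le> (K * norm (L x))\<^sup>2" by (rule power_mono[OF K(2)]) simp
      then have "s * (norm x)\<^sup>2 \<le> (norm (L x))\<^sup>2" using K(1) by (simp add: s_def field_simps power_mult_distrib)
      then show "\<phi> (L x) \<le> ennreal (gauss s x)" by (simp add: \<phi>_def gauss_def)
    qed
    also have "\<dots> = ennreal B"
      unfolding B_def by (intro nn_integral_eq_integral gauss_integrable s) (auto intro: less_imp_le[OF gauss_pos])
    finally show ?thesis .
  qed
  show thesis
  proof (rule that[of "B / F"])
    fix g :: "'a \<Rightarrow> ennreal" assume [measurable]: "g \<in> borel_measurable borel"
    let ?A = "\<integral>\<^sup>+x. g (L x) \<partial>lborel" and ?B = "\<integral>\<^sup>+x. \<phi> (L x) \<partial>lborel" and ?G = "\<integral>\<^sup>+y. g y \<partial>lborel"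
    have "?A * ennreal F = (\<integral>\<^sup>+y. ?A * \<phi> y \<partial>lborel)"
      by (simp add: nn_integral_cmult F(2))
    also have "\<dots> = (\<integral>\<^sup>+y. \<integral>\<^sup>+x. g (y + L x) * \<phi> y \<partial>lborel \<partial>lborel)"
    proof (rule nn_integral_cong)
      fix y
      have "?A = (\<integral>\<^sup>+x. g (L (M y + x)) \<partial>lborel)"
        by (rule nn_integral_translate[symmetric]) measurable
      also have "\<dots> = (\<integral>\<^sup>+x. g (y + L x) \<partial>lborel)" by (simp add: linear_add[OF L] LM)
      finally show "?A * \<phi> y = (\<integral>\<^sup>+x. g (y + L x) * \<phi> y \<partial>lborel)"
        by (simp add: nn_integral_multc)
    qed
    also have "\<dots> = (\<integral>\<^sup>+x. \<integral>\<^sup>+y. g (y + L x) * \<phi> y \<partial>lborel \<partial>lborel)"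
      by (rule lborel_pair.Fubini') measurable
    also have "\<dots> = (\<integral>\<^sup>+x. \<integral>\<^sup>+y. g y * \<phi> (y - L x) \<partial>lborel \<partial>lborel)"
    proof (rule nn_integral_cong)
      fix x
      have "(\<integral>\<^sup>+y. g (L x + y) * \<phi> ((L x + y) - L x) \<partial>lborel) = (\<integral>\<^sup>+y. g y * \<phi> (y - L x) \<partial>lborel)"
        by (rule nn_integral_translate[where f = "\<lambda>y. g y * \<phi> (y - L x)"]) measurable
      then show "(\<integral>\<^sup>+y. g (y + L x) * \<phi> y \<partial>lborel) = (\<integral>\<^sup>+y. g y * \<phi> (y - L x) \<partial>lborel)"
        by (simp add: add.commute)
    qed
    also have "\<dots> = (\<integral>\<^sup>+y. \<integral>\<^sup>+x. g y * \<phi> (y - L x) \<partial>lborel \<partial>lborel)"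
      by (rule lborel_pair.Fubini'[symmetric]) measurable
    also have "\<dots> = (\<integral>\<^sup>+y. g y * ?B \<partial>lborel)"
    proof (rule nn_integral_cong)
      fix y
      have "(\<integral>\<^sup>+x. \<phi> (y - L x) \<partial>lborel) = (\<integral>\<^sup>+x. \<phi> (y - L (- x)) \<partial>lborel)"
        by (rule nn_integral_reflect[symmetric]) measurable
      also have "\<dots> = (\<integral>\<^sup>+x. \<phi> (L (M y + x)) \<partial>lborel)" by (simp add: linear_add[OF L] linear_neg[OF L] LM)
      also have "\<dots> = ?B"
        by (rule nn_integral_translate) measurable
      finally show "(\<integral>\<^sup>+x. g y * \<phi> (y - L x) \<partial>lborel) = g y * ?B"
        by (simp add: nn_integral_cmult)
    qed
    also have "\<dots> \<le> ?G * ennreal B"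
      by (simp add: nn_integral_multc mult_left_mono \<phi>L)
    finally have "?A * ennreal F * ennreal (1 / F) \<le> ?G * ennreal B * ennreal (1 / F)"
      by (rule mult_right_mono) simp
    also have "?A * ennreal F * ennreal (1 / F) = ?A"
      using F(1) by (simp add: mult.assoc ennreal_mult[symmetric])
    also have "?G * ennreal B * ennreal (1 / F) = ennreal (B / F) * (\<integral>\<^sup>+x. g x \<partial>lborel)"
      using F(1) B by (subst mult.assoc) (simp add: ennreal_mult[symmetric] mult.commute)
    finally show "(\<integral>\<^sup>+x. g (L x) \<partial>lborel) \<le> ennreal (B / F) * (\<integral>\<^sup>+x. g x \<partial>lborel)" .
  qed (use F B in simp)
qed

text \<open>The matrix with columns \<open>W j\<close> differs from the identity by an operator of norm at most \<open>1 / 2\<close>, so it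
  has an inverse with the stated bounds.\<close>

lemma frame_map:
  fixes W :: "'n::finite \<Rightarrow> real^'n"
  assumes W: "\<And>j. norm (W j - axis j 1) \<le> 1 / (2 * real CARD('n))"
  obtains L :: "real^'n \<Rightarrow> real^'n" where "linear L" "\<And>j. L (W j) = axis j 1"
    "\<And>x. norm (L x) \<le> 2 * norm x" "\<And>x. norm x \<le> 2 * norm (L x)"
proof -
  define F :: "real^'n \<Rightarrow> real^'n" where "F x = (\<Sum>j\<in>UNIV. x $ j *\<^sub>R W j)" for x
  have lin: "linear F"
    unfolding F_def by (rule linearI) (simp_all add: scaleR_add_left sum.distrib scaleR_sum_right)
  have close: "norm (F x - x) \<le> norm x / 2" for x
  proof -
    have "(\<Sum>j\<in>UNIV. x $ j *\<^sub>R axis j 1) = x"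
      using basis_expansion[of x] by (simp add: scalar_mult_eq_scaleR)
    then have "F x - x = (\<Sum>j\<in>UNIV. x $ j *\<^sub>R (W j - axis j 1))"
      unfolding scaleR_diff_right sum_subtractf F_def by simp
    also have "norm \<dots> \<le> (\<Sum>(j::'n)\<in>UNIV. norm x * (1 / (2 * real CARD('n))))"
    proof (rule sum_norm_le)
      fix j :: 'n
      show "norm (x $ j *\<^sub>R (W j - axis j 1)) \<le> norm x * (1 / (2 * real CARD('n)))"
        unfolding norm_scaleR by (intro mult_mono W) (auto simp: component_le_norm_cart)
    qed
    finally show ?thesis by simp
  qed
  have low: "norm x \<le> 2 * norm (F x)" and up: "norm (F x) \<le> 2 * norm x" for x
    using close[of x] norm_triangle_ineq2[of x "F x"] norm_triangle_ineq2[of "F x" x] norm_minus_commute[of x "F x"]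
      norm_ge_zero[of x] by linarith+
  have "inj F"
  proof (subst linear_injective_0[OF lin], intro allI impI)
    fix x assume "F x = 0" with low[of x] show "x = 0" by simp
  qed
  from linear_injective_isomorphism[OF lin this] obtain L
    where L: "linear L" "\<And>x. L (F x) = x" "\<And>x. F (L x) = x" by blast
  show thesis
  proof (rule that[OF L(1)])
    fix j
    have "F (axis j 1) = W j"
      by (simp add: F_def axis_def if_distrib[where f = "\<lambda>r. r *\<^sub>R _"] cong: if_cong)
    then show "L (W j) = axis j 1" using L(2)[of "axis j 1"] by simp
  next
    fix x show "norm (L x) \<le> 2 * norm x" "norm x \<le> 2 * norm (L x)"
      using low[of "L x"] up[of "L x"] by (simp_all add: L(3))
  qed
qed

lemma orthonormal_norm_sq:
  fixes w :: "'n::finite \<Rightarrow> real^'n"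
  assumes "\<And>i j. w i \<bullet> w j = (if i = j then 1 else 0)"
  shows "(norm y)\<^sup>2 = (\<Sum>i\<in>UNIV. (y \<bullet> w i)\<^sup>2)"
proof -
  define A :: "real^'n^'n" where "A = (\<chi> i. w i)"
  have row: "row i A = w i" for i by (simp add: A_def row_def vec_eq_iff)
  have "orthogonal_matrix A"
    unfolding orthogonal_matrix_orthonormal_rows row
    using assms by (auto simp: norm_eq_1 orthogonal_def)
  then have "orthogonal_transformation (\<lambda>y. A *v y)"
    by (simp add: orthogonal_transformation_matrix)
  then have "norm (A *v y) = norm y" by (rule orthogonal_transformation_norm)
  moreover have "(A *v y) $ i = y \<bullet> w i" for i
    by (simp add: A_def matrix_vector_mult_def inner_vec_def mult.commute)
  moreover have "(norm (A *v y))\<^sup>2 = (\<Sum>i\<in>UNIV. ((A *v y) $ i)\<^sup>2)"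
    by (simp add: norm_vec_def L2_set_def sum_nonneg)
  ultimately show ?thesis by simp
qed

lemma tube_transverse_le:
  fixes T :: "(real^'n::finite) set"
  assumes "delta_tube_along \<delta> \<omega> T" and \<delta>: "0 < \<delta>"
  obtains a where "norm \<omega> = 1" "\<And>x. x \<in> T \<Longrightarrow> norm (perp \<omega> (x - a)) \<le> \<delta> * real CARD('n)"
proof -
  from assms(1) obtain a k and w :: "'n \<Rightarrow> real^'n"
    where w': "\<forall>i j. w i \<bullet> w j = (if i = j then 1 else 0)" and k: "w k = \<omega>"
      and T: "T = {x. \<forall>i. \<bar>(x - a) \<bullet> w i\<bar> \<le> (if i = k then 1 else \<delta>) / 2}"
    unfolding delta_tube_along_def by blast
  note w = w'[rule_format]
  show thesis
  proof (rule that)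
    show u: "norm \<omega> = 1" using w[of k k] k by (simp add: norm_eq_1)
    fix x assume "x \<in> T"
    then have x: "\<bar>(x - a) \<bullet> w i\<bar> \<le> \<delta>" if "i \<noteq> k" for i
      using that \<delta> unfolding T by (auto dest!: spec[of _ i])
    have "(norm (perp \<omega> (x - a)))\<^sup>2 = (\<Sum>i\<in>UNIV. ((x - a) \<bullet> w i)\<^sup>2) - ((x - a) \<bullet> w k)\<^sup>2"
      using norm_perp_sq[OF u, of "x - a"] orthonormal_norm_sq[OF w, of "x - a"] by (simp add: k inner_commute)
    also have "\<dots> = (\<Sum>i\<in>UNIV - {k}. ((x - a) \<bullet> w i)\<^sup>2)"
      by (subst sum.remove[of UNIV k]) simp_all
    also have "\<dots> \<le> (\<Sum>i\<in>UNIV - {k}. \<delta>\<^sup>2)"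
      using x power_mono[of "\<bar>(x - a) \<bullet> w _\<bar>" \<delta> 2] by (intro sum_mono) simp
    also have "\<dots> \<le> (\<Sum>(i::'n)\<in>UNIV. \<delta>\<^sup>2)" by (intro sum_mono2) auto
    also have "\<dots> \<le> (\<delta> * real CARD('n))\<^sup>2"
    proof -
      have "1 \<le> real CARD('n)" using one_le_card_finite[where 'a = 'n] by simp
      then have "\<delta>\<^sup>2 * (1 * real CARD('n)) \<le> \<delta>\<^sup>2 * (real CARD('n) * real CARD('n))"
        by (intro mult_left_mono mult_right_mono) auto
      then show ?thesis by (simp add: power2_eq_square ac_simps)
    qed
    finally show "norm (perp \<omega> (x - a)) \<le> \<delta> * real CARD('n)"
      by (rule power2_le_imp_le) (use \<delta> in simp)
  qed
qed

text \<open>A linear map sends a tube into a tube with the image direction and comparable width, because only the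
  component transversal to \<open>\<omega>\<close> matters after projecting along \<open>L \<omega>\<close>. The tube is dominated by an
  infinite Gaussian tube around its axis.\<close>

lemma tube_indicator_le:
  fixes L :: "real^'n::finite \<Rightarrow> real^'n"
  assumes tube: "delta_tube_along \<delta> \<omega> T" and \<delta>: "0 < \<delta>"
    and L: "linear L" "\<And>x. norm (L x) \<le> 2 * norm x" "\<And>x. norm x \<le> 2 * norm (L x)"
    and near: "norm (L \<omega> - axis j 1) \<le> \<eta> / 2"
  obtains \<omega>' v where "norm \<omega>' = 1" "norm (\<omega>' - axis j 1) \<le> \<eta>"
    and "\<And>x. indicator T x \<le> exp (2 * (real CARD('n))\<^sup>2) * exp (- (norm (perp \<omega>' ((1 / \<delta>) *\<^sub>R L x - v)))\<^sup>2 / 2)"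
proof -
  obtain a where unit: "norm \<omega> = 1"
    and thin: "\<And>x. x \<in> T \<Longrightarrow> norm (perp \<omega> (x - a)) \<le> \<delta> * real CARD('n)"
    using tube_transverse_le[OF tube \<delta>] by blast
  define r where "r = norm (L \<omega>)"
  have r: "0 < r" using L(3)[of \<omega>] unit unfolding r_def by linarith
  define \<omega>' where "\<omega>' = (1 / r) *\<^sub>R L \<omega>"
  have unit': "norm \<omega>' = 1" using r by (simp add: \<omega>'_def r_def)
  have L\<omega>: "L \<omega> = r *\<^sub>R \<omega>'" using r by (simp add: \<omega>'_def)
  have kill: "perp \<omega>' \<omega>' = 0" using unit_inner[OF unit'] by (simp add: perp_def)
  define v where "v = (1 / \<delta>) *\<^sub>R L a"
  show thesis
  proof (rule that[OF unit'])
    have "norm (\<omega>' - L \<omega>) = \<bar>1 - r\<bar>"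
    proof -
      have "\<omega>' - L \<omega> = (1 - r) *\<^sub>R \<omega>'" by (simp add: L\<omega> algebra_simps)
      then show ?thesis by (simp add: unit')
    qed
    also have "\<dots> = \<bar>norm (axis j (1::real) :: real^'n) - norm (L \<omega>)\<bar>" by (simp add: r_def)
    also have "\<dots> \<le> norm (axis j 1 - L \<omega>)" by (rule norm_triangle_ineq3)
    finally show "norm (\<omega>' - axis j 1) \<le> \<eta>"
      using near norm_triangle_ineq[of "\<omega>' - L \<omega>" "L \<omega> - axis j 1"] by (simp add: norm_minus_commute)
  next
    fix x
    show "indicator T x \<le> exp (2 * (real CARD('n))\<^sup>2) * exp (- (norm (perp \<omega>' ((1 / \<delta>) *\<^sub>R L x - v)))\<^sup>2 / 2)"
    proof (cases "x \<in> T")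
      case True
      have "x - a = (\<omega> \<bullet> (x - a)) *\<^sub>R \<omega> + perp \<omega> (x - a)" by (simp add: perp_def)
      then have "L (x - a) = (\<omega> \<bullet> (x - a)) *\<^sub>R L \<omega> + L (perp \<omega> (x - a))"
        by (metis linear_add[OF L(1)] linear_scale[OF L(1)])
      then have "perp \<omega>' (L (x - a)) = perp \<omega>' (L (perp \<omega> (x - a)))"
        by (simp add: perp_add perp_scaleR L\<omega> kill)
      then have "norm (perp \<omega>' (L (x - a))) \<le> 2 * norm (perp \<omega> (x - a))"
        using norm_perp_le[OF unit', of "L (perp \<omega> (x - a))"] L(2)[of "perp \<omega> (x - a)"] by simp
      also have "\<dots> \<le> 2 * (\<delta> * real CARD('n))" using thin[OF True] by simp
      finally have "(1 / \<delta>) * norm (perp \<omega>' (L (x - a))) \<le> (1 / \<delta>) * (2 * (\<delta> * real CARD('n)))"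
        using \<delta> by (intro mult_left_mono) auto
      moreover have "(1 / \<delta>) *\<^sub>R L x - v = (1 / \<delta>) *\<^sub>R L (x - a)"
        by (simp add: v_def linear_diff[OF L(1)] scaleR_diff_right)
      ultimately have "norm (perp \<omega>' ((1 / \<delta>) *\<^sub>R L x - v)) \<le> 2 * real CARD('n)"
        using \<delta> by (simp add: perp_scaleR)
      then have "(norm (perp \<omega>' ((1 / \<delta>) *\<^sub>R L x - v)))\<^sup>2 \<le> (2 * real CARD('n))\<^sup>2"
        by (intro power_mono) auto
      then have "0 \<le> 2 * (real CARD('n))\<^sup>2 + - (norm (perp \<omega>' ((1 / \<delta>) *\<^sub>R L x - v)))\<^sup>2 / 2"
        by (simp add: power_mult_distrib)
      then have "1 \<le> exp (2 * (real CARD('n))\<^sup>2 + - (norm (perp \<omega>' ((1 / \<delta>) *\<^sub>R L x - v)))\<^sup>2 / 2)"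
        by (simp only: one_le_exp_iff)
      then show ?thesis using True by (simp add: exp_add[symmetric])
    qed simp
  qed
qed

text \<open>The required estimate near one frame \<open>W\<close> of directions, on which the constant \<open>C\<close> may depend.\<close>

definition frame_estimate :: "real \<Rightarrow> real \<Rightarrow> real \<Rightarrow> ('n::finite \<Rightarrow> real^'n) \<Rightarrow> bool" where
  "frame_estimate p \<eta> C W \<longleftrightarrow> 0 \<le> C \<and> (\<forall>\<delta> S c \<omega>. 0 < \<delta> \<longrightarrow> (\<forall>j. finite (S j)) \<longrightarrow>
      (\<forall>j. \<forall>T\<in>S j. 0 < c j T \<and> delta_tube_along \<delta> (\<omega> j T) T \<and> norm (\<omega> j T - W j) \<le> \<eta> / 4) \<longrightarrow>
      (\<integral>\<^sup>+x. ennreal (\<Prod>j\<in>UNIV. (\<Sum>T\<in>S j. c j T * indicator T x) powr p) \<partial>lborel)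
        \<le> ennreal (C * \<delta> ^ CARD('n) * (\<Prod>j\<in>UNIV. sum (c j) (S j) powr p)))"

text \<open>The map \<open>L\<close> that straightens the frame, followed by the dilation by \<open>1 / \<delta>\<close>, turns tubes with
  directions close to \<open>W\<close> into tubes of width comparable to \<open>1\<close> with directions close to the basis.\<close>

lemma tubes_near_frame:
  fixes W :: "'n::finite \<Rightarrow> real^'n"
  assumes p: "0 < p" and C0: "0 \<le> C0"
    and gaussian: "\<And>I :: 'n \<Rightarrow> (real^'n) set set. gaussian_estimate p \<eta> C0 I"
    and W: "\<And>j. norm (W j - axis j 1) \<le> 1 / (2 * real CARD('n))"
  shows "\<exists>C. frame_estimate p \<eta> C W"
proof -
  obtain L :: "real^'n \<Rightarrow> real^'n" where L: "linear L" "\<And>x. norm (L x) \<le> 2 * norm x" "\<And>x. norm x \<le> 2 * norm (L x)"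
    and LW: "\<And>j. L (W j) = axis j 1"
    using frame_map[OF W] by metis
  have [measurable]: "L \<in> borel_measurable borel"
    using L by (intro borel_measurable_continuous_onI linear_continuous_on linear_conv_bounded_linear[THEN iffD1])
  obtain CL where CL: "0 \<le> CL" and change: "\<And>g. g \<in> borel_measurable borel \<Longrightarrow>
    (\<integral>\<^sup>+x. g (L x) \<partial>lborel) \<le> ennreal CL * (\<integral>\<^sup>+x. g x \<partial>lborel)"
    using nn_integral_linear_le[OF L(1) _ L(3)] by (metis zero_less_numeral)
  define E where "E = (\<Prod>(j::'n)\<in>UNIV. exp (2 * (real CARD('n))\<^sup>2) powr p)"
  have E: "0 \<le> E" unfolding E_def by (intro prod_nonneg) simp
  have "frame_estimate p \<eta> (E * CL * C0) W"
    unfolding frame_estimate_def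
  proof (intro conjI allI impI)
    show "0 \<le> E * CL * C0" using E CL C0 by simp
  next
    fix \<delta> :: real and S :: "'n \<Rightarrow> (real^'n) set set" and c :: "'n \<Rightarrow> (real^'n) set \<Rightarrow> real"
      and \<omega> :: "'n \<Rightarrow> (real^'n) set \<Rightarrow> real^'n"
    assume \<delta>: "0 < \<delta>" and fin: "\<forall>j. finite (S j)"
      and tubes: "\<forall>j. \<forall>T\<in>S j. 0 < c j T \<and> delta_tube_along \<delta> (\<omega> j T) T \<and> norm (\<omega> j T - W j) \<le> \<eta> / 4"
    note fin = fin[rule_format]
    have c0: "0 < c j T" and tube: "delta_tube_along \<delta> (\<omega> j T) T" and near: "norm (\<omega> j T - W j) \<le> \<eta> / 4"
      if "T \<in> S j" for j T
      using tubes that by blast+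
    have "\<forall>j T. \<exists>\<omega>' v. T \<in> S j \<longrightarrow> norm \<omega>' = 1 \<and> norm (\<omega>' - axis j 1) \<le> \<eta> \<and>
      (\<forall>x. indicator T x \<le> exp (2 * (real CARD('n))\<^sup>2) * exp (- (norm (perp \<omega>' ((1 / \<delta>) *\<^sub>R L x - v)))\<^sup>2 / 2))" (is "\<forall>j T. ?P j T")
    proof (intro allI)
      fix j T show "?P j T"
    proof (cases "T \<in> S j")
      case True
      have "norm (L (\<omega> j T) - axis j 1) = norm (L (\<omega> j T - W j))"
        by (simp add: linear_diff[OF L(1)] LW)
      also have "\<dots> \<le> \<eta> / 2" using L(2)[of "\<omega> j T - W j"] near[OF True] by simp
      finally have "norm (L (\<omega> j T) - axis j 1) \<le> \<eta> / 2" .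
      from tube_indicator_le[OF tube[OF True] \<delta> L this] show ?thesis by metis
    qed simp
    qed
    then obtain \<omega>' v where \<omega>': "\<And>j T. T \<in> S j \<Longrightarrow> norm (\<omega>' j T) = 1"
      "\<And>j T. T \<in> S j \<Longrightarrow> norm (\<omega>' j T - axis j 1) \<le> \<eta>"
      and dom: "\<And>j T x. T \<in> S j \<Longrightarrow> indicator T x
        \<le> exp (2 * (real CARD('n))\<^sup>2) * exp (- (norm (perp (\<omega>' j T) ((1 / \<delta>) *\<^sub>R L x - v j T)))\<^sup>2 / 2)"
      unfolding choice_iff by blast
    define g where "g x = ennreal (tube_prod S c \<omega>' p v x)" for x
    have [measurable]: "g \<in> borel_measurable borel" unfolding g_def[abs_def] by measurable
    have le: "(\<Prod>j\<in>UNIV. (\<Sum>T\<in>S j. c j T * indicator T x) powr p) \<le> E * tube_prod S c \<omega>' p v ((1 / \<delta>) *\<^sub>R L x)" for x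
    proof -
      let ?f = "\<lambda>j. \<Sum>T\<in>S j. c j T * indicator T x" and ?E = "exp (2 * (real CARD('n))\<^sup>2)"
      let ?G = "\<lambda>j T. exp (- (norm (perp (\<omega>' j T) ((1 / \<delta>) *\<^sub>R L x - v j T)))\<^sup>2 / 2)"
      have "(\<Prod>j\<in>UNIV. ?f j powr p)
        \<le> (\<Prod>j\<in>UNIV. ?E powr p *
          (\<Sum>T\<in>S j. c j T * ?G j T) powr p)"
      proof (intro prod_mono conjI)
        fix j
        have c1: "0 \<le> c j T" if "T \<in> S j" for T using c0[OF that] by simp
        have "?f j \<le> (\<Sum>T\<in>S j. c j T * (?E *
            ?G j T))"
          by (intro sum_mono mult_left_mono dom c1)
        also have "\<dots> = ?E * (\<Sum>T\<in>S j. c j T *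
            ?G j T)"
          by (simp add: sum_distrib_left ac_simps)
        finally have "?f j powr p \<le> (?E * (\<Sum>T\<in>S j. c j T *
            ?G j T)) powr p"
          using p c1 by (intro powr_mono2 sum_nonneg) auto
        then show "?f j powr p \<le> ?E powr p *
          (\<Sum>T\<in>S j. c j T * ?G j T) powr p"
          using c1 by (subst (asm) powr_mult) (auto intro!: sum_nonneg)
      qed simp
      then show ?thesis by (simp add: E_def tube_prod_def prod.distrib)
    qed
    have "(\<integral>\<^sup>+x. ennreal (\<Prod>j\<in>UNIV. (\<Sum>T\<in>S j. c j T * indicator T x) powr p) \<partial>lborel)
      \<le> (\<integral>\<^sup>+x. ennreal E * g ((1 / \<delta>) *\<^sub>R L x) \<partial>lborel)"
      unfolding g_def using E
      by (intro nn_integral_mono) (auto simp: ennreal_mult[symmetric] tube_prod_nonneg intro!: ennreal_leI le)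
    also have "\<dots> = ennreal E * (\<integral>\<^sup>+x. g ((1 / \<delta>) *\<^sub>R L x) \<partial>lborel)"
      by (rule nn_integral_cmult) measurable
    also have "(\<integral>\<^sup>+x. g ((1 / \<delta>) *\<^sub>R L x) \<partial>lborel) = ennreal (\<delta> ^ CARD('n)) * (\<integral>\<^sup>+x. g ((1 / \<delta>) *\<^sub>R L (\<delta> *\<^sub>R x)) \<partial>lborel)"
      using \<delta> by (subst nn_integral_dilate[where r = \<delta>]) simp_all
    also have "(\<integral>\<^sup>+x. g ((1 / \<delta>) *\<^sub>R L (\<delta> *\<^sub>R x)) \<partial>lborel) = (\<integral>\<^sup>+x. g (L x) \<partial>lborel)"
      using \<delta> by (simp add: linear_scale[OF L(1)])
    also have "ennreal E * (ennreal (\<delta> ^ CARD('n)) * (\<integral>\<^sup>+x. g (L x) \<partial>lborel))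
      \<le> ennreal E * (ennreal (\<delta> ^ CARD('n)) * (ennreal CL * ennreal (C0 * (\<Prod>j\<in>UNIV. sum (c j) (S j) powr p))))"
    proof (intro mult_left_mono)
      have "(\<integral>\<^sup>+x. g (L x) \<partial>lborel) \<le> ennreal CL * (\<integral>\<^sup>+x. g x \<partial>lborel)" by (rule change) measurable
      also have "\<dots> \<le> ennreal CL * ennreal (C0 * (\<Prod>j\<in>UNIV. sum (c j) (S j) powr p))"
        unfolding g_def
        by (intro mult_left_mono gaussian[unfolded gaussian_estimate_def, rule_format] fin) (use c0 \<omega>' in auto)
      finally show "(\<integral>\<^sup>+x. g (L x) \<partial>lborel) \<le> ennreal CL * ennreal (C0 * (\<Prod>j\<in>UNIV. sum (c j) (S j) powr p))" .
    qed auto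
    also have "\<dots> = ennreal (E * CL * C0 * \<delta> ^ CARD('n) * (\<Prod>j\<in>UNIV. sum (c j) (S j) powr p))"
      using E CL C0 \<delta> by (simp add: ennreal_mult[symmetric] prod_nonneg ac_simps)
    finally show "(\<integral>\<^sup>+x. ennreal (\<Prod>j\<in>UNIV. (\<Sum>T\<in>S j. c j T * indicator T x) powr p) \<partial>lborel)
        \<le> ennreal (E * CL * C0 * \<delta> ^ CARD('n) * (\<Prod>j\<in>UNIV. sum (c j) (S j) powr p))" .
  qed
  then show ?thesis by blast
qed

section \<open>Transversal families of tubes\<close>

lemma sum_mset_eq_sum_count:
  fixes f :: "'a \<Rightarrow> real"
  shows "(\<Sum>x\<in>#M. f x) = (\<Sum>x\<in>set_mset M. real (count M x) * f x)"
proof (induction M)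
  case (add a M)
  let ?s = "\<Sum>x\<in>insert a (set_mset M). real (count M x) * f x"
  have "(\<Sum>x\<in>set_mset (add_mset a M). real (count (add_mset a M) x) * f x)
     = (\<Sum>x\<in>insert a (set_mset M). real (count M x) * f x + (if x = a then f x else 0))"
    by (intro sum.cong) (auto simp: algebra_simps)
  also have "\<dots> = ?s + f a"
    by (simp add: sum.distrib)
  also have "?s = (\<Sum>x\<in>set_mset M. real (count M x) * f x)"
    by (rule sum.mono_neutral_right) (auto simp: not_in_iff)
  finally show ?case by (simp add: add.IH)
qed simp

text \<open>In each factor the sum is at most the number of summands times the largest one.\<close>

lemma prod_le_sum_over_choices:
  fixes f :: "'j::finite \<Rightarrow> 'w \<Rightarrow> real"
  assumes fin: "\<And>j. finite (K j)" and ne: "\<And>j. K j \<noteq> {}" and f: "\<And>j w. 0 \<le> f j w" and p: "0 < p"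
  shows "(\<Prod>j\<in>UNIV. (\<Sum>w\<in>K j. f j w) powr p)
    \<le> (\<Prod>j\<in>UNIV. real (card (K j)) powr p) * (\<Sum>W\<in>Pi UNIV K. \<Prod>j\<in>UNIV. f j (W j) powr p)"
proof -
  have "\<exists>w\<in>K j. (\<Sum>w\<in>K j. f j w) \<le> real (card (K j)) * f j w" for j
  proof -
    have "Max (f j ` K j) \<in> f j ` K j" using fin ne by simp
    then obtain w where w: "w \<in> K j" "f j w = Max (f j ` K j)" by force
    then have "(\<Sum>w\<in>K j. f j w) \<le> of_nat (card (K j)) * f j w"
      using fin by (intro sum_bounded_above) simp
    with w show ?thesis by (intro bexI[of _ w]) simp_all
  qed
  then obtain W where W: "\<And>j. W j \<in> K j" "\<And>j. (\<Sum>w\<in>K j. f j w) \<le> real (card (K j)) * f j (W j)" by metis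
  have "(\<Prod>j\<in>UNIV. (\<Sum>w\<in>K j. f j w) powr p) \<le> (\<Prod>j\<in>UNIV. (real (card (K j)) * f j (W j)) powr p)"
    using p W(2) f by (intro prod_mono conjI powr_mono2 sum_nonneg) auto
  also have "\<dots> = (\<Prod>j\<in>UNIV. real (card (K j)) powr p) * (\<Prod>j\<in>UNIV. f j (W j) powr p)"
    using f by (simp add: powr_mult prod.distrib)
  also have "\<dots> \<le> (\<Prod>j\<in>UNIV. real (card (K j)) powr p) * (\<Sum>W\<in>Pi UNIV K. \<Prod>j\<in>UNIV. f j (W j) powr p)"
  proof (rule mult_left_mono)
    have "finite (PiE UNIV K)" by (intro finite_PiE fin) simp
    then have "finite (Pi UNIV K)" by (simp add: PiE_UNIV_domain)
    then show "(\<Prod>j\<in>UNIV. f j (W j) powr p) \<le> (\<Sum>W\<in>Pi UNIV K. \<Prod>j\<in>UNIV. f j (W j) powr p)"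
      using W(1) by (intro member_le_sum) (auto intro: prod_nonneg)
  qed (intro prod_nonneg, simp)
  finally show ?thesis .
qed

text \<open>The radius \<open>1 / (2 * d)\<close> makes every choice of one direction from each cap a basis to which
  \<open>frame_map\<close> applies. It does not depend on the exponent.\<close>

definition cap :: "'n::finite \<Rightarrow> (real^'n) set" where
  "cap j = sphere 0 1 \<inter> ball (axis j 1) (1 / (2 * real CARD('n)))"

lemma delta_tube_closed:
  fixes T :: "(real^'n::finite) set"
  assumes "delta_tube_along \<delta> v T"
  shows "closed T"
proof -
  obtain a k and w :: "'n \<Rightarrow> real^'n" where "T = {x. \<forall>i. \<bar>(x - a) \<bullet> w i\<bar> \<le> (if i = k then 1 else \<delta>) / 2}"
    using assms unfolding delta_tube_along_def by blast
  then have "T = (\<Inter>i. {x. \<bar>(x - a) \<bullet> w i\<bar> \<le> (if i = k then 1 else \<delta>) / 2})"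
    by (simp only: Collect_all_eq)
  also have "closed \<dots>" by (intro closed_INT ballI closed_Collect_le continuous_intros)
  finally show ?thesis .
qed

lemma tube_product_measurable:
  assumes "transversal N \<delta> \<T>"
  shows "tube_product \<T> \<in> borel_measurable borel"
proof -
  have "T \<in> sets borel" if "T \<in># \<T> j" for j T
    using assms that delta_tube_closed unfolding transversal_def by (metis borel_closed)
  then show ?thesis
    unfolding tube_product_def[abs_def] sum_mset_eq_sum_count
    by (intro borel_measurable_prod borel_measurable_sum borel_measurable_times borel_measurable_const
      borel_measurable_indicator) simp
qed

lemma tube_product_bounds: "0 \<le> tube_product \<T> x" "tube_product \<T> x \<le> (\<Prod>j\<in>UNIV. real (size (\<T> j)))"
proof -
  let ?s = "\<lambda>j. \<Sum>T\<in>set_mset (\<T> j). real (count (\<T> j) T) * indicator T x"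
  have "?s j \<le> (\<Sum>T\<in>set_mset (\<T> j). real (count (\<T> j) T) * 1)" for j
    by (intro sum_mono mult_left_mono) (auto simp: indicator_def)
  then have "?s j \<le> real (size (\<T> j))" for j
    by (simp add: size_multiset_overloaded_eq)
  then show "tube_product \<T> x \<le> (\<Prod>j\<in>UNIV. real (size (\<T> j)))"
    unfolding tube_product_def sum_mset_eq_sum_count by (intro prod_mono conjI sum_nonneg) auto
  show "0 \<le> tube_product \<T> x"
    unfolding tube_product_def sum_mset_eq_sum_count by (intro prod_nonneg sum_nonneg) simp
qed

text \<open>The Gaussian estimate controls directions within \<open>\<eta> / 4\<close> of a frame, where \<open>\<eta>\<close> depends on \<open>p\<close>. The caps
  are fixed and relatively compact, so finitely many small balls cover each of them.
  Splitting the families accordingly produces finitely many products, one for each choice \<open>W\<close> of a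
  ball in every cap, and each choice of centres is an admissible frame.\<close>

lemma transversal_tubes_powr:
  assumes card: "2 \<le> CARD('n::finite)" and p: "0 < p" "1 < p * (real CARD('n) - 1)"
  obtains C where "0 \<le> C" and "\<And>\<delta> (\<T> :: 'n \<Rightarrow> (real^'n) set multiset). 0 < \<delta> \<Longrightarrow> transversal cap \<delta> \<T> \<Longrightarrow>
    (\<integral>\<^sup>+x. ennreal (tube_product \<T> x powr p) \<partial>lborel)
      \<le> ennreal (C * \<delta> ^ CARD('n) * (\<Prod>j\<in>UNIV. real (size (\<T> j))) powr p)"
proof -
  obtain \<eta> C0 where \<eta>: "0 < \<eta>" and C0: "0 \<le> C0"
    and gaussian: "\<And>I :: 'n \<Rightarrow> (real^'n) set set. gaussian_estimate p \<eta> C0 I"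
    by (rule gaussian_multilinear_kakeya[OF card p]) blast
  define K' :: "'n \<Rightarrow> (real^'n) set" where "K' j = sphere 0 1 \<inter> cball (axis j 1) (1 / (2 * real CARD('n)))" for j
  have "\<exists>k. finite k \<and> k \<subseteq> K' j \<and> K' j \<subseteq> (\<Union>w\<in>k. ball w (\<eta> / 4))" for j
  proof -
    have "compact (K' j)" unfolding K'_def by (intro compact_Int_closed) auto
    then show ?thesis using \<eta> seq_compact_imp_totally_bounded[of "K' j"]
      by (simp add: compact_eq_seq_compact_metric)
  qed
  then obtain K where K: "\<And>j. finite (K j)" "\<And>j. K j \<subseteq> K' j" "\<And>j. K' j \<subseteq> (\<Union>w\<in>K j. ball w (\<eta> / 4))"
    by metis
  have "axis j 1 \<in> K' j" for j by (simp add: K'_def)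
  then have Kne: "K j \<noteq> {}" for j using K(3)[of j] by auto
  have "\<exists>C. W \<in> Pi UNIV K \<longrightarrow> frame_estimate p \<eta> C W" for W
  proof (cases "W \<in> Pi UNIV K")
    case True
    have near: "norm (W j - axis j 1) \<le> 1 / (2 * real CARD('n))" for j
    proof -
      have "W j \<in> K' j" using True K(2) by auto
      then show ?thesis by (simp add: K'_def dist_norm norm_minus_commute)
    qed
    have "\<exists>C. frame_estimate p \<eta> C W"
      by (rule tubes_near_frame[OF p(1) C0 gaussian near])
    then show ?thesis by blast
  qed simp
  then obtain CW where CW: "\<And>W. W \<in> Pi UNIV K \<Longrightarrow> frame_estimate p \<eta> (CW W) W" by metis
  define B where "B = (\<Prod>j\<in>UNIV. real (card (K j)) powr p)"
  have B: "0 \<le> B" unfolding B_def by (intro prod_nonneg) simp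
  have CW0: "0 \<le> CW W" if "W \<in> Pi UNIV K" for W using CW[OF that] by (simp add: frame_estimate_def)
  show thesis
  proof (rule that[of "B * (\<Sum>W\<in>Pi UNIV K. CW W)"])
    show "0 \<le> B * (\<Sum>W\<in>Pi UNIV K. CW W)" using B CW0 by (intro mult_nonneg_nonneg sum_nonneg) auto
  next
    fix \<delta> :: real and \<T> :: "'n \<Rightarrow> (real^'n) set multiset"
    assume \<delta>: "0 < \<delta>" and "transversal cap \<delta> \<T>"
    then have "\<forall>j T. \<exists>v. T \<in># \<T> j \<longrightarrow> v \<in> cap j \<and> delta_tube_along \<delta> v T"
      unfolding transversal_def by blast
    then obtain \<omega> where \<omega>: "\<And>j T. T \<in># \<T> j \<Longrightarrow> \<omega> j T \<in> cap j" "\<And>j T. T \<in># \<T> j \<Longrightarrow> delta_tube_along \<delta> (\<omega> j T) T"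
      unfolding choice_iff by blast
    have "\<forall>j T. \<exists>w. T \<in># \<T> j \<longrightarrow> w \<in> K j \<and> norm (\<omega> j T - w) \<le> \<eta> / 4"
    proof (intro allI)
      fix j T
      show "\<exists>w. T \<in># \<T> j \<longrightarrow> w \<in> K j \<and> norm (\<omega> j T - w) \<le> \<eta> / 4"
      proof (cases "T \<in># \<T> j")
        case True
        have "\<omega> j T \<in> K' j" using \<omega>(1)[OF True] by (auto simp: cap_def K'_def)
        then obtain w where "w \<in> K j" "\<omega> j T \<in> ball w (\<eta> / 4)" using K(3) by blast
        then show ?thesis by (intro exI[of _ w]) (auto simp: dist_norm norm_minus_commute less_imp_le)
      qed simp
    qed
    then obtain k where k: "\<And>j T. T \<in># \<T> j \<Longrightarrow> k j T \<in> K j" "\<And>j T. T \<in># \<T> j \<Longrightarrow> norm (\<omega> j T - k j T) \<le> \<eta> / 4"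
      unfolding choice_iff by blast
    define c where "c j T = real (count (\<T> j) T)" for j T
    define S where "S j w = {T \<in> set_mset (\<T> j). k j T = w}" for j w
    define f where "f j w x = (\<Sum>T\<in>S j w. c j T * indicator T x)" for j w and x :: "real^'n"
    have f0: "0 \<le> f j w x" for j w x unfolding f_def c_def by (intro sum_nonneg) simp
    have split: "(\<Sum>w\<in>K j. \<Sum>T\<in>S j w. h T) = (\<Sum>T\<in>set_mset (\<T> j). h T)" for h :: "(real^'n) set \<Rightarrow> real" and j
      unfolding S_def using k(1) by (intro sum.group K(1)) auto
    have product: "tube_product \<T> x powr p = (\<Prod>j\<in>UNIV. (\<Sum>w\<in>K j. f j w x) powr p)" for x
      unfolding tube_product_def sum_mset_eq_sum_count f_def c_def split
      by (subst prod_powr_distrib) (auto intro: sum_nonneg)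
    have size: "sum (c j) (S j w) \<le> real (size (\<T> j))" for j w
    proof -
      have "sum (c j) (S j w) \<le> sum (c j) (set_mset (\<T> j))"
        by (rule sum_mono2) (auto simp: S_def c_def)
      also have "\<dots> = real (size (\<T> j))" by (simp add: c_def size_multiset_overloaded_eq)
      finally show ?thesis .
    qed
    define P where "P = (\<Prod>j\<in>UNIV. real (size (\<T> j))) powr p"
    have P: "0 \<le> P" by (simp add: P_def)
    have pieces: "(\<integral>\<^sup>+x. ennreal (\<Prod>j\<in>UNIV. f j (W j) x powr p) \<partial>lborel) \<le> ennreal (CW W * \<delta> ^ CARD('n) * P)"
      if W: "W \<in> Pi UNIV K" for W
    proof -
      have "(\<integral>\<^sup>+x. ennreal (\<Prod>j\<in>UNIV. f j (W j) x powr p) \<partial>lborel)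
        \<le> ennreal (CW W * \<delta> ^ CARD('n) * (\<Prod>j\<in>UNIV. sum (c j) (S j (W j)) powr p))"
      proof -
        have tubes: "0 < c j T \<and> delta_tube_along \<delta> (\<omega> j T) T \<and> norm (\<omega> j T - W j) \<le> \<eta> / 4" if "T \<in> S j (W j)" for j T
        proof -
          have T: "T \<in># \<T> j" "k j T = W j" using that by (auto simp: S_def)
          show ?thesis using \<omega>(2)[OF T(1)] k(2)[OF T(1)] T by (simp add: c_def)
        qed
        have finS: "finite (S j (W j))" for j by (simp add: S_def)
        show ?thesis unfolding f_def
          by (rule CW[OF W, unfolded frame_estimate_def, THEN conjunct2, rule_format,
                of \<delta> "\<lambda>j. S j (W j)" c \<omega>, OF \<delta> finS tubes])
      qed
      also have "\<dots> \<le> ennreal (CW W * \<delta> ^ CARD('n) * P)"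
      proof (intro ennreal_leI mult_left_mono)
        have "(\<Prod>j\<in>UNIV. sum (c j) (S j (W j)) powr p) \<le> (\<Prod>j\<in>UNIV. real (size (\<T> j)) powr p)"
          using p size by (intro prod_mono conjI powr_mono2) (auto simp: c_def intro: sum_nonneg)
        also have "\<dots> = P" unfolding P_def by (subst prod_powr_distrib) auto
        finally show "(\<Prod>j\<in>UNIV. sum (c j) (S j (W j)) powr p) \<le> P" .
      qed (use CW0[OF W] \<delta> in auto)
      finally show ?thesis .
    qed
    have tube_borel: "T \<in> sets borel" if "T \<in># \<T> j" for j T
      by (rule borel_closed[OF delta_tube_closed[OF \<omega>(2)[OF that]]])
    have [measurable]: "f j w \<in> borel_measurable borel" for j w
      unfolding f_def[abs_def]
      by (intro borel_measurable_sum borel_measurable_times borel_measurable_const borel_measurable_indicator)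
         (auto simp: S_def intro: tube_borel)
    have finPi: "finite (Pi UNIV K)"
      using finite_PiE[of UNIV K] K(1) by (simp add: PiE_UNIV_domain)
    have "(\<integral>\<^sup>+x. ennreal (tube_product \<T> x powr p) \<partial>lborel)
      \<le> (\<integral>\<^sup>+x. ennreal B * (\<Sum>W\<in>Pi UNIV K. ennreal (\<Prod>j\<in>UNIV. f j (W j) x powr p)) \<partial>lborel)"
    proof (rule nn_integral_mono)
      fix x
      have "tube_product \<T> x powr p \<le> B * (\<Sum>W\<in>Pi UNIV K. \<Prod>j\<in>UNIV. f j (W j) x powr p)"
        unfolding product B_def by (rule prod_le_sum_over_choices[OF K(1) Kne f0 p(1)])
      then show "ennreal (tube_product \<T> x powr p) \<le> ennreal B * (\<Sum>W\<in>Pi UNIV K. ennreal (\<Prod>j\<in>UNIV. f j (W j) x powr p))"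
        using B by (simp add: sum_ennreal prod_nonneg ennreal_mult[symmetric] sum_nonneg ennreal_leI)
    qed
    also have "\<dots> = ennreal B * (\<Sum>W\<in>Pi UNIV K. \<integral>\<^sup>+x. ennreal (\<Prod>j\<in>UNIV. f j (W j) x powr p) \<partial>lborel)"
      by (simp add: nn_integral_cmult nn_integral_sum)
    also have "\<dots> \<le> ennreal B * (\<Sum>W\<in>Pi UNIV K. ennreal (CW W * \<delta> ^ CARD('n) * P))"
      by (intro mult_left_mono sum_mono pieces) auto
    also have "\<dots> = ennreal (B * (\<Sum>W\<in>Pi UNIV K. CW W) * \<delta> ^ CARD('n) * P)"
      using B CW0 \<delta> P
      by (subst sum_ennreal) (auto simp: ennreal_mult[symmetric] sum_nonneg sum_distrib_right mult.assoc)
    finally show "(\<integral>\<^sup>+x. ennreal (tube_product \<T> x powr p) \<partial>lborel)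
      \<le> ennreal (B * (\<Sum>W\<in>Pi UNIV K. CW W) * \<delta> ^ CARD('n) * (\<Prod>j\<in>UNIV. real (size (\<T> j))) powr p)"
      unfolding P_def .
  qed
qed

lemma Lr_norm_le:
  assumes p: "0 < p" and B: "0 \<le> B" and I: "(\<integral>\<^sup>+x. ennreal (\<bar>f x\<bar> powr p) \<partial>M) \<le> ennreal B"
  shows "Lr_norm (ennreal p) M f \<le> ennreal (B powr (1 / p))"
proof -
  define I where "I = (\<integral>\<^sup>+x. ennreal (\<bar>f x\<bar> powr p) \<partial>M)"
  have "I < \<infinity>" using assms(3) unfolding I_def by (rule order_le_less_trans) simp
  then have "I \<noteq> \<infinity>" by simp
  have "enn2real I \<le> B" using enn2real_mono[OF assms(3)] B by (simp add: I_def)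
  then have "enn2real I powr (1 / p) \<le> B powr (1 / p)" using p by (intro powr_mono2) simp_all
  then show ?thesis
    using p \<open>I \<noteq> \<infinity>\<close> by (simp add: Lr_norm_def I_def[symmetric] ennreal_leI)
qed

text \<open>For \<open>q < \<infinity>\<close> this is \<open>transversal_tubes_powr\<close> for \<open>p = q / d\<close>, where \<open>\<delta> ^ d\<close> turns into
  \<open>\<delta> powr (d / p) = (\<delta> powr (d / q)) ^ d\<close>. For \<open>q = \<infinity>\<close> the pointwise bound suffices.\<close>

lemma strong_type_estimate:
  assumes card: "2 \<le> CARD('n::finite)" and q: "ennreal (real CARD('n) / (real CARD('n) - 1)) < q"
  shows "\<exists>C::ennreal. C < \<infinity> \<and> (\<forall>(\<delta>::real) (\<T> :: 'n \<Rightarrow> (real^'n) set multiset). 0 < \<delta> \<and> \<delta> \<le> 1 \<and> transversal cap \<delta> \<T> \<longrightarrow>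
          Lr_norm (q / of_nat CARD('n)) lborel (tube_product \<T>)
            \<le> C * ennreal (\<Prod>j\<in>UNIV. \<delta> powr enn2real (of_nat CARD('n) / q) * real (size (\<T> j))))"
proof (cases q)
  case top
  have "Lr_norm (q / of_nat CARD('n)) lborel (tube_product \<T>)
      \<le> 1 * ennreal (\<Prod>j\<in>UNIV. \<delta> powr enn2real (of_nat CARD('n) / q) * real (size (\<T> j)))"
    if "0 < \<delta>" "transversal cap \<delta> \<T>" for \<delta> and \<T> :: "'n \<Rightarrow> (real^'n) set multiset"
  proof -
    have [measurable]: "tube_product \<T> \<in> borel_measurable borel" by (rule tube_product_measurable[OF that(2)])
    have "q / of_nat CARD('n) = \<infinity>" unfolding top by (simp add: ennreal_top_divide)
    then have "Lr_norm (q / of_nat CARD('n)) lborel (tube_product \<T>) = esssup lborel (\<lambda>x. ennreal \<bar>tube_product \<T> x\<bar>)"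
      by (simp add: Lr_norm_def)
    also have "\<dots> \<le> ennreal (\<Prod>j\<in>UNIV. real (size (\<T> j)))"
      by (intro esssup_I AE_I2 ennreal_leI) (simp_all add: tube_product_bounds)
    finally show ?thesis using that(1) by (simp add: top)
  qed
  then show ?thesis by (intro exI[of _ 1]) auto
next
  case (real r)
  define d where "d = real CARD('n)"
  have d: "2 \<le> d" using card by (simp add: d_def)
  have r: "d / (d - 1) < r" using q d unfolding real d_def[symmetric] by (subst (asm) ennreal_less_iff) auto
  then have r0: "0 < r" using d by (meson divide_pos_pos less_trans diff_gt_0_iff_gt dual_order.strict_trans1 one_less_numeral_iff semiring_norm(76) zero_less_numeral)
  define p where "p = r / d"
  have p: "0 < p" "1 < p * (real CARD('n) - 1)"
    using r r0 d by (simp_all add: p_def d_def[symmetric] field_simps)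
  obtain C where C: "0 \<le> C" and est: "\<And>\<delta> (\<T> :: 'n \<Rightarrow> (real^'n) set multiset). 0 < \<delta> \<Longrightarrow> transversal cap \<delta> \<T> \<Longrightarrow>
    (\<integral>\<^sup>+x. ennreal (tube_product \<T> x powr p) \<partial>lborel)
      \<le> ennreal (C * \<delta> ^ CARD('n) * (\<Prod>j\<in>UNIV. real (size (\<T> j))) powr p)"
    using transversal_tubes_powr[OF card p] by blast
  have "Lr_norm (q / of_nat CARD('n)) lborel (tube_product \<T>)
      \<le> ennreal (C powr (1 / p)) * ennreal (\<Prod>j\<in>UNIV. \<delta> powr enn2real (of_nat CARD('n) / q) * real (size (\<T> j)))"
    if \<delta>: "0 < \<delta>" and tr: "transversal cap \<delta> \<T>" for \<delta> and \<T> :: "'n \<Rightarrow> (real^'n) set multiset"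
  proof -
    define m where "m = (\<Prod>j\<in>UNIV. real (size (\<T> j)))"
    have m: "0 \<le> m" unfolding m_def by (intro prod_nonneg) simp
    have qd: "q / of_nat CARD('n) = ennreal p" and dq: "enn2real (of_nat CARD('n) / q) = d / r"
      using r0 d by (simp_all add: real p_def d_def[symmetric] ennreal_of_nat_eq_real_of_nat divide_ennreal)
    have "(\<Prod>(j::'n)\<in>UNIV. \<delta> powr (d / r)) = (\<delta> powr d) powr (1 / p)"
      using \<delta> r0 d by (simp add: powr_powr powr_realpow[symmetric] p_def d_def[symmetric])
    then have rhs: "(\<Prod>j\<in>UNIV. \<delta> powr enn2real (of_nat CARD('n) / q) * real (size (\<T> j))) = (\<delta> powr d) powr (1 / p) * m"
      by (simp add: dq prod.distrib m_def)
    have "(\<integral>\<^sup>+x. ennreal (\<bar>tube_product \<T> x\<bar> powr p) \<partial>lborel) \<le> ennreal (C * \<delta> powr d * m powr p)"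
      using est[OF \<delta> tr] \<delta> by (simp add: tube_product_bounds m_def d_def powr_realpow)
    then have "Lr_norm (ennreal p) lborel (tube_product \<T>) \<le> ennreal ((C * \<delta> powr d * m powr p) powr (1 / p))"
      using C p by (intro Lr_norm_le) auto
    also have "(C * \<delta> powr d * m powr p) powr (1 / p) = C powr (1 / p) * ((\<delta> powr d) powr (1 / p) * m)"
      using C m p by (simp add: powr_mult powr_powr)
    finally show ?thesis
      using m by (simp add: qd rhs ennreal_mult)
  qed
  then show ?thesis by (intro exI[of _ "ennreal (C powr (1 / p))"]) auto
qed

text \<open>On the unit ball the exponent \<open>p0 = 1 / (d - 1)\<close> is reached from a slightly larger exponent \<open>p\<close>, with
  \<open>d / p = d * (d - 1) - e\<close>, so that the scale invariant bound differs from the claimed one by a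
  factor \<open>\<delta> powr (- e)\<close>. In place of Hoelder's inequality, the function is compared with the level \<open>l\<close>
  that is natural for the exponent \<open>p\<close>.\<close>

lemma endpoint_estimate:
  assumes card: "2 \<le> CARD('n::finite)" and \<epsilon>: "0 < (\<epsilon>::real)"
  shows "\<exists>C::ennreal. C < \<infinity> \<and> (\<forall>(\<delta>::real) (\<T> :: 'n \<Rightarrow> (real^'n) set multiset). 0 < \<delta> \<and> \<delta> \<le> 1 \<and> transversal cap \<delta> \<T> \<longrightarrow>
          Lr_norm (ennreal (1 / (real CARD('n) - 1))) (restrict_space lborel (ball 0 1)) (tube_product \<T>)
            \<le> C * ennreal (\<delta> powr (- \<epsilon>) * (\<Prod>j\<in>UNIV. \<delta> ^ (CARD('n) - 1) * real (size (\<T> j)))))"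
proof -
  define d where "d = real CARD('n)"
  have d: "2 \<le> d" using card by (simp add: d_def)
  define p0 where "p0 = 1 / (d - 1)"
  define D where "D = d * (d - 1)"
  define e where "e = min \<epsilon> (D / 2)"
  have D: "0 < D" using d by (simp add: D_def)
  have e: "0 < e" "e \<le> \<epsilon>" "e < D" using \<epsilon> D by (auto simp: e_def)
  define p where "p = d / (D - e)"
  have p0: "0 < p0" using d by (simp add: p0_def)
  have p: "0 < p" "1 < p * (real CARD('n) - 1)"
  proof -
    show "0 < p" using d e by (simp add: p_def)
    have "p * (d - 1) = D / (D - e)" by (simp add: p_def D_def)
    then show "1 < p * (real CARD('n) - 1)" using e D by (simp add: d_def[symmetric])
  qed
  have p0_le: "p0 \<le> p"
    using p(2) d by (simp add: p0_def d_def[symmetric] field_simps)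
  obtain C where C: "0 \<le> C" and est: "\<And>\<delta> (\<T> :: 'n \<Rightarrow> (real^'n) set multiset). 0 < \<delta> \<Longrightarrow> transversal cap \<delta> \<T> \<Longrightarrow>
    (\<integral>\<^sup>+x. ennreal (tube_product \<T> x powr p) \<partial>lborel)
      \<le> ennreal (C * \<delta> ^ CARD('n) * (\<Prod>j\<in>UNIV. real (size (\<T> j))) powr p)"
    using transversal_tubes_powr[OF card p] by blast
  define b where "b = measure lborel (ball (0::real^'n) 1)"
  have b: "0 \<le> b" "emeasure lborel (ball (0::real^'n) 1) = ennreal b"
    unfolding b_def using emeasure_lborel_ball_finite[of "0::real^'n" 1]
    by (auto intro!: emeasure_eq_ennreal_measure)
  have "Lr_norm (ennreal p0) (restrict_space lborel (ball 0 1)) (tube_product \<T>)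
      \<le> ennreal ((b + C) powr (1 / p0)) * ennreal (\<delta> powr (- \<epsilon>) * (\<Prod>j\<in>UNIV. \<delta> ^ (CARD('n) - 1) * real (size (\<T> j))))"
    if \<delta>: "0 < \<delta>" "\<delta> \<le> 1" and tr: "transversal cap \<delta> \<T>" for \<delta> and \<T> :: "'n \<Rightarrow> (real^'n) set multiset"
  proof -
    have [measurable]: "tube_product \<T> \<in> borel_measurable borel" by (rule tube_product_measurable[OF tr])
    have F: "(\<lambda>x. ennreal (tube_product \<T> x powr p)) \<in> borel_measurable lborel" by measurable
    have [measurable]: "ball (0::real^'n) 1 \<in> sets borel" by simp
    have ball: "(\<lambda>x::real^'n. ennreal r * indicator (ball 0 1) x) \<in> borel_measurable lborel" for r
      by measurable
    have cF: "(\<lambda>x. ennreal r * ennreal (tube_product \<T> x powr p)) \<in> borel_measurable lborel" for r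
      by measurable
    define m where "m = (\<Prod>j\<in>UNIV. real (size (\<T> j)))"
    have m: "0 \<le> m" unfolding m_def by (intro prod_nonneg) simp
    let ?P = "\<Prod>j\<in>UNIV. \<delta> ^ (CARD('n) - 1) * real (size (\<T> j))" and ?I = "\<integral>\<^sup>+x. ennreal (tube_product \<T> x powr p) \<partial>lborel"
    define l where "l = \<delta> powr (D - e) * m"
    have l: "0 \<le> l" using m by (simp add: l_def)
    have pointwise: "tube_product \<T> x powr p0 \<le> l powr p0 + l powr (p0 - p) * tube_product \<T> x powr p" for x
    proof (cases "tube_product \<T> x \<le> l")
      case True
      then have "tube_product \<T> x powr p0 \<le> l powr p0"
        using p0 tube_product_bounds(1) by (intro powr_mono2) auto
      then show ?thesis by (simp add: add_increasing2)
    next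
      case False
      have "0 < l"
      proof (rule ccontr)
        assume "\<not> 0 < l"
        then have "m = 0" using l \<delta> by (simp add: l_def)
        then show False using tube_product_bounds(2)[of \<T> x] False l unfolding m_def[symmetric] by linarith
      qed
      have "tube_product \<T> x powr p0 = tube_product \<T> x powr (p0 - p) * tube_product \<T> x powr p"
        by (simp add: powr_add[symmetric])
      also have "\<dots> \<le> l powr (p0 - p) * tube_product \<T> x powr p"
        using False \<open>0 < l\<close> p0_le by (intro mult_right_mono powr_mono2') auto
      finally show ?thesis by (simp add: add_increasing)
    qed
    have lp: "l powr p = \<delta> ^ CARD('n) * m powr p"
      using \<delta> m e d by (simp add: l_def powr_mult powr_powr p_def powr_realpow[symmetric] d_def[symmetric])
    have "(\<integral>\<^sup>+x. ennreal (\<bar>tube_product \<T> x\<bar> powr p0) \<partial>restrict_space lborel (ball 0 1))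
      = (\<integral>\<^sup>+x. ennreal (tube_product \<T> x powr p0) * indicator (ball 0 1) x \<partial>lborel)"
      by (simp add: nn_integral_restrict_space tube_product_bounds)
    also have "\<dots> \<le> (\<integral>\<^sup>+x. ennreal (l powr p0) * indicator (ball 0 1) x
        + ennreal (l powr (p0 - p)) * ennreal (tube_product \<T> x powr p) \<partial>lborel)"
    proof (rule nn_integral_mono)
      fix x :: "real^'n"
      show "ennreal (tube_product \<T> x powr p0) * indicator (ball 0 1) x
        \<le> ennreal (l powr p0) * indicator (ball 0 1) x + ennreal (l powr (p0 - p)) * ennreal (tube_product \<T> x powr p)"
        using pointwise[of x]
        by (auto simp: indicator_def ennreal_mult[symmetric] ennreal_plus[symmetric] intro!: ennreal_leI simp del: ennreal_plus)
    qed
    also have "\<dots> = (\<integral>\<^sup>+x. ennreal (l powr p0) * indicator (ball (0::real^'n) 1) x \<partial>lborel)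
        + (\<integral>\<^sup>+x. ennreal (l powr (p0 - p)) * ennreal (tube_product \<T> x powr p) \<partial>lborel)"
      by (rule nn_integral_add[OF ball cF])
    also have "(\<integral>\<^sup>+x. ennreal (l powr p0) * indicator (ball (0::real^'n) 1) x \<partial>lborel) = ennreal (l powr p0) * ennreal b"
      by (subst nn_integral_cmult_indicator) (simp_all only: b(2), simp)
    also have "(\<integral>\<^sup>+x. ennreal (l powr (p0 - p)) * ennreal (tube_product \<T> x powr p) \<partial>lborel)
        = ennreal (l powr (p0 - p)) * ?I"
      by (rule nn_integral_cmult[OF F])
    also have "ennreal (l powr p0) * ennreal b
        + ennreal (l powr (p0 - p)) * ?I
      \<le> ennreal (l powr p0) * ennreal b + ennreal (l powr (p0 - p)) * ennreal (C * l powr p)"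
      using est[OF \<delta>(1) tr] by (intro add_left_mono mult_left_mono) (auto simp: lp m_def mult.assoc)
    also have "\<dots> = ennreal (l powr p0 * (b + C))"
    proof -
      have "l powr (p0 - p) * l powr p = l powr p0" by (simp add: powr_add[symmetric])
      then have "l powr p0 * b + l powr (p0 - p) * (C * l powr p) = l powr p0 * (b + C)"
        by (simp add: algebra_simps)
      then show ?thesis using b(1) C
        by (simp add: ennreal_mult[symmetric] ennreal_plus[symmetric] del: ennreal_plus)
    qed
    finally have "(\<integral>\<^sup>+x. ennreal (\<bar>tube_product \<T> x\<bar> powr p0) \<partial>restrict_space lborel (ball 0 1))
      \<le> ennreal (l powr p0 * (b + C))" .
    then have "Lr_norm (ennreal p0) (restrict_space lborel (ball 0 1)) (tube_product \<T>) \<le> ennreal ((l powr p0 * (b + C)) powr (1 / p0))"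
      using p0 b(1) C by (intro Lr_norm_le) auto
    also have "(l powr p0 * (b + C)) powr (1 / p0) = (b + C) powr (1 / p0) * l"
      using p0 b(1) C l by (simp add: powr_mult powr_powr)
    also have "ennreal ((b + C) powr (1 / p0) * l)
      \<le> ennreal ((b + C) powr (1 / p0) * (\<delta> powr (- \<epsilon>) * ?P))"
    proof (intro ennreal_leI mult_left_mono)
      have "real (CARD('n) - 1) = d - 1" using card by (simp add: d_def of_nat_diff)
      then have "(\<Prod>(j::'n)\<in>UNIV. \<delta> ^ (CARD('n) - 1)) = \<delta> powr D"
        using \<delta> by (simp add: powr_realpow[symmetric] powr_powr D_def d_def[symmetric] mult.commute)
      then have "\<delta> powr (- \<epsilon>) * ?P = \<delta> powr (D - \<epsilon>) * m"
        by (simp add: prod.distrib m_def powr_add[symmetric] mult.assoc[symmetric])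
      moreover have "\<delta> powr (D - e) \<le> \<delta> powr (D - \<epsilon>)"
        using \<delta> e by (intro powr_mono') auto
      ultimately show "l \<le> \<delta> powr (- \<epsilon>) * ?P"
        using m by (simp add: l_def mult_right_mono)
    qed simp
    finally show ?thesis by (simp add: ennreal_mult')
  qed
  then show ?thesis unfolding p0_def d_def by (intro exI[of _ "ennreal ((b + C) powr (1 / (1 / (real CARD('n) - 1))))"]) auto
qed

theorem theorem1p15:
  assumes "CARD('n::finite) \<ge> 2"
  shows "\<exists>N :: 'n \<Rightarrow> (real^'n) set.
    (\<forall>j. openin (top_of_set (sphere 0 1)) (N j) \<and> axis j 1 \<in> N j) \<and>
    (\<forall>q::ennreal. ennreal (real CARD('n) / (real CARD('n) - 1)) < q \<longrightarrow>
      (\<exists>C::ennreal. C < \<infinity> \<and>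
        (\<forall>(\<delta>::real) \<T>. 0 < \<delta> \<and> \<delta> \<le> 1 \<and> transversal N \<delta> \<T> \<longrightarrow>
          Lr_norm (q / of_nat CARD('n)) lborel (tube_product \<T>)
            \<le> C * ennreal (\<Prod>j\<in>UNIV. \<delta> powr enn2real (of_nat CARD('n) / q) * real (size (\<T> j)))))) \<and>
    (\<forall>\<epsilon>::real. \<epsilon> > 0 \<longrightarrow>
      (\<exists>C::ennreal. C < \<infinity> \<and>
        (\<forall>(\<delta>::real) \<T>. 0 < \<delta> \<and> \<delta> \<le> 1 \<and> transversal N \<delta> \<T> \<longrightarrow>
          Lr_norm (ennreal (1 / (real CARD('n) - 1))) (restrict_space lborel (ball 0 1)) (tube_product \<T>)
            \<le> C * ennreal (\<delta> powr (- \<epsilon>) * (\<Prod>j\<in>UNIV. \<delta> ^ (CARD('n) - 1) * real (size (\<T> j)))))))"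
proof (rule exI[of _ cap], intro conjI)
  show "\<forall>j::'n. openin (top_of_set (sphere 0 1)) (cap j) \<and> axis j 1 \<in> cap j"
    by (simp add: cap_def openin_open_Int)
qed (use strong_type_estimate[OF assms] endpoint_estimate[OF assms] in \<open>blast+\<close>)

end
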